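(* Let $A/B$ be a QF ring extension. Then $A/B$ is left D2 (left depth two) if and only if $A/B$ is right D2 (right depth two).
   Context: Rings are unital. $X^{(n)}$ denotes the direct sum of $n$ copies of $X$. For bimodules $X,Y$ over the same pair of rings, $X\,|\,Y$ means $X\oplus P\cong Y^{(n)}$ for some bimodule $P$ and some $n\in\mathbb{N}$, and $X\sim Y$ (similar) means $X\,|\,Y$ and $Y\,|\,X$. A ring extension $A/B$ is a unital ring homomorphism $B\to A$ (not necessarily injective), via which $A$ is a natural $B$-bimodule. $({}_BA)^*=\mathrm{Hom}({}_BA,{}_BB)$ is an $(A,B)$-bimodule via $(a\cdot f\cdot b)(x)=f(xa)b$, and $(A_B)^*=\mathrm{Hom}(A_B,B_B)$ is a $(B,A)$-bimodule via $(b\cdot g\cdot a)(x)=b\,g(ax)$. QF extension: $A/B$ is left QF if ${}_BA$ is finitely generated projective and $A\,|\,({}_BA)^*$ as $(A,B)$-bimodules; right QF if $A_B$ is finitely generated projective and $A\,|\,(A_B)^*$ as $(B,A)$-bimodules; QF if both left and right QF. Depth two: $A/B$ is right D2 if $A\otimes_BA\sim A$ as natural $(A,B)$-bimodules, and left D2 if $A\otimes_BA\sim A$ as natural $(B,A)$-bimodules. *)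

theory Defs
  imports "HOL-Algebra.Module" "HOL-Algebra.RingHom" "HOL-Algebra.Free_Abelian_Groups"
begin

section \<open>Modules and bimodules over arbitrary rings\<close>

text \<open>
  The library locale \<open>module\<close> requires a commutative ring of scalars; only its record type is
  reused here.  As in the library, the record of a module extends that of a ring, and the
  fields \<open>mult\<close> and \<open>one\<close> of a module carry no meaning.
\<close>

locale left_module = R?: ring R + M?: abelian_group M
  for R :: "('r, 'i) ring_scheme" (structure) and M :: "('r, 'm, 'j) module_scheme" (structure) +
  assumes smult_closed:
      "\<lbrakk>r \<in> carrier R; x \<in> carrier M\<rbrakk> \<Longrightarrow> r \<odot>\<^bsub>M\<^esub> x \<in> carrier M"
    and smult_l_distr:
      "\<lbrakk>r \<in> carrier R; r' \<in> carrier R; x \<in> carrier M\<rbrakk> \<Longrightarrow>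
        (r \<oplus>\<^bsub>R\<^esub> r') \<odot>\<^bsub>M\<^esub> x = r \<odot>\<^bsub>M\<^esub> x \<oplus>\<^bsub>M\<^esub> r' \<odot>\<^bsub>M\<^esub> x"
    and smult_r_distr:
      "\<lbrakk>r \<in> carrier R; x \<in> carrier M; y \<in> carrier M\<rbrakk> \<Longrightarrow>
        r \<odot>\<^bsub>M\<^esub> (x \<oplus>\<^bsub>M\<^esub> y) = r \<odot>\<^bsub>M\<^esub> x \<oplus>\<^bsub>M\<^esub> r \<odot>\<^bsub>M\<^esub> y"
    and smult_assoc:
      "\<lbrakk>r \<in> carrier R; r' \<in> carrier R; x \<in> carrier M\<rbrakk> \<Longrightarrow>
        (r \<otimes>\<^bsub>R\<^esub> r') \<odot>\<^bsub>M\<^esub> x = r \<odot>\<^bsub>M\<^esub> (r' \<odot>\<^bsub>M\<^esub> x)"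
    and smult_one:
      "x \<in> carrier M \<Longrightarrow> \<one>\<^bsub>R\<^esub> \<odot>\<^bsub>M\<^esub> x = x"

record ('r, 's, 'm) bimodule = "('r, 'm) module" +
  rsmult :: "['m, 's] \<Rightarrow> 'm" (infixl \<open>\<bullet>\<index>\<close> 70)

locale right_module = S?: ring S + M?: abelian_group M
  for S :: "('s, 'h) ring_scheme" (structure)
    and M :: "('r, 's, 'm, 'j) bimodule_scheme" (structure) +
  assumes rsmult_closed:
      "\<lbrakk>x \<in> carrier M; s \<in> carrier S\<rbrakk> \<Longrightarrow> x \<bullet>\<^bsub>M\<^esub> s \<in> carrier M"
    and rsmult_r_distr:
      "\<lbrakk>x \<in> carrier M; s \<in> carrier S; s' \<in> carrier S\<rbrakk> \<Longrightarrow>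
        x \<bullet>\<^bsub>M\<^esub> (s \<oplus>\<^bsub>S\<^esub> s') = x \<bullet>\<^bsub>M\<^esub> s \<oplus>\<^bsub>M\<^esub> x \<bullet>\<^bsub>M\<^esub> s'"
    and rsmult_l_distr:
      "\<lbrakk>x \<in> carrier M; y \<in> carrier M; s \<in> carrier S\<rbrakk> \<Longrightarrow>
        (x \<oplus>\<^bsub>M\<^esub> y) \<bullet>\<^bsub>M\<^esub> s = x \<bullet>\<^bsub>M\<^esub> s \<oplus>\<^bsub>M\<^esub> y \<bullet>\<^bsub>M\<^esub> s"
    and rsmult_assoc:
      "\<lbrakk>x \<in> carrier M; s \<in> carrier S; s' \<in> carrier S\<rbrakk> \<Longrightarrow>
        x \<bullet>\<^bsub>M\<^esub> (s \<otimes>\<^bsub>S\<^esub> s') = (x \<bullet>\<^bsub>M\<^esub> s) \<bullet>\<^bsub>M\<^esub> s'"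
    and rsmult_one:
      "x \<in> carrier M \<Longrightarrow> x \<bullet>\<^bsub>M\<^esub> \<one>\<^bsub>S\<^esub> = x"

locale bimodule = left_module R M + right_module S M
  for R :: "('r, 'i) ring_scheme" (structure) and S :: "('s, 'h) ring_scheme" (structure)
    and M :: "('r, 's, 'm, 'j) bimodule_scheme" (structure) +
  assumes smult_rsmult:
    "\<lbrakk>r \<in> carrier R; x \<in> carrier M; s \<in> carrier S\<rbrakk> \<Longrightarrow>
      (r \<odot>\<^bsub>M\<^esub> x) \<bullet>\<^bsub>M\<^esub> s = r \<odot>\<^bsub>M\<^esub> (x \<bullet>\<^bsub>M\<^esub> s)"

definition left_hom ::
    "('r, 'i) ring_scheme \<Rightarrow> ('r, 'm, 'j) module_scheme \<Rightarrow> ('r, 'n, 'k) module_scheme \<Rightarrow> ('m \<Rightarrow> 'n) set"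
  where "left_hom R M N =
    {f \<in> carrier M \<rightarrow> carrier N.
      (\<forall>x\<in>carrier M. \<forall>y\<in>carrier M. f (x \<oplus>\<^bsub>M\<^esub> y) = f x \<oplus>\<^bsub>N\<^esub> f y) \<and>
      (\<forall>r\<in>carrier R. \<forall>x\<in>carrier M. f (r \<odot>\<^bsub>M\<^esub> x) = r \<odot>\<^bsub>N\<^esub> f x)}"

definition right_hom ::
    "('s, 'i) ring_scheme \<Rightarrow> ('q, 's, 'm, 'j) bimodule_scheme \<Rightarrow> ('p, 's, 'n, 'k) bimodule_scheme \<Rightarrow>
      ('m \<Rightarrow> 'n) set"
  where "right_hom S M N =
    {f \<in> carrier M \<rightarrow> carrier N.
      (\<forall>x\<in>carrier M. \<forall>y\<in>carrier M. f (x \<oplus>\<^bsub>M\<^esub> y) = f x \<oplus>\<^bsub>N\<^esub> f y) \<and>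
      (\<forall>x\<in>carrier M. \<forall>s\<in>carrier S. f (x \<bullet>\<^bsub>M\<^esub> s) = f x \<bullet>\<^bsub>N\<^esub> s)}"

definition left_isomorphic ::
    "('r, 'i) ring_scheme \<Rightarrow> ('r, 'm, 'j) module_scheme \<Rightarrow> ('r, 'n, 'k) module_scheme \<Rightarrow> bool"
  where "left_isomorphic R M N \<longleftrightarrow>
    (\<exists>f \<in> left_hom R M N. bij_betw f (carrier M) (carrier N))"

definition bimod_isomorphic ::
    "('r, 'i) ring_scheme \<Rightarrow> ('s, 'h) ring_scheme \<Rightarrow>
      ('r, 's, 'm, 'j) bimodule_scheme \<Rightarrow> ('r, 's, 'n, 'k) bimodule_scheme \<Rightarrow> bool"
  where "bimod_isomorphic R S M N \<longleftrightarrow>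
    (\<exists>f \<in> left_hom R M N \<inter> right_hom S M N. bij_betw f (carrier M) (carrier N))"


section \<open>Finitely generated projective modules\<close>

definition finitely_generated :: "('r, 'i) ring_scheme \<Rightarrow> ('r, 'm, 'j) module_scheme \<Rightarrow> bool"
  where "finitely_generated R M \<longleftrightarrow>
    (\<exists>G. finite G \<and> G \<subseteq> carrier M \<and>
      (\<forall>x\<in>carrier M. \<exists>c \<in> G \<rightarrow> carrier R. x = (\<Oplus>\<^bsub>M\<^esub>g\<in>G. c g \<odot>\<^bsub>M\<^esub> g)))"

definition module_sum ::
    "('r, 'm, 'j) module_scheme \<Rightarrow> ('r, 'n, 'k) module_scheme \<Rightarrow> ('r, 'm \<times> 'n) module"
  where "module_sum M N =
    \<lparr>carrier = carrier M \<times> carrier N,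
     monoid.mult = undefined, one = undefined,
     ring.zero = (\<zero>\<^bsub>M\<^esub>, \<zero>\<^bsub>N\<^esub>),
     add = (\<lambda>(x, y) (x', y'). (x \<oplus>\<^bsub>M\<^esub> x', y \<oplus>\<^bsub>N\<^esub> y')),
     smult = (\<lambda>r (x, y). (r \<odot>\<^bsub>M\<^esub> x, r \<odot>\<^bsub>N\<^esub> y))\<rparr>"

definition free_module :: "('r, 'i) ring_scheme \<Rightarrow> 'b set \<Rightarrow> ('r, 'b \<Rightarrow> 'r) module"
  where "free_module R I =
    \<lparr>carrier = {f \<in> I \<rightarrow>\<^sub>E carrier R. finite {i \<in> I. f i \<noteq> \<zero>\<^bsub>R\<^esub>}},
     monoid.mult = undefined, one = undefined,
     ring.zero = (\<lambda>i\<in>I. \<zero>\<^bsub>R\<^esub>),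
     add = (\<lambda>f g. \<lambda>i\<in>I. f i \<oplus>\<^bsub>R\<^esub> g i),
     smult = (\<lambda>r f. \<lambda>i\<in>I. r \<otimes>\<^bsub>R\<^esub> f i)\<rparr>"

text \<open>
  Projective: a direct summand of a free module.  Restricting the basis to a set of elements
  of the type of \<open>M\<close> is no loss of generality: if \<open>M\<close> is projective, the canonical surjection
  onto \<open>M\<close> from the free module on \<open>carrier M\<close> splits, and the complement can be taken to be a
  submodule of that free module.
\<close>

definition projective :: "('r, 'i) ring_scheme \<Rightarrow> ('r, 'm, 'j) module_scheme \<Rightarrow> bool"
  where "projective R M \<longleftrightarrow>
    (\<exists>(I :: 'm set) (Q :: ('r, 'm \<Rightarrow> 'r) module).
      left_module R Q \<and> left_isomorphic R (module_sum M Q) (free_module R I))"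

text \<open>Right modules over \<open>S\<close> are treated as left modules over the opposite ring of \<open>S\<close>.\<close>

definition opposite_ring :: "('s, 'i) ring_scheme \<Rightarrow> ('s, 'i) ring_scheme"
  where "opposite_ring S = S\<lparr>monoid.mult := \<lambda>s s'. s' \<otimes>\<^bsub>S\<^esub> s\<rparr>"

definition opposite_module :: "('r, 's, 'm, 'j) bimodule_scheme \<Rightarrow> ('s, 'm) module"
  where "opposite_module M =
    \<lparr>carrier = carrier M, monoid.mult = undefined, one = undefined, ring.zero = \<zero>\<^bsub>M\<^esub>, add = add M,
     smult = (\<lambda>s x. x \<bullet>\<^bsub>M\<^esub> s)\<rparr>"

definition left_fg_projective :: "('r, 'i) ring_scheme \<Rightarrow> ('r, 'm, 'j) module_scheme \<Rightarrow> bool"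
  where "left_fg_projective R M \<longleftrightarrow> finitely_generated R M \<and> projective R M"

definition right_fg_projective :: "('s, 'i) ring_scheme \<Rightarrow> ('r, 's, 'm, 'j) bimodule_scheme \<Rightarrow> bool"
  where "right_fg_projective S M \<longleftrightarrow> left_fg_projective (opposite_ring S) (opposite_module M)"


section \<open>Similarity of bimodules\<close>

definition bimod_sum ::
    "('r, 's, 'm, 'j) bimodule_scheme \<Rightarrow> ('r, 's, 'n, 'k) bimodule_scheme \<Rightarrow>
      ('r, 's, 'm \<times> 'n) bimodule"
  where "bimod_sum M N =
    \<lparr>carrier = carrier M \<times> carrier N,
     monoid.mult = undefined, one = undefined,
     ring.zero = (\<zero>\<^bsub>M\<^esub>, \<zero>\<^bsub>N\<^esub>),
     add = (\<lambda>(x, y) (x', y'). (x \<oplus>\<^bsub>M\<^esub> x', y \<oplus>\<^bsub>N\<^esub> y')),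
     smult = (\<lambda>r (x, y). (r \<odot>\<^bsub>M\<^esub> x, r \<odot>\<^bsub>N\<^esub> y)),
     rsmult = (\<lambda>(x, y) s. (x \<bullet>\<^bsub>M\<^esub> s, y \<bullet>\<^bsub>N\<^esub> s))\<rparr>"

definition bimod_power ::
    "('r, 's, 'm, 'j) bimodule_scheme \<Rightarrow> nat \<Rightarrow> ('r, 's, nat \<Rightarrow> 'm) bimodule"
  where "bimod_power M n =
    \<lparr>carrier = {..<n} \<rightarrow>\<^sub>E carrier M,
     monoid.mult = undefined, one = undefined,
     ring.zero = (\<lambda>i\<in>{..<n}. \<zero>\<^bsub>M\<^esub>),
     add = (\<lambda>f g. \<lambda>i\<in>{..<n}. f i \<oplus>\<^bsub>M\<^esub> g i),
     smult = (\<lambda>r f. \<lambda>i\<in>{..<n}. r \<odot>\<^bsub>M\<^esub> f i),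
     rsmult = (\<lambda>f s. \<lambda>i\<in>{..<n}. f i \<bullet>\<^bsub>M\<^esub> s)\<rparr>"

text \<open>
  \<open>X | Y\<close>.  The complement \<open>P\<close> is isomorphic to a sub-bimodule of the direct power of \<open>Y\<close>, so
  letting it range over the bimodules on the element type of that power is no restriction.
\<close>

definition bimod_divides ::
    "('r, 'i) ring_scheme \<Rightarrow> ('s, 'h) ring_scheme \<Rightarrow>
      ('r, 's, 'x, 'j) bimodule_scheme \<Rightarrow> ('r, 's, 'y, 'k) bimodule_scheme \<Rightarrow> bool"
  where "bimod_divides R S X Y \<longleftrightarrow>
    (\<exists>(P :: ('r, 's, nat \<Rightarrow> 'y) bimodule) n.
      bimodule R S P \<and> bimod_isomorphic R S (bimod_sum X P) (bimod_power Y n))"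

definition bimod_similar ::
    "('r, 'i) ring_scheme \<Rightarrow> ('s, 'h) ring_scheme \<Rightarrow>
      ('r, 's, 'x, 'j) bimodule_scheme \<Rightarrow> ('r, 's, 'y, 'k) bimodule_scheme \<Rightarrow> bool"
  where "bimod_similar R S X Y \<longleftrightarrow> bimod_divides R S X Y \<and> bimod_divides R S Y X"


section \<open>Ring extensions, duals and tensor products\<close>

text \<open>The ring \<open>A\<close> as an \<open>(R,S)\<close>-bimodule via ring homomorphisms \<open>\<phi> : R \<rightarrow> A\<close> and \<open>\<psi> : S \<rightarrow> A\<close>.\<close>

definition ring_bimod ::
    "('a, 'i) ring_scheme \<Rightarrow> ('r \<Rightarrow> 'a) \<Rightarrow> ('s \<Rightarrow> 'a) \<Rightarrow> ('r, 's, 'a) bimodule"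
  where "ring_bimod A \<phi> \<psi> =
    \<lparr>carrier = carrier A, monoid.mult = monoid.mult A, one = \<one>\<^bsub>A\<^esub>, ring.zero = \<zero>\<^bsub>A\<^esub>, add = add A,
     smult = (\<lambda>r x. \<phi> r \<otimes>\<^bsub>A\<^esub> x),
     rsmult = (\<lambda>x s. x \<otimes>\<^bsub>A\<^esub> \<psi> s)\<rparr>"

text \<open>
  For an \<open>(R,S)\<close>-bimodule \<open>M\<close>, both duals \<open>Hom(\<^sub>RM, \<^sub>RR)\<close> and \<open>Hom(M\<^sub>S, S\<^sub>S)\<close> are
  \<open>(S,R)\<close>-bimodules.
\<close>

definition left_dual ::
    "('r, 'i) ring_scheme \<Rightarrow> ('r, 's, 'm, 'j) bimodule_scheme \<Rightarrow> ('s, 'r, 'm \<Rightarrow> 'r) bimodule"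
  where "left_dual R M =
    \<lparr>carrier = left_hom R M (ring_bimod R id id) \<inter> extensional (carrier M),
     monoid.mult = undefined, one = undefined,
     ring.zero = (\<lambda>x\<in>carrier M. \<zero>\<^bsub>R\<^esub>),
     add = (\<lambda>f g. \<lambda>x\<in>carrier M. f x \<oplus>\<^bsub>R\<^esub> g x),
     smult = (\<lambda>s f. \<lambda>x\<in>carrier M. f (x \<bullet>\<^bsub>M\<^esub> s)),
     rsmult = (\<lambda>f r. \<lambda>x\<in>carrier M. f x \<otimes>\<^bsub>R\<^esub> r)\<rparr>"

definition right_dual ::
    "('s, 'i) ring_scheme \<Rightarrow> ('r, 's, 'm, 'j) bimodule_scheme \<Rightarrow> ('s, 'r, 'm \<Rightarrow> 's) bimodule"
  where "right_dual S M =
    \<lparr>carrier = right_hom S M (ring_bimod S id id) \<inter> extensional (carrier M),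
     monoid.mult = undefined, one = undefined,
     ring.zero = (\<lambda>x\<in>carrier M. \<zero>\<^bsub>S\<^esub>),
     add = (\<lambda>f g. \<lambda>x\<in>carrier M. f x \<oplus>\<^bsub>S\<^esub> g x),
     smult = (\<lambda>s f. \<lambda>x\<in>carrier M. s \<otimes>\<^bsub>S\<^esub> f x),
     rsmult = (\<lambda>f r. \<lambda>x\<in>carrier M. f (r \<odot>\<^bsub>M\<^esub> x))\<rparr>"

text \<open>
  The tensor product over \<open>S\<close> of an \<open>(R,S)\<close>-bimodule \<open>M\<close> and an \<open>(S,T)\<close>-bimodule \<open>N\<close>, as the
  quotient of the free abelian group on \<open>carrier M \<times> carrier N\<close> by the usual relations.
\<close>

definition tensor_relators ::
    "('s, 'i) ring_scheme \<Rightarrow> ('r, 's, 'm, 'j) bimodule_scheme \<Rightarrow> ('s, 't, 'n, 'k) bimodule_scheme \<Rightarrow>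
      ('m \<times> 'n \<Rightarrow>\<^sub>0 int) set"
  where "tensor_relators S M N =
    {frag_of (x \<oplus>\<^bsub>M\<^esub> x', y) - frag_of (x, y) - frag_of (x', y) | x x' y.
      x \<in> carrier M \<and> x' \<in> carrier M \<and> y \<in> carrier N} \<union>
    {frag_of (x, y \<oplus>\<^bsub>N\<^esub> y') - frag_of (x, y) - frag_of (x, y') | x y y'.
      x \<in> carrier M \<and> y \<in> carrier N \<and> y' \<in> carrier N} \<union>
    {frag_of (x \<bullet>\<^bsub>M\<^esub> s, y) - frag_of (x, s \<odot>\<^bsub>N\<^esub> y) | x s y.
      x \<in> carrier M \<and> s \<in> carrier S \<and> y \<in> carrier N}"

abbreviation tensor_free ::
    "('r, 's, 'm, 'j) bimodule_scheme \<Rightarrow> ('s, 't, 'n, 'k) bimodule_scheme \<Rightarrow> ('m \<times> 'n \<Rightarrow>\<^sub>0 int) monoid"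
  where "tensor_free M N \<equiv> free_Abelian_group (carrier M \<times> carrier N)"

definition tensor_kernel ::
    "('s, 'i) ring_scheme \<Rightarrow> ('r, 's, 'm, 'j) bimodule_scheme \<Rightarrow> ('s, 't, 'n, 'k) bimodule_scheme \<Rightarrow>
      ('m \<times> 'n \<Rightarrow>\<^sub>0 int) set"
  where "tensor_kernel S M N = generate (tensor_free M N) (tensor_relators S M N)"

text \<open>
  The scalar actions on a coset \<open>X\<close> act on a representative \<open>c\<close> of \<open>X\<close> and return the coset of
  the result; as this coset does not depend on \<open>c\<close>, it is the union over all \<open>c \<in> X\<close>.
\<close>

definition tensor_product ::
    "('s, 'i) ring_scheme \<Rightarrow> ('r, 's, 'm, 'j) bimodule_scheme \<Rightarrow> ('s, 't, 'n, 'k) bimodule_scheme \<Rightarrow>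
      ('r, 't, ('m \<times> 'n \<Rightarrow>\<^sub>0 int) set) bimodule"
  where "tensor_product S M N =
    \<lparr>carrier = carrier (tensor_free M N Mod tensor_kernel S M N),
     monoid.mult = undefined, one = undefined,
     ring.zero = one (tensor_free M N Mod tensor_kernel S M N),
     add = monoid.mult (tensor_free M N Mod tensor_kernel S M N),
     smult = (\<lambda>r X. \<Union>c\<in>X. tensor_kernel S M N #>\<^bsub>tensor_free M N\<^esub>
       frag_extend (\<lambda>(x, y). frag_of (r \<odot>\<^bsub>M\<^esub> x, y)) c),
     rsmult = (\<lambda>X t. \<Union>c\<in>X. tensor_kernel S M N #>\<^bsub>tensor_free M N\<^esub>
       frag_extend (\<lambda>(x, y). frag_of (x, y \<bullet>\<^bsub>N\<^esub> t)) c)\<rparr>"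


section \<open>QF extensions and depth two\<close>

text \<open>
  In what follows \<open>h : B \<rightarrow> A\<close> is the ring homomorphism of a ring extension \<open>A/B\<close>, so that
  \<open>ring_bimod A id h\<close> is \<open>\<^sub>AA\<^sub>B\<close>, \<open>ring_bimod A h id\<close> is \<open>\<^sub>BA\<^sub>A\<close>, and \<open>ring_bimod A h h\<close> is
  \<open>\<^sub>BA\<^sub>B\<close>.
\<close>

definition left_QF ::
    "('a, 'i) ring_scheme \<Rightarrow> ('b, 'j) ring_scheme \<Rightarrow> ('b \<Rightarrow> 'a) \<Rightarrow> bool"
  where "left_QF A B h \<longleftrightarrow>
    left_fg_projective B (ring_bimod A h id) \<and>
    bimod_divides A B (ring_bimod A id h) (left_dual B (ring_bimod A h id))"

definition right_QF ::
    "('a, 'i) ring_scheme \<Rightarrow> ('b, 'j) ring_scheme \<Rightarrow> ('b \<Rightarrow> 'a) \<Rightarrow> bool"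
  where "right_QF A B h \<longleftrightarrow>
    right_fg_projective B (ring_bimod A id h) \<and>
    bimod_divides B A (ring_bimod A h id) (right_dual B (ring_bimod A id h))"

definition QF ::
    "('a, 'i) ring_scheme \<Rightarrow> ('b, 'j) ring_scheme \<Rightarrow> ('b \<Rightarrow> 'a) \<Rightarrow> bool"
  where "QF A B h \<longleftrightarrow> left_QF A B h \<and> right_QF A B h"

definition right_D2 ::
    "('a, 'i) ring_scheme \<Rightarrow> ('b, 'j) ring_scheme \<Rightarrow> ('b \<Rightarrow> 'a) \<Rightarrow> bool"
  where "right_D2 A B h \<longleftrightarrow>
    bimod_similar A B
      (tensor_product B (ring_bimod A id h) (ring_bimod A h h)) (ring_bimod A id h)"

definition left_D2 ::
    "('a, 'i) ring_scheme \<Rightarrow> ('b, 'j) ring_scheme \<Rightarrow> ('b \<Rightarrow> 'a) \<Rightarrow> bool"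
  where "left_D2 A B h \<longleftrightarrow>
    bimod_similar B A
      (tensor_product B (ring_bimod A h h) (ring_bimod A h id)) (ring_bimod A h id)"

end

theory Submission
  imports Defs
begin

text \<open>
  Put \<open>T = A \<otimes>\<^sub>B A\<close>.  The right QF condition, read through a dual basis \<open>(m\<^sub>j, \<xi>\<^sub>j)\<close> of the right
  \<open>B\<close>-module \<open>A\<close>, yields \<open>B\<close>-bilinear \<open>\<psi>\<^sub>i : A \<rightarrow> B\<close> and \<open>B\<close>-central \<open>e\<^sub>i \<in> T\<close> with
  \<open>1 \<otimes> a = \<Sum>\<^sub>i (\<psi>\<^sub>i(a -) \<otimes> id) e\<^sub>i\<close>.  Left depth two gives \<open>B\<close>-central \<open>t\<^sub>k \<in> T\<close> and
  \<open>B\<close>-bilinear endomorphisms \<open>\<beta>\<^sub>k\<close> of \<open>A\<close> with \<open>u \<otimes> 1 = \<Sum>\<^sub>k t\<^sub>k \<beta>\<^sub>k(u)\<close>.  Applying the right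
  linear map \<open>\<psi>\<^sub>i(a -)\<close> to the first tensor factors of the second formula and substituting
  into the first one gives \<open>1 \<otimes> a = \<Sum>\<^sub>i\<^sub>,\<^sub>k \<gamma>\<^sub>i\<^sub>k(a) s\<^sub>i\<^sub>k\<close> with \<open>\<gamma>\<^sub>i\<^sub>k\<close> \<open>B\<close>-bilinear and
  \<open>s\<^sub>i\<^sub>k = (\<beta>\<^sub>k \<otimes> id) e\<^sub>i\<close> \<open>B\<close>-central, which is right depth two.  The converse is the same
  statement for the opposite rings.
\<close>

section \<open>Sums of additive maps\<close>

text \<open>The data on the two depth two sides come from evaluation. A \<open>(B,A)\<close>-map
  from \<open>A\<close> to \<open>T\<close> is fixed by the image of 1, a \<open>B\<close>-central
  tensor; a \<open>(B,A)\<close>-map from \<open>T\<close> to \<open>A\<close> is fixed by its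
  values on the \<open>u \<otimes> 1\<close>, which form a \<open>B\<close>-bilinear endomorphism of
  \<open>A\<close>. Only \<open>T | A\<close> carries information: \<open>A | T\<close> always
  holds, as multiplication splits \<open>x \<mapsto> x \<otimes> 1\<close>. The
  \<open>e\<^sub>i\<close> are Casimir elements. The canonical element
  \<open>\<Sum>\<^sub>j m\<^sub>j \<otimes> \<xi>\<^sub>j\<close> of \<open>A\<close> tensored with
  its right dual corresponds to the identity of \<open>End(A\<^sub>B)\<close>, so it commutes with
  \<open>A\<close>; a bimodule map from the dual to \<open>A\<close>, applied to the second factors,
  yields \<open>e\<^sub>i\<close>. The difficulty is that \<open>\<psi>\<^sub>i(a -)\<close> is only
  right linear and involves \<open>a\<close>. Left depth two resolves it by pulling all dependence
  on \<open>a\<close> out as a coefficient on the left. Such substitutions need formulas, whereas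
  \<open>X | Y\<close> is given by a complement. It is therefore first turned into the statement
  that the identity of \<open>X\<close> is a finite sum of maps factoring through
  \<open>Y\<close>.\<close>

abbreviation add_hom :: "('a, 'i) ring_scheme \<Rightarrow> ('b, 'j) ring_scheme \<Rightarrow> ('a \<Rightarrow> 'b) set"
  where "add_hom M N \<equiv> hom (add_monoid M) (add_monoid N)"

lemma add_hom_iff:
  "f \<in> add_hom M N \<longleftrightarrow> f \<in> carrier M \<rightarrow> carrier N \<and>
    (\<forall>x\<in>carrier M. \<forall>y\<in>carrier M. f (x \<oplus>\<^bsub>M\<^esub> y) = f x \<oplus>\<^bsub>N\<^esub> f y)"
  by (simp add: hom_def)

lemma add_hom_closed: "f \<in> add_hom M N \<Longrightarrow> x \<in> carrier M \<Longrightarrow> f x \<in> carrier N"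
  by (auto simp: add_hom_iff)

lemma add_hom_add:
  "f \<in> add_hom M N \<Longrightarrow> x \<in> carrier M \<Longrightarrow> y \<in> carrier M \<Longrightarrow> f (x \<oplus>\<^bsub>M\<^esub> y) = f x \<oplus>\<^bsub>N\<^esub> f y"
  by (auto simp: add_hom_iff)

lemma add_hom_comp: "f \<in> add_hom M N \<Longrightarrow> g \<in> add_hom N P \<Longrightarrow> (\<lambda>x. g (f x)) \<in> add_hom M P"
  by (auto simp: add_hom_iff Pi_iff)

lemma add_hom_plus:
  assumes "abelian_group N" "f \<in> add_hom M N" "g \<in> add_hom M N"
  shows "(\<lambda>x. f x \<oplus>\<^bsub>N\<^esub> g x) \<in> add_hom M N"
proof -
  interpret N: abelian_group N by fact
  show ?thesis using assms(2,3) by (auto simp: add_hom_iff Pi_iff N.a_ac)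
qed

lemma add_hom_zero:
  assumes "abelian_group M" "abelian_group N" "f \<in> add_hom M N"
  shows "f \<zero>\<^bsub>M\<^esub> = \<zero>\<^bsub>N\<^esub>"
proof -
  have "abelian_group_hom M N f"
    using assms by (intro abelian_group_homI group_hom.intro group_hom_axioms.intro abelian_group.a_group)
  then show ?thesis by (rule abelian_group_hom.hom_zero)
qed

lemma add_hom_minus:
  assumes "abelian_group M" "abelian_group N" "f \<in> add_hom M N" "x \<in> carrier M"
  shows "f (\<ominus>\<^bsub>M\<^esub> x) = \<ominus>\<^bsub>N\<^esub> f x"
proof -
  have "abelian_group_hom M N f"
    using assms by (intro abelian_group_homI group_hom.intro group_hom_axioms.intro abelian_group.a_group)
  then show ?thesis using assms(4) by (rule abelian_group_hom.hom_a_inv)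
qed

lemma add_hom_finsum:
  assumes "abelian_group M" "abelian_group N" "f \<in> add_hom M N" "g \<in> I \<rightarrow> carrier M"
  shows "f (\<Oplus>\<^bsub>M\<^esub>i\<in>I. g i) = (\<Oplus>\<^bsub>N\<^esub>i\<in>I. f (g i))"
proof -
  interpret M: abelian_group M by fact
  interpret N: abelian_group N by fact
  show ?thesis
    using assms(4)
  proof (induction I rule: infinite_finite_induct)
    case (infinite I)
    then show ?case by (simp add: add_hom_zero[OF assms(1-3)])
  next
    case empty
    then show ?case by (simp add: add_hom_zero[OF assms(1-3)])
  next
    case (insert x I)
    then have "g x \<in> carrier M" "g \<in> I \<rightarrow> carrier M" by auto
    with insert show ?case
      using assms(3) by (subst M.finsum_insert, simp, simp, simp, simp)
        (subst N.finsum_insert, auto simp: add_hom_add add_hom_closed Pi_iff)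
  qed
qed

lemma finsum_add_hom:
  assumes "abelian_group N" and g: "\<And>i. i \<in> I \<Longrightarrow> g i \<in> add_hom M N"
  shows "(\<lambda>x. \<Oplus>\<^bsub>N\<^esub>i\<in>I. g i x) \<in> add_hom M N"
proof -
  interpret N: abelian_group N by fact
  have cl: "(\<lambda>i. g i x) \<in> I \<rightarrow> carrier N" if "x \<in> carrier M" for x
    using g that by (auto intro: add_hom_closed)
  have "(\<Oplus>\<^bsub>N\<^esub>i\<in>I. g i (x \<oplus>\<^bsub>M\<^esub> y)) = (\<Oplus>\<^bsub>N\<^esub>i\<in>I. g i x) \<oplus>\<^bsub>N\<^esub> (\<Oplus>\<^bsub>N\<^esub>i\<in>I. g i y)"
    if "x \<in> carrier M" "y \<in> carrier M" for x y
  proof -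
    have "(\<Oplus>\<^bsub>N\<^esub>i\<in>I. g i (x \<oplus>\<^bsub>M\<^esub> y)) = (\<Oplus>\<^bsub>N\<^esub>i\<in>I. g i x \<oplus>\<^bsub>N\<^esub> g i y)"
      using cl that by (intro N.finsum_cong') (auto simp: add_hom_add[OF g] Pi_iff)
    then show ?thesis using cl that by (simp add: N.finsum_addf)
  qed
  then show ?thesis using cl by (simp add: add_hom_iff N.finsum_closed Pi_iff)
qed

text \<open>Serves the Casimir property, where two sums over a dual basis are exchanged.\<close>

lemma (in abelian_group) finsum_swap:
  assumes "finite I" "finite J" "\<And>i j. i \<in> I \<Longrightarrow> j \<in> J \<Longrightarrow> f i j \<in> carrier G"
  shows "(\<Oplus>i\<in>I. \<Oplus>j\<in>J. f i j) = (\<Oplus>j\<in>J. \<Oplus>i\<in>I. f i j)"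
  using assms(1,3)
proof (induction I)
  case empty
  then show ?case by simp
next
  case (insert x I)
  then have "(\<Oplus>j\<in>J. \<Oplus>i\<in>insert x I. f i j) = (\<Oplus>j\<in>J. f x j \<oplus> (\<Oplus>i\<in>I. f i j))"
    by (intro finsum_cong') (auto simp: Pi_iff intro!: finsum_closed)
  also have "\<dots> = (\<Oplus>j\<in>J. f x j) \<oplus> (\<Oplus>j\<in>J. \<Oplus>i\<in>I. f i j)"
    using insert by (intro finsum_addf) (auto simp: Pi_iff intro!: finsum_closed)
  finally show ?case
    using insert by (subst finsum_insert) (auto simp: Pi_iff intro!: finsum_closed)
qed

text \<open>The number of summands stays hidden, repetitions and the empty sum are allowed, and only
  values on \<open>D\<close> count. Thus the sum over the QF data and the sum over the depth two
  data can be merged without pairing indices.\<close>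

definition sum_of :: "('m, 'i) ring_scheme \<Rightarrow> 'x set \<Rightarrow> ('x \<Rightarrow> 'm) set \<Rightarrow> ('x \<Rightarrow> 'm) \<Rightarrow> bool"
  where "sum_of M D G F \<longleftrightarrow>
    (\<exists>(n :: nat) g. (\<forall>i<n. g i \<in> G) \<and> (\<forall>x\<in>D. F x = (\<Oplus>\<^bsub>M\<^esub>i\<in>{..<n}. g i x)))"

lemma sum_ofI:
  "(\<And>i. i < (n :: nat) \<Longrightarrow> g i \<in> G) \<Longrightarrow> (\<And>x. x \<in> D \<Longrightarrow> F x = (\<Oplus>\<^bsub>M\<^esub>i\<in>{..<n}. g i x)) \<Longrightarrow>
    sum_of M D G F"
  unfolding sum_of_def by blast

lemma sum_ofE:
  assumes "sum_of M D G F"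
  obtains n :: nat and g
  where "\<And>i. i < n \<Longrightarrow> g i \<in> G" "\<And>x. x \<in> D \<Longrightarrow> F x = (\<Oplus>\<^bsub>M\<^esub>i\<in>{..<n}. g i x)"
  using assms unfolding sum_of_def by blast

lemma sum_of_cong:
  "(\<And>x. x \<in> D \<Longrightarrow> F x = F' x) \<Longrightarrow> sum_of M D G F \<longleftrightarrow> sum_of M D G F'"
  by (simp add: sum_of_def)

context abelian_group
begin

lemma sum_of_zero: "(\<And>x. x \<in> D \<Longrightarrow> F x = \<zero>) \<Longrightarrow> sum_of G D S F"
  unfolding sum_of_def by (rule exI[of _ 0]) simp

lemma sum_of_add:
  assumes F: "sum_of G D S F" and F': "sum_of G D S F'" and S: "S \<subseteq> D \<rightarrow> carrier G"
  shows "sum_of G D S (\<lambda>x. F x \<oplus> F' x)"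
proof -
  obtain n :: nat and g where g: "\<And>i. i < n \<Longrightarrow> g i \<in> S" "\<And>x. x \<in> D \<Longrightarrow> F x = (\<Oplus>i\<in>{..<n}. g i x)"
    using F by (rule sum_ofE) blast
  obtain m :: nat and g' where g': "\<And>i. i < m \<Longrightarrow> g' i \<in> S" "\<And>x. x \<in> D \<Longrightarrow> F' x = (\<Oplus>i\<in>{..<m}. g' i x)"
    using F' by (rule sum_ofE) blast
  \<comment> \<open>Concatenation of the two families: indices from \<open>n\<close> on are shifted
    back by \<open>n\<close>.\<close>
  define k where "k i = (if i < n then g i else g' (i - n))" for i :: nat
  have k: "k i \<in> S" if "i < n + m" for i
    using that g(1) g'(1) by (auto simp: k_def)
  have "F x \<oplus> F' x = (\<Oplus>i\<in>{..<n + m}. k i x)" if x: "x \<in> D" for x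
  proof -
    have kx: "k i x \<in> carrier G" if "i < n + m" for i
      using k[OF that] S x by auto
    have eq: "{..<n + m} = {..<n} \<union> (\<lambda>i. i + n) ` {..<m}"
    proof -
      have "j \<in> (\<lambda>i. i + n) ` {..<m}" if "\<not> j < n" "j < n + m" for j
        using that by (intro image_eqI[of _ _ "j - n"]) auto
      then show ?thesis by fastforce
    qed
    have "(\<Oplus>i\<in>{..<n + m}. k i x) =
        (\<Oplus>i\<in>{..<n}. k i x) \<oplus> (\<Oplus>i\<in>(\<lambda>i. i + n) ` {..<m}. k i x)"
      unfolding eq using kx by (intro finsum_Un_disjoint) auto
    also have "(\<Oplus>i\<in>(\<lambda>i. i + n) ` {..<m}. k i x) = (\<Oplus>i\<in>{..<m}. k (i + n) x)"
      using kx by (intro finsum_reindex) (auto simp: inj_on_def)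
    also have "\<dots> = F' x"
      using x g'(1) S by (auto simp: g'(2) k_def)
    also have "(\<Oplus>i\<in>{..<n}. k i x) = F x"
      unfolding g(2)[OF x] using x g(1) S by (intro finsum_cong') (auto simp: k_def)
    finally show ?thesis ..
  qed
  with k show ?thesis by (rule sum_ofI)
qed

lemma sum_of_base:
  assumes "g \<in> S" "g \<in> D \<rightarrow> carrier G"
  shows "sum_of G D S g"
proof -
  have "g x = (\<Oplus>i\<in>{..<Suc 0}. g x)" if "x \<in> D" for x
    using assms(2) that by (simp add: lessThan_Suc Pi_iff)
  with assms(1) show ?thesis by (intro sum_ofI[of "Suc 0" "\<lambda>_. g"])
qed

lemma sum_of_finsum:
  assumes g: "\<And>i. i \<in> I \<Longrightarrow> sum_of G D S (g i)" and S: "S \<subseteq> D \<rightarrow> carrier G"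
    and I: "finite I"
  shows "sum_of G D S (\<lambda>x. \<Oplus>i\<in>I. g i x)"
  using I g
proof (induction I)
  case empty
  then show ?case by (auto intro: sum_of_zero)
next
  case (insert i I)
  have cl: "g j x \<in> carrier G" if j: "j \<in> insert i I" and x: "x \<in> D" for j x
  proof -
    obtain n :: nat and h where h: "\<And>i. i < n \<Longrightarrow> h i \<in> S" "\<And>x. x \<in> D \<Longrightarrow> g j x = (\<Oplus>i\<in>{..<n}. h i x)"
      using insert.prems[OF j] by (rule sum_ofE) blast
    show ?thesis unfolding h(2)[OF x] using h(1) S x by (intro finsum_closed) auto
  qed
  have "sum_of G D S (\<lambda>x. g i x \<oplus> (\<Oplus>i\<in>I. g i x))"
    using insert by (intro sum_of_add S) auto
  then show ?case
    using cl insert.hyps by (subst sum_of_cong) (auto simp: finsum_insert Pi_iff)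
qed

text \<open>Substitution of sums into a sum; this is how the depth two formula is inserted into the
  QF formula.\<close>

lemma sum_of_trans:
  assumes "sum_of G D S F" "S' \<subseteq> D \<rightarrow> carrier G" "\<And>g. g \<in> S \<Longrightarrow> sum_of G D S' g"
  shows "sum_of G D S' F"
proof -
  obtain n :: nat and g where g: "\<And>i. i < n \<Longrightarrow> g i \<in> S" "\<And>x. x \<in> D \<Longrightarrow> F x = (\<Oplus>i\<in>{..<n}. g i x)"
    using assms(1) by (rule sum_ofE) blast
  have "sum_of G D S' (\<lambda>x. \<Oplus>i\<in>{..<n}. g i x)"
    using g(1) assms(2,3) by (intro sum_of_finsum) auto
  then show ?thesis using g(2) by (subst sum_of_cong) auto
qed

end

section \<open>Bimodule homomorphisms and divisibility\<close>

definition bimod_hom ::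
    "('r, 'i) ring_scheme \<Rightarrow> ('s, 'h) ring_scheme \<Rightarrow>
      ('r, 's, 'm, 'j) bimodule_scheme \<Rightarrow> ('r, 's, 'n, 'k) bimodule_scheme \<Rightarrow> ('m \<Rightarrow> 'n) set"
  where "bimod_hom R S M N = left_hom R M N \<inter> right_hom S M N"

lemma left_hom_iff:
  "f \<in> left_hom R M N \<longleftrightarrow> f \<in> add_hom M N \<and>
    (\<forall>r\<in>carrier R. \<forall>x\<in>carrier M. f (r \<odot>\<^bsub>M\<^esub> x) = r \<odot>\<^bsub>N\<^esub> f x)"
  by (auto simp: left_hom_def add_hom_iff)

lemma right_hom_iff:
  "f \<in> right_hom S M N \<longleftrightarrow> f \<in> add_hom M N \<and>
    (\<forall>x\<in>carrier M. \<forall>s\<in>carrier S. f (x \<bullet>\<^bsub>M\<^esub> s) = f x \<bullet>\<^bsub>N\<^esub> s)"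
  by (auto simp: right_hom_def add_hom_iff)

lemma bimod_hom_iff:
  "f \<in> bimod_hom R S M N \<longleftrightarrow> f \<in> add_hom M N \<and>
    (\<forall>r\<in>carrier R. \<forall>x\<in>carrier M. f (r \<odot>\<^bsub>M\<^esub> x) = r \<odot>\<^bsub>N\<^esub> f x) \<and>
    (\<forall>x\<in>carrier M. \<forall>s\<in>carrier S. f (x \<bullet>\<^bsub>M\<^esub> s) = f x \<bullet>\<^bsub>N\<^esub> s)"
  by (auto simp: bimod_hom_def left_hom_iff right_hom_iff)

lemma (in left_module) smult_add_hom: "r \<in> carrier R \<Longrightarrow> (\<lambda>x. r \<odot>\<^bsub>M\<^esub> x) \<in> add_hom M M"
  by (simp add: add_hom_iff smult_closed smult_r_distr)

lemma (in left_module) smult_add_hom_left: "x \<in> carrier M \<Longrightarrow> (\<lambda>r. r \<odot>\<^bsub>M\<^esub> x) \<in> add_hom R M"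
  by (simp add: add_hom_iff smult_closed smult_l_distr)

lemma (in right_module) rsmult_add_hom: "s \<in> carrier S \<Longrightarrow> (\<lambda>x. x \<bullet>\<^bsub>M\<^esub> s) \<in> add_hom M M"
  by (simp add: add_hom_iff rsmult_closed rsmult_l_distr)

lemma left_hom_finsum:
  assumes "left_module R N" and g: "\<And>i. i \<in> I \<Longrightarrow> g i \<in> left_hom R M N"
  shows "(\<lambda>x. \<Oplus>\<^bsub>N\<^esub>i\<in>I. g i x) \<in> left_hom R M N"
proof -
  interpret N: left_module R N by fact
  have ab: "abelian_group N" by (rule N.M.abelian_group_axioms)
  have "(\<Oplus>\<^bsub>N\<^esub>i\<in>I. g i (r \<odot>\<^bsub>M\<^esub> x)) = r \<odot>\<^bsub>N\<^esub> (\<Oplus>\<^bsub>N\<^esub>i\<in>I. g i x)"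
    if "r \<in> carrier R" "x \<in> carrier M" for r x
  proof -
    have "g i x \<in> carrier N" "g i (r \<odot>\<^bsub>M\<^esub> x) = r \<odot>\<^bsub>N\<^esub> g i x" if "i \<in> I" for i
      using g[OF that] \<open>r \<in> carrier R\<close> \<open>x \<in> carrier M\<close> by (auto simp: left_hom_def)
    then show ?thesis
      using that by (subst add_hom_finsum[OF ab ab N.smult_add_hom])
        (auto intro!: N.M.finsum_cong' simp: N.smult_closed)
  qed
  then show ?thesis
    unfolding left_hom_iff using g by (auto intro!: finsum_add_hom ab simp: left_hom_iff)
qed

lemma right_hom_finsum:
  assumes "right_module S N" and g: "\<And>i. i \<in> I \<Longrightarrow> g i \<in> right_hom S M N"
  shows "(\<lambda>x. \<Oplus>\<^bsub>N\<^esub>i\<in>I. g i x) \<in> right_hom S M N"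
proof -
  interpret N: right_module S N by fact
  have ab: "abelian_group N" by (rule N.M.abelian_group_axioms)
  have "(\<Oplus>\<^bsub>N\<^esub>i\<in>I. g i (x \<bullet>\<^bsub>M\<^esub> s)) = (\<Oplus>\<^bsub>N\<^esub>i\<in>I. g i x) \<bullet>\<^bsub>N\<^esub> s"
    if "s \<in> carrier S" "x \<in> carrier M" for s x
  proof -
    have "g i x \<in> carrier N" "g i (x \<bullet>\<^bsub>M\<^esub> s) = g i x \<bullet>\<^bsub>N\<^esub> s" if "i \<in> I" for i
      using g[OF that] \<open>s \<in> carrier S\<close> \<open>x \<in> carrier M\<close> by (auto simp: right_hom_def)
    then show ?thesis
      using that by (subst add_hom_finsum[OF ab ab N.rsmult_add_hom])
        (auto intro!: N.M.finsum_cong' simp: N.rsmult_closed)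
  qed
  then show ?thesis
    unfolding right_hom_iff using g by (auto intro!: finsum_add_hom ab simp: right_hom_iff)
qed

lemma bimod_hom_comp:
  "f \<in> bimod_hom R S M N \<Longrightarrow> g \<in> bimod_hom R S N P \<Longrightarrow> (\<lambda>x. g (f x)) \<in> bimod_hom R S M P"
  by (auto simp: bimod_hom_iff add_hom_iff Pi_iff)

lemma (in left_module) smult_zero: "r \<in> carrier R \<Longrightarrow> r \<odot>\<^bsub>M\<^esub> \<zero>\<^bsub>M\<^esub> = \<zero>\<^bsub>M\<^esub>"
  by (rule add_hom_zero[OF _ _ smult_add_hom]) (rule M.abelian_group_axioms)+

lemma (in right_module) zero_rsmult: "s \<in> carrier S \<Longrightarrow> \<zero>\<^bsub>M\<^esub> \<bullet>\<^bsub>M\<^esub> s = \<zero>\<^bsub>M\<^esub>"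
  by (rule add_hom_zero[OF _ _ rsmult_add_hom]) (rule M.abelian_group_axioms)+

lemma bimodule_abelian_group: "bimodule R S M \<Longrightarrow> abelian_group M"
  by (simp add: bimodule_def left_module_def)

lemma bimodule_left_module: "bimodule R S M \<Longrightarrow> left_module R M"
  by (simp add: bimodule_def)

lemma bimodule_right_module: "bimodule R S M \<Longrightarrow> right_module S M"
  by (simp add: bimodule_def)

lemma left_hom_inv:
  assumes "left_module R M" "f \<in> left_hom R M N" "bij_betw f (carrier M) (carrier N)"
  shows "inv_into (carrier M) f \<in> left_hom R N M"
proof -
  interpret M: left_module R M by fact
  let ?g = "inv_into (carrier M) f"
  have g: "?g y \<in> carrier M" "f (?g y) = y" if "y \<in> carrier N" for y
    using assms(3) that by (auto simp: bij_betw_def intro: inv_into_into f_inv_into_f)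
  have gf: "?g (f x) = x" if "x \<in> carrier M" for x
    using assms(3) that by (simp add: bij_betw_def)
  have "?g (x \<oplus>\<^bsub>N\<^esub> y) = ?g x \<oplus>\<^bsub>M\<^esub> ?g y" if "x \<in> carrier N" "y \<in> carrier N" for x y
    using assms(2) gf[of "?g x \<oplus>\<^bsub>M\<^esub> ?g y"] g[OF that(1)] g[OF that(2)]
    by (simp add: left_hom_iff add_hom_iff)
  moreover have "?g (r \<odot>\<^bsub>N\<^esub> x) = r \<odot>\<^bsub>M\<^esub> ?g x" if "r \<in> carrier R" "x \<in> carrier N" for r x
    using assms(2) gf[of "r \<odot>\<^bsub>M\<^esub> ?g x"] g[OF that(2)] that(1)
    by (simp add: left_hom_iff M.smult_closed)
  ultimately show ?thesis
    using g by (auto simp: left_hom_iff add_hom_iff)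
qed

lemma right_hom_inv:
  assumes "right_module S M" "f \<in> right_hom S M N" "bij_betw f (carrier M) (carrier N)"
  shows "inv_into (carrier M) f \<in> right_hom S N M"
proof -
  interpret M: right_module S M by fact
  let ?g = "inv_into (carrier M) f"
  have g: "?g y \<in> carrier M" "f (?g y) = y" if "y \<in> carrier N" for y
    using assms(3) that by (auto simp: bij_betw_def intro: inv_into_into f_inv_into_f)
  have gf: "?g (f x) = x" if "x \<in> carrier M" for x
    using assms(3) that by (simp add: bij_betw_def)
  have "?g (x \<oplus>\<^bsub>N\<^esub> y) = ?g x \<oplus>\<^bsub>M\<^esub> ?g y" if "x \<in> carrier N" "y \<in> carrier N" for x y
    using assms(2) gf[of "?g x \<oplus>\<^bsub>M\<^esub> ?g y"] g[OF that(1)] g[OF that(2)]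
    by (simp add: right_hom_iff add_hom_iff)
  moreover have "?g (x \<bullet>\<^bsub>N\<^esub> s) = ?g x \<bullet>\<^bsub>M\<^esub> s" if "s \<in> carrier S" "x \<in> carrier N" for s x
    using assms(2) gf[of "?g x \<bullet>\<^bsub>M\<^esub> s"] g[OF that(2)] that(1)
    by (simp add: right_hom_iff M.rsmult_closed)
  ultimately show ?thesis
    using g by (auto simp: right_hom_iff add_hom_iff)
qed

lemma bimod_hom_inv:
  assumes "bimodule R S M" "f \<in> bimod_hom R S M N" "bij_betw f (carrier M) (carrier N)"
  shows "inv_into (carrier M) f \<in> bimod_hom R S N M"
  using assms unfolding bimod_hom_def
  by (blast intro: left_hom_inv right_hom_inv bimodule_left_module bimodule_right_module)

section \<open>Direct powers, direct sums and kernels of bimodules\<close>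

lemma bimod_power_simps [simp]:
  "carrier (bimod_power M n) = {..<n} \<rightarrow>\<^sub>E carrier M"
  "\<zero>\<^bsub>bimod_power M n\<^esub> = (\<lambda>i\<in>{..<n}. \<zero>\<^bsub>M\<^esub>)"
  "f \<oplus>\<^bsub>bimod_power M n\<^esub> g = (\<lambda>i\<in>{..<n}. f i \<oplus>\<^bsub>M\<^esub> g i)"
  "r \<odot>\<^bsub>bimod_power M n\<^esub> f = (\<lambda>i\<in>{..<n}. r \<odot>\<^bsub>M\<^esub> f i)"
  "f \<bullet>\<^bsub>bimod_power M n\<^esub> s = (\<lambda>i\<in>{..<n}. f i \<bullet>\<^bsub>M\<^esub> s)"
  by (simp_all add: bimod_power_def)

lemma bimod_sum_simps [simp]:
  "carrier (bimod_sum M N) = carrier M \<times> carrier N"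
  "\<zero>\<^bsub>bimod_sum M N\<^esub> = (\<zero>\<^bsub>M\<^esub>, \<zero>\<^bsub>N\<^esub>)"
  "(x, y) \<oplus>\<^bsub>bimod_sum M N\<^esub> (x', y') = (x \<oplus>\<^bsub>M\<^esub> x', y \<oplus>\<^bsub>N\<^esub> y')"
  "r \<odot>\<^bsub>bimod_sum M N\<^esub> (x, y) = (r \<odot>\<^bsub>M\<^esub> x, r \<odot>\<^bsub>N\<^esub> y)"
  "(x, y) \<bullet>\<^bsub>bimod_sum M N\<^esub> s = (x \<bullet>\<^bsub>M\<^esub> s, y \<bullet>\<^bsub>N\<^esub> s)"
  by (simp_all add: bimod_sum_def)

lemma bimodule_power:
  assumes "bimodule R S M" shows "bimodule R S (bimod_power M n)"
proof -
  interpret M: bimodule R S M by fact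
  have "abelian_group (bimod_power M n)"
  proof (rule abelian_groupI)
    fix f assume f: "f \<in> carrier (bimod_power M n)"
    show "\<exists>g\<in>carrier (bimod_power M n). g \<oplus>\<^bsub>bimod_power M n\<^esub> f = \<zero>\<^bsub>bimod_power M n\<^esub>"
      using f by (intro bexI[of _ "\<lambda>i\<in>{..<n}. \<ominus>\<^bsub>M\<^esub> f i"]) (auto simp: PiE_iff M.M.l_neg)
    show "\<zero>\<^bsub>bimod_power M n\<^esub> \<oplus>\<^bsub>bimod_power M n\<^esub> f = f"
      using f by (auto simp: PiE_iff extensional_def)
  qed (auto simp: PiE_iff M.M.a_ac intro!: restrict_ext)
  then show ?thesis
    by (intro bimodule.intro left_module.intro right_module.intro left_module_axioms.intro
        right_module_axioms.intro bimodule_axioms.intro M.R.ring_axioms M.S.ring_axioms)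
      (auto simp: PiE_iff M.smult_closed M.rsmult_closed M.smult_l_distr M.smult_r_distr
        M.smult_assoc M.smult_one M.rsmult_l_distr M.rsmult_r_distr M.rsmult_assoc M.rsmult_one
        M.smult_rsmult extensional_def fun_eq_iff)
qed

lemma bimodule_sum:
  assumes "bimodule R S M" "bimodule R S N" shows "bimodule R S (bimod_sum M N)"
proof -
  interpret M: bimodule R S M by fact
  interpret N: bimodule R S N by fact
  have "abelian_group (bimod_sum M N)"
  proof (rule abelian_groupI)
    fix p assume p: "p \<in> carrier (bimod_sum M N)"
    show "\<exists>q\<in>carrier (bimod_sum M N). q \<oplus>\<^bsub>bimod_sum M N\<^esub> p = \<zero>\<^bsub>bimod_sum M N\<^esub>"
      using p by (intro bexI[of _ "(\<ominus>\<^bsub>M\<^esub> fst p, \<ominus>\<^bsub>N\<^esub> snd p)"]) (auto simp: M.M.l_neg N.M.l_neg)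
  qed (auto simp: M.M.a_ac N.M.a_ac)
  then show ?thesis
    by (intro bimodule.intro left_module.intro right_module.intro left_module_axioms.intro
        right_module_axioms.intro bimodule_axioms.intro M.R.ring_axioms M.S.ring_axioms)
      (auto simp: M.smult_closed M.rsmult_closed M.smult_l_distr M.smult_r_distr
        M.smult_assoc M.smult_one M.rsmult_l_distr M.rsmult_r_distr M.rsmult_assoc M.rsmult_one
        M.smult_rsmult N.smult_closed N.rsmult_closed N.smult_l_distr N.smult_r_distr
        N.smult_assoc N.smult_one N.rsmult_l_distr N.rsmult_r_distr N.rsmult_assoc N.rsmult_one
        N.smult_rsmult)
qed

lemma bimodule_kernel:
  fixes Y :: "('r, 's, 'y) bimodule"
  assumes Y: "bimodule R S Y" and X: "bimodule R S X" and G: "G \<in> bimod_hom R S Y X"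
  shows "bimodule R S (Y\<lparr>carrier := {y \<in> carrier Y. G y = \<zero>\<^bsub>X\<^esub>}\<rparr>)"
proof -
  interpret Y: bimodule R S Y by fact
  interpret X: bimodule R S X by fact
  note ab = Y.M.abelian_group_axioms X.M.abelian_group_axioms
  have G': "G \<in> add_hom Y X" using G by (simp add: bimod_hom_iff)
  have "abelian_group (Y\<lparr>carrier := {y \<in> carrier Y. G y = \<zero>\<^bsub>X\<^esub>}\<rparr>)" (is "abelian_group ?P")
  proof (rule abelian_groupI)
    fix p assume p: "p \<in> carrier ?P"
    show "\<exists>q\<in>carrier ?P. q \<oplus>\<^bsub>?P\<^esub> p = \<zero>\<^bsub>?P\<^esub>"
      using p by (intro bexI[of _ "\<ominus>\<^bsub>Y\<^esub> p"]) (auto simp: Y.M.l_neg add_hom_minus[OF ab G'])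
  qed (auto simp: Y.M.a_ac add_hom_zero[OF ab G'] add_hom_add[OF G'])
  then show ?thesis
    using G
    by (intro bimodule.intro left_module.intro right_module.intro left_module_axioms.intro
        right_module_axioms.intro bimodule_axioms.intro Y.R.ring_axioms Y.S.ring_axioms)
      (auto simp: bimod_hom_iff X.smult_zero X.zero_rsmult
        Y.smult_closed Y.rsmult_closed Y.smult_l_distr Y.smult_r_distr
        Y.smult_assoc Y.smult_one Y.rsmult_l_distr Y.rsmult_r_distr Y.rsmult_assoc Y.rsmult_one
        Y.smult_rsmult)
qed

text \<open>Since \<open>G\<close> retracts \<open>F\<close>, \<open>Y\<close> is the internal
  direct sum of the image of \<open>F\<close> and the kernel of \<open>G\<close>. The kernel is made
  by shrinking the carrier of the record \<open>Y\<close>; when \<open>Y\<close> is a direct power,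
  it thus has the element type that \<open>bimod_divides\<close> prescribes for the
  complement.\<close>

lemma bimod_retract_complement:
  fixes Y :: "('r, 's, 'y) bimodule"
  assumes X: "bimodule R S X" and Y: "bimodule R S Y"
    and F: "F \<in> bimod_hom R S X Y" and G: "G \<in> bimod_hom R S Y X"
    and GF: "\<And>x. x \<in> carrier X \<Longrightarrow> G (F x) = x"
  shows "\<exists>P :: ('r, 's, 'y) bimodule. bimodule R S P \<and> bimod_isomorphic R S (bimod_sum X P) Y"
proof -
  interpret Y: bimodule R S Y by fact
  interpret X: bimodule R S X by fact
  note ab = Y.M.abelian_group_axioms X.M.abelian_group_axioms
  have F': "F \<in> add_hom X Y" and G': "G \<in> add_hom Y X" using F G by (simp_all add: bimod_hom_iff)
  note cl = add_hom_closed[OF F'] add_hom_closed[OF G']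
  define P where "P = Y\<lparr>carrier := {y \<in> carrier Y. G y = \<zero>\<^bsub>X\<^esub>}\<rparr>"
  define k where "k = (\<lambda>(x, p). F x \<oplus>\<^bsub>Y\<^esub> p)"
  have P: "bimodule R S P" unfolding P_def by (rule bimodule_kernel[OF Y X G])
  have k: "k \<in> bimod_hom R S (bimod_sum X P) Y"
    using F unfolding bimod_hom_iff add_hom_iff
    by (auto simp: k_def P_def Y.M.a_ac Y.smult_r_distr Y.rsmult_l_distr Y.smult_closed Y.rsmult_closed Pi_iff)
  have "bij_betw k (carrier (bimod_sum X P)) (carrier Y)"
  \<comment> \<open>The second component subtracts from \<open>y\<close> its part in the image of
    \<open>F\<close>, so \<open>G\<close> kills it.\<close>
  proof (rule bij_betwI[where g = "\<lambda>y. (G y, y \<ominus>\<^bsub>Y\<^esub> F (G y))"])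
    show "k \<in> carrier (bimod_sum X P) \<rightarrow> carrier Y"
      using k unfolding bimod_hom_iff add_hom_iff by blast
    show "(\<lambda>y. (G y, y \<ominus>\<^bsub>Y\<^esub> F (G y))) \<in> carrier Y \<rightarrow> carrier (bimod_sum X P)"
      by (auto simp: P_def cl add_hom_add[OF G'] a_minus_def add_hom_minus[OF ab G'] GF X.M.r_neg)
    show "(G (k q), k q \<ominus>\<^bsub>Y\<^esub> F (G (k q))) = q" if "q \<in> carrier (bimod_sum X P)" for q
      using that
      by (auto simp: k_def P_def cl add_hom_add[OF G'] GF a_minus_def Y.M.r_neg1 Y.M.a_ac Y.M.r_neg Y.M.a_lcomm)
    show "k (G y, y \<ominus>\<^bsub>Y\<^esub> F (G y)) = y" if "y \<in> carrier Y" for y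
      using that by (auto simp: k_def cl a_minus_def Y.M.a_lcomm Y.M.r_neg)
  qed
  with P k show ?thesis unfolding bimod_isomorphic_def bimod_hom_def by blast
qed

text \<open>The \<open>i\<close>-th coordinate inclusion. For \<open>i \<ge> n\<close> it is the
  zero map, so \<open>power_inj_hom\<close> holds for every index.\<close>

definition power_inj :: "('r, 's, 'm, 'j) bimodule_scheme \<Rightarrow> nat \<Rightarrow> nat \<Rightarrow> 'm \<Rightarrow> nat \<Rightarrow> 'm"
  where "power_inj M n i x = (\<lambda>j\<in>{..<n}. if j = i then x else \<zero>\<^bsub>M\<^esub>)"

lemma power_inj_hom:
  assumes "bimodule R S M" shows "power_inj M n i \<in> bimod_hom R S M (bimod_power M n)"
proof -
  interpret M: bimodule R S M by fact
  show ?thesis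
    unfolding bimod_hom_iff add_hom_iff
    by (auto simp: power_inj_def M.smult_zero M.zero_rsmult fun_eq_iff)
qed

text \<open>An element of the power is the sum of its coordinate inclusions, and \<open>q\<close> is
  additive.\<close>

lemma power_hom_decomp:
  assumes M: "bimodule R S M" and N: "abelian_group N" and q: "q \<in> add_hom (bimod_power M n) N"
    and y: "y \<in> carrier (bimod_power M n)"
  shows "q y = (\<Oplus>\<^bsub>N\<^esub>i\<in>{..<n}. q (power_inj M n i (y i)))"
proof -
  interpret M: bimodule R S M by fact
  interpret N: abelian_group N by fact
  have q0: "q \<zero>\<^bsub>bimod_power M n\<^esub> = \<zero>\<^bsub>N\<^esub>"
    using bimodule_abelian_group[OF bimodule_power[OF M]] N q by (rule add_hom_zero)
  have yi: "y i \<in> carrier M" if "i < n" for i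
    using y that by auto
  have inj: "power_inj M n i (y i) \<in> carrier (bimod_power M n)" if "i < n" for i
    using yi[OF that] by (auto simp: power_inj_def)
  \<comment> \<open>Truncation to the first \<open>k\<close> coordinates: \<open>z 0\<close> is
    zero, \<open>z n\<close> is \<open>y\<close>, and each step adds one coordinate
    inclusion.\<close>
  define z where "z k = (\<lambda>i\<in>{..<n}. if i < k then y i else \<zero>\<^bsub>M\<^esub>)" for k
  have z: "z k \<in> carrier (bimod_power M n)" for k
    using yi by (auto simp: z_def)
  have qz: "q (z k) = (\<Oplus>\<^bsub>N\<^esub>i\<in>{..<k}. q (power_inj M n i (y i)))" if "k \<le> n" for k
    using that
  proof (induction k)
    case 0
    then show ?case using q0 by (simp add: z_def restrict_def)
  next
    case (Suc k)
    have zk: "z (Suc k) = power_inj M n k (y k) \<oplus>\<^bsub>bimod_power M n\<^esub> z k"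
      using yi Suc.prems by (auto simp: z_def power_inj_def fun_eq_iff less_Suc_eq)
    have "q (z (Suc k)) = q (power_inj M n k (y k)) \<oplus>\<^bsub>N\<^esub> q (z k)"
      unfolding zk using Suc.prems by (intro add_hom_add[OF q inj z]) simp
    moreover have "(\<Oplus>\<^bsub>N\<^esub>i\<in>{..<Suc k}. q (power_inj M n i (y i))) =
        q (power_inj M n k (y k)) \<oplus>\<^bsub>N\<^esub> (\<Oplus>\<^bsub>N\<^esub>i\<in>{..<k}. q (power_inj M n i (y i)))"
      unfolding lessThan_Suc using Suc.prems
      by (intro N.finsum_insert) (auto intro!: add_hom_closed[OF q inj])
    ultimately show ?case
      using Suc by simp
  qed
  have "z n = y"
    using y by (auto simp: z_def fun_eq_iff extensional_def PiE_iff)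
  then show ?thesis using qz[of n] by simp
qed

section \<open>Divisibility as a decomposition of the identity\<close>

definition factor_through ::
    "('r, 'i) ring_scheme \<Rightarrow> ('s, 'h) ring_scheme \<Rightarrow>
      ('r, 's, 'x, 'j) bimodule_scheme \<Rightarrow> ('r, 's, 'y, 'k) bimodule_scheme \<Rightarrow> ('x \<Rightarrow> 'x) set"
  where "factor_through R S X Y =
    {k. \<exists>f\<in>bimod_hom R S X Y. \<exists>g\<in>bimod_hom R S Y X. k = (\<lambda>x. g (f x))}"

lemma factor_throughI:
  "f \<in> bimod_hom R S X Y \<Longrightarrow> g \<in> bimod_hom R S Y X \<Longrightarrow> (\<lambda>x. g (f x)) \<in> factor_through R S X Y"
  unfolding factor_through_def by blast

lemma factor_through_funcset: "factor_through R S X Y \<subseteq> carrier X \<rightarrow> carrier X"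
  by (auto simp: factor_through_def bimod_hom_iff add_hom_iff Pi_iff)

text \<open>An isomorphism of \<open>X \<oplus> P\<close> with \<open>Y\<^sup>n\<close> gives a
  split embedding of \<open>X\<close> into the power, and the coordinates of embedding and
  retraction are the required factors. Conversely, factors assemble to a split embedding, and the
  kernel of the retraction serves as \<open>P\<close>.\<close>

theorem bimod_divides_iff:
  fixes X :: "('r, 's, 'x, 'j) bimodule_scheme" and Y :: "('r, 's, 'y, 'k) bimodule_scheme"
  assumes X: "bimodule R S X" and Y: "bimodule R S Y"
  shows "bimod_divides R S X Y \<longleftrightarrow> sum_of X (carrier X) (factor_through R S X Y) (\<lambda>x. x)"
proof
  interpret X: bimodule R S X by fact
  interpret Y: bimodule R S Y by fact
  assume "bimod_divides R S X Y"
  then obtain P :: "('r, 's, nat \<Rightarrow> 'y) bimodule" and n \<theta>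
    where P: "bimodule R S P" and \<theta>: "\<theta> \<in> bimod_hom R S (bimod_sum X P) (bimod_power Y n)"
      and bij: "bij_betw \<theta> (carrier (bimod_sum X P)) (carrier (bimod_power Y n))"
    unfolding bimod_divides_def bimod_isomorphic_def bimod_hom_def by blast
  interpret P: bimodule R S P by fact
  define \<theta>' where "\<theta>' = inv_into (carrier (bimod_sum X P)) \<theta>"
  have sum: "bimodule R S (bimod_sum X P)" by (rule bimodule_sum[OF X P])
  have \<theta>': "\<theta>' \<in> bimod_hom R S (bimod_power Y n) (bimod_sum X P)"
    unfolding \<theta>'_def using sum \<theta> bij by (rule bimod_hom_inv)
  have "fst \<in> bimod_hom R S (bimod_sum X P) X"
    unfolding bimod_hom_iff add_hom_iff by auto
  with \<theta>' have q: "(\<lambda>y. fst (\<theta>' y)) \<in> bimod_hom R S (bimod_power Y n) X"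
    by (rule bimod_hom_comp)
  have "(\<lambda>x. (x, \<zero>\<^bsub>P\<^esub>)) \<in> bimod_hom R S X (bimod_sum X P)"
    unfolding bimod_hom_iff add_hom_iff by (auto simp: P.smult_zero P.zero_rsmult)
  then have p: "(\<lambda>x. \<theta> (x, \<zero>\<^bsub>P\<^esub>)) \<in> bimod_hom R S X (bimod_power Y n)"
    using \<theta> by (rule bimod_hom_comp)
  show "sum_of X (carrier X) (factor_through R S X Y) (\<lambda>x. x)"
  \<comment> \<open>The \<open>i\<close>-th summand is the \<open>i\<close>-th coordinate of the
    embedding followed by the retraction restricted to the \<open>i\<close>-th copy of
    \<open>Y\<close>.\<close>
  proof (rule sum_ofI[where n = n and g = "\<lambda>i x. fst (\<theta>' (power_inj Y n i (\<theta> (x, \<zero>\<^bsub>P\<^esub>) i)))"])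
    fix i assume i: "i < n"
    have "(\<lambda>y. y i) \<in> bimod_hom R S (bimod_power Y n) Y"
      using i unfolding bimod_hom_iff add_hom_iff by auto
    with p have "(\<lambda>x. \<theta> (x, \<zero>\<^bsub>P\<^esub>) i) \<in> bimod_hom R S X Y"
      by (rule bimod_hom_comp)
    moreover have "(\<lambda>y. fst (\<theta>' (power_inj Y n i y))) \<in> bimod_hom R S Y X"
      using power_inj_hom[OF Y] q by (rule bimod_hom_comp)
    ultimately show "(\<lambda>x. fst (\<theta>' (power_inj Y n i (\<theta> (x, \<zero>\<^bsub>P\<^esub>) i)))) \<in> factor_through R S X Y"
      by (rule factor_throughI)
  next
    fix x assume x: "x \<in> carrier X"
    then have "\<theta>' (\<theta> (x, \<zero>\<^bsub>P\<^esub>)) = (x, \<zero>\<^bsub>P\<^esub>)"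
      unfolding \<theta>'_def using bij by (intro inv_into_f_f) (auto simp: bij_betw_def)
    moreover have "\<theta> (x, \<zero>\<^bsub>P\<^esub>) \<in> carrier (bimod_power Y n)"
      using p x unfolding bimod_hom_iff add_hom_iff by auto
    then have "fst (\<theta>' (\<theta> (x, \<zero>\<^bsub>P\<^esub>))) =
        (\<Oplus>\<^bsub>X\<^esub>i\<in>{..<n}. fst (\<theta>' (power_inj Y n i (\<theta> (x, \<zero>\<^bsub>P\<^esub>) i))))"
      using q by (intro power_hom_decomp[OF Y X.M.abelian_group_axioms]) (simp_all add: bimod_hom_iff)
    ultimately show "x = (\<Oplus>\<^bsub>X\<^esub>i\<in>{..<n}. fst (\<theta>' (power_inj Y n i (\<theta> (x, \<zero>\<^bsub>P\<^esub>) i))))"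
      by simp
  qed
next
  interpret X: bimodule R S X by fact
  interpret Y: bimodule R S Y by fact
  assume "sum_of X (carrier X) (factor_through R S X Y) (\<lambda>x. x)"
  then obtain n :: nat and k where k: "\<And>i. i < n \<Longrightarrow> k i \<in> factor_through R S X Y"
      and id: "\<And>x. x \<in> carrier X \<Longrightarrow> x = (\<Oplus>\<^bsub>X\<^esub>i\<in>{..<n}. k i x)"
    by (rule sum_ofE) blast
  have "\<forall>i\<in>{..<n}. \<exists>f g. k i = (\<lambda>x. g (f x)) \<and> f \<in> bimod_hom R S X Y \<and> g \<in> bimod_hom R S Y X"
  proof
    fix i assume "i \<in> {..<n}"
    then have "k i \<in> factor_through R S X Y" using k by simp
    then show "\<exists>f g. k i = (\<lambda>x. g (f x)) \<and> f \<in> bimod_hom R S X Y \<and> g \<in> bimod_hom R S Y X"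
      unfolding factor_through_def by blast
  qed
  then obtain f g where fg: "\<And>i. i < n \<Longrightarrow> k i = (\<lambda>x. g i (f i x))"
      "\<And>i. i < n \<Longrightarrow> f i \<in> bimod_hom R S X Y" "\<And>i. i < n \<Longrightarrow> g i \<in> bimod_hom R S Y X"
    unfolding bchoice_iff by (metis lessThan_iff)
  have F: "(\<lambda>x. \<lambda>i\<in>{..<n}. f i x) \<in> bimod_hom R S X (bimod_power Y n)"
    using fg(2) unfolding bimod_hom_iff add_hom_iff by (auto simp: Pi_iff fun_eq_iff)
  have gi: "(\<lambda>y. g i (y i)) \<in> bimod_hom R S (bimod_power Y n) X" if "i \<in> {..<n}" for i
  proof -
    have "(\<lambda>y. y i) \<in> bimod_hom R S (bimod_power Y n) Y"
      using that unfolding bimod_hom_iff add_hom_iff by auto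
    then show ?thesis using fg(3)[of i] that by (auto elim: bimod_hom_comp)
  qed
  then have G: "(\<lambda>y. \<Oplus>\<^bsub>X\<^esub>i\<in>{..<n}. g i (y i)) \<in> bimod_hom R S (bimod_power Y n) X"
    using left_hom_finsum[OF bimodule_left_module[OF X], of "{..<n}" "\<lambda>i y. g i (y i)" "bimod_power Y n"]
      right_hom_finsum[OF bimodule_right_module[OF X], of "{..<n}" "\<lambda>i y. g i (y i)" "bimod_power Y n"]
    by (auto simp: bimod_hom_def)
  have "(\<Oplus>\<^bsub>X\<^esub>i\<in>{..<n}. g i ((\<lambda>i\<in>{..<n}. f i x) i)) = x" if "x \<in> carrier X" for x
  proof -
    have "(\<Oplus>\<^bsub>X\<^esub>i\<in>{..<n}. g i ((\<lambda>i\<in>{..<n}. f i x) i)) = (\<Oplus>\<^bsub>X\<^esub>i\<in>{..<n}. k i x)"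
      using fg that by (intro X.M.finsum_cong') (auto simp: bimod_hom_iff add_hom_iff Pi_iff)
    then show ?thesis using id[OF that] by simp
  qed
  then obtain P :: "('r, 's, nat \<Rightarrow> 'y) bimodule"
    where "bimodule R S P" "bimod_isomorphic R S (bimod_sum X P) (bimod_power Y n)"
    using bimod_retract_complement[OF X bimodule_power[OF Y] F G] by blast
  then show "bimod_divides R S X Y"
    unfolding bimod_divides_def by blast
qed

section \<open>Opposite bimodules and restriction of scalars\<close>

lemma bimoduleI:
  assumes "ring R" "ring S" "abelian_group M"
    and "\<And>r x. \<lbrakk>r \<in> carrier R; x \<in> carrier M\<rbrakk> \<Longrightarrow> r \<odot>\<^bsub>M\<^esub> x \<in> carrier M"
    and "\<And>r r' x. \<lbrakk>r \<in> carrier R; r' \<in> carrier R; x \<in> carrier M\<rbrakk> \<Longrightarrow>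
        (r \<oplus>\<^bsub>R\<^esub> r') \<odot>\<^bsub>M\<^esub> x = r \<odot>\<^bsub>M\<^esub> x \<oplus>\<^bsub>M\<^esub> r' \<odot>\<^bsub>M\<^esub> x"
    and "\<And>r x y. \<lbrakk>r \<in> carrier R; x \<in> carrier M; y \<in> carrier M\<rbrakk> \<Longrightarrow>
        r \<odot>\<^bsub>M\<^esub> (x \<oplus>\<^bsub>M\<^esub> y) = r \<odot>\<^bsub>M\<^esub> x \<oplus>\<^bsub>M\<^esub> r \<odot>\<^bsub>M\<^esub> y"
    and "\<And>r r' x. \<lbrakk>r \<in> carrier R; r' \<in> carrier R; x \<in> carrier M\<rbrakk> \<Longrightarrow>
        (r \<otimes>\<^bsub>R\<^esub> r') \<odot>\<^bsub>M\<^esub> x = r \<odot>\<^bsub>M\<^esub> (r' \<odot>\<^bsub>M\<^esub> x)"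
    and "\<And>x. x \<in> carrier M \<Longrightarrow> \<one>\<^bsub>R\<^esub> \<odot>\<^bsub>M\<^esub> x = x"
    and "\<And>x s. \<lbrakk>x \<in> carrier M; s \<in> carrier S\<rbrakk> \<Longrightarrow> x \<bullet>\<^bsub>M\<^esub> s \<in> carrier M"
    and "\<And>x s s'. \<lbrakk>x \<in> carrier M; s \<in> carrier S; s' \<in> carrier S\<rbrakk> \<Longrightarrow>
        x \<bullet>\<^bsub>M\<^esub> (s \<oplus>\<^bsub>S\<^esub> s') = x \<bullet>\<^bsub>M\<^esub> s \<oplus>\<^bsub>M\<^esub> x \<bullet>\<^bsub>M\<^esub> s'"
    and "\<And>x y s. \<lbrakk>x \<in> carrier M; y \<in> carrier M; s \<in> carrier S\<rbrakk> \<Longrightarrow>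
        (x \<oplus>\<^bsub>M\<^esub> y) \<bullet>\<^bsub>M\<^esub> s = x \<bullet>\<^bsub>M\<^esub> s \<oplus>\<^bsub>M\<^esub> y \<bullet>\<^bsub>M\<^esub> s"
    and "\<And>x s s'. \<lbrakk>x \<in> carrier M; s \<in> carrier S; s' \<in> carrier S\<rbrakk> \<Longrightarrow>
        x \<bullet>\<^bsub>M\<^esub> (s \<otimes>\<^bsub>S\<^esub> s') = (x \<bullet>\<^bsub>M\<^esub> s) \<bullet>\<^bsub>M\<^esub> s'"
    and "\<And>x. x \<in> carrier M \<Longrightarrow> x \<bullet>\<^bsub>M\<^esub> \<one>\<^bsub>S\<^esub> = x"
    and "\<And>r x s. \<lbrakk>r \<in> carrier R; x \<in> carrier M; s \<in> carrier S\<rbrakk> \<Longrightarrow>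
        (r \<odot>\<^bsub>M\<^esub> x) \<bullet>\<^bsub>M\<^esub> s = r \<odot>\<^bsub>M\<^esub> (x \<bullet>\<^bsub>M\<^esub> s)"
  shows "bimodule R S M"
  using assms
  by (intro bimodule.intro left_module.intro right_module.intro left_module_axioms.intro
      right_module_axioms.intro bimodule_axioms.intro) auto

lemma abelian_group_cong:
  assumes "abelian_group M" "carrier N = carrier M" "add N = add M" "\<zero>\<^bsub>N\<^esub> = \<zero>\<^bsub>M\<^esub>"
  shows "abelian_group N"
proof -
  interpret abelian_group M by fact
  show ?thesis
    by (rule abelian_groupI) (auto simp: assms a_ac intro: l_neg)
qed

lemma opposite_ring_simps [simp]:
  "carrier (opposite_ring S) = carrier S"
  "x \<oplus>\<^bsub>opposite_ring S\<^esub> y = x \<oplus>\<^bsub>S\<^esub> y"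
  "x \<otimes>\<^bsub>opposite_ring S\<^esub> y = y \<otimes>\<^bsub>S\<^esub> x"
  "\<zero>\<^bsub>opposite_ring S\<^esub> = \<zero>\<^bsub>S\<^esub>"
  "\<one>\<^bsub>opposite_ring S\<^esub> = \<one>\<^bsub>S\<^esub>"
  "opposite_ring (opposite_ring S) = S"
  by (simp_all add: opposite_ring_def)

lemma ring_opposite_ring:
  assumes "ring S" shows "ring (opposite_ring S)"
proof -
  interpret ring S by fact
  have "abelian_group (opposite_ring S)"
    by (rule abelian_group_cong[OF abelian_group_axioms]) (auto simp: fun_eq_iff opposite_ring_def)
  moreover have "monoid (opposite_ring S)"
    by (rule monoidI) (auto simp: m_assoc)
  ultimately show ?thesis
    by (rule ringI) (auto simp: l_distr r_distr)
qed

lemma ring_hom_opposite_ring: "h \<in> ring_hom B A \<Longrightarrow> h \<in> ring_hom (opposite_ring B) (opposite_ring A)"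
  by (auto simp: ring_hom_def)

text \<open>The meaningless fields \<open>mult\<close> and \<open>one\<close> are copied, which
  makes the construction an involution on records and turns facts such as
  \<open>opposite_left_dual\<close> into equalities of records.\<close>

definition opposite_bimod ::
    "('r, 's, 'm, 'j) bimodule_scheme \<Rightarrow> ('s, 'r, 'm) bimodule"
  where "opposite_bimod M =
    \<lparr>carrier = carrier M, monoid.mult = monoid.mult M, one = \<one>\<^bsub>M\<^esub>, ring.zero = \<zero>\<^bsub>M\<^esub>, add = add M,
     smult = (\<lambda>s x. x \<bullet>\<^bsub>M\<^esub> s), rsmult = (\<lambda>x r. r \<odot>\<^bsub>M\<^esub> x)\<rparr>"

lemma opposite_bimod_simps [simp]:
  "carrier (opposite_bimod M) = carrier M"
  "x \<oplus>\<^bsub>opposite_bimod M\<^esub> y = x \<oplus>\<^bsub>M\<^esub> y"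
  "\<zero>\<^bsub>opposite_bimod M\<^esub> = \<zero>\<^bsub>M\<^esub>"
  "s \<odot>\<^bsub>opposite_bimod M\<^esub> x = x \<bullet>\<^bsub>M\<^esub> s"
  "x \<bullet>\<^bsub>opposite_bimod M\<^esub> r = r \<odot>\<^bsub>M\<^esub> x"
  by (simp_all add: opposite_bimod_def)

lemma finsum_opposite_bimod [simp]: "finsum (opposite_bimod M) = finsum M"
  by (simp add: finsum_def finprod_def opposite_bimod_def fun_eq_iff)

lemma bimodule_opposite:
  assumes "bimodule R S M" shows "bimodule (opposite_ring S) (opposite_ring R) (opposite_bimod M)"
proof -
  interpret M: bimodule R S M by fact
  have "abelian_group (opposite_bimod M)"
    by (rule abelian_group_cong[OF M.M.abelian_group_axioms]) (auto simp: fun_eq_iff opposite_bimod_def)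
  then show ?thesis
    by (intro bimoduleI ring_opposite_ring M.R.ring_axioms M.S.ring_axioms)
      (auto simp: M.smult_closed M.rsmult_closed M.smult_l_distr M.smult_r_distr
        M.smult_assoc M.smult_one M.rsmult_l_distr M.rsmult_r_distr M.rsmult_assoc M.rsmult_one
        M.smult_rsmult)
qed

lemma bimod_hom_opposite:
  "bimod_hom (opposite_ring S) (opposite_ring R) (opposite_bimod M) (opposite_bimod N) =
    bimod_hom R S M N"
  by (auto simp: bimod_hom_def left_hom_def right_hom_def)

text \<open>Passing to the opposite changes neither the homomorphisms nor the addition, so the
  decompositions of the identity on both sides are literally the same. No complement has to be
  transported.\<close>

lemma bimod_divides_opposite:
  assumes X: "bimodule R S X" and Y: "bimodule R S Y"
  shows "bimod_divides (opposite_ring S) (opposite_ring R) (opposite_bimod X) (opposite_bimod Y) \<longleftrightarrow>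
    bimod_divides R S X Y"
  unfolding bimod_divides_iff[OF bimodule_opposite[OF X] bimodule_opposite[OF Y]]
    bimod_divides_iff[OF X Y] factor_through_def bimod_hom_opposite sum_of_def
  by simp

text \<open>The tensor square is kept as a single \<open>(A,A)\<close>-bimodule; restriction along
  \<open>id\<close> and \<open>h\<close> yields the \<open>(A,B)\<close>- and
  \<open>(B,A)\<close>-structures of the two depth two conditions.\<close>

definition restrict_scalars ::
    "('r \<Rightarrow> 'a) \<Rightarrow> ('s \<Rightarrow> 'b) \<Rightarrow> ('a, 'b, 'm, 'j) bimodule_scheme \<Rightarrow> ('r, 's, 'm) bimodule"
  where "restrict_scalars \<phi> \<psi> M =
    \<lparr>carrier = carrier M, monoid.mult = monoid.mult M, one = \<one>\<^bsub>M\<^esub>, ring.zero = \<zero>\<^bsub>M\<^esub>, add = add M,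
     smult = (\<lambda>r x. \<phi> r \<odot>\<^bsub>M\<^esub> x), rsmult = (\<lambda>x s. x \<bullet>\<^bsub>M\<^esub> \<psi> s)\<rparr>"

lemma restrict_scalars_simps [simp]:
  "carrier (restrict_scalars \<phi> \<psi> M) = carrier M"
  "x \<oplus>\<^bsub>restrict_scalars \<phi> \<psi> M\<^esub> y = x \<oplus>\<^bsub>M\<^esub> y"
  "\<zero>\<^bsub>restrict_scalars \<phi> \<psi> M\<^esub> = \<zero>\<^bsub>M\<^esub>"
  "r \<odot>\<^bsub>restrict_scalars \<phi> \<psi> M\<^esub> x = \<phi> r \<odot>\<^bsub>M\<^esub> x"
  "x \<bullet>\<^bsub>restrict_scalars \<phi> \<psi> M\<^esub> s = x \<bullet>\<^bsub>M\<^esub> \<psi> s"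
  by (simp_all add: restrict_scalars_def)

lemma finsum_restrict_scalars [simp]: "finsum (restrict_scalars \<phi> \<psi> M) = finsum M"
  by (simp add: finsum_def finprod_def restrict_scalars_def fun_eq_iff)

lemma bimodule_restrict_scalars:
  assumes "bimodule A A' M" "ring R" "ring S" "\<phi> \<in> ring_hom R A" "\<psi> \<in> ring_hom S A'"
  shows "bimodule R S (restrict_scalars \<phi> \<psi> M)"
proof -
  interpret M: bimodule A A' M by fact
  have "abelian_group (restrict_scalars \<phi> \<psi> M)"
    by (rule abelian_group_cong[OF M.M.abelian_group_axioms])
      (auto simp: fun_eq_iff restrict_scalars_def)
  then show ?thesis
    using assms(2-5)
    by (intro bimoduleI)
      (auto simp: ring_hom_def Pi_iff M.smult_closed M.rsmult_closed M.smult_l_distr M.smult_r_distr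
        M.smult_assoc M.smult_one M.rsmult_l_distr M.rsmult_r_distr M.rsmult_assoc M.rsmult_one
        M.smult_rsmult)
qed

lemma restrict_scalars_opposite:
  "opposite_bimod (restrict_scalars \<phi> \<psi> M) = restrict_scalars \<psi> \<phi> (opposite_bimod M)"
  by (simp add: opposite_bimod_def restrict_scalars_def)

lemma ring_bimod_simps [simp]:
  "carrier (ring_bimod A \<phi> \<psi>) = carrier A"
  "x \<oplus>\<^bsub>ring_bimod A \<phi> \<psi>\<^esub> y = x \<oplus>\<^bsub>A\<^esub> y"
  "\<zero>\<^bsub>ring_bimod A \<phi> \<psi>\<^esub> = \<zero>\<^bsub>A\<^esub>"
  "r \<odot>\<^bsub>ring_bimod A \<phi> \<psi>\<^esub> x = \<phi> r \<otimes>\<^bsub>A\<^esub> x"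
  "x \<bullet>\<^bsub>ring_bimod A \<phi> \<psi>\<^esub> s = x \<otimes>\<^bsub>A\<^esub> \<psi> s"
  by (simp_all add: ring_bimod_def)

lemma finsum_ring_bimod [simp]: "finsum (ring_bimod A \<phi> \<psi>) = finsum A"
  by (simp add: finsum_def finprod_def ring_bimod_def fun_eq_iff)

lemma bimodule_ring_bimod:
  assumes "ring A" "ring R" "ring S" "\<phi> \<in> ring_hom R A" "\<psi> \<in> ring_hom S A"
  shows "bimodule R S (ring_bimod A \<phi> \<psi>)"
proof -
  interpret ring A by fact
  have "abelian_group (ring_bimod A \<phi> \<psi>)"
    by (rule abelian_group_cong[OF abelian_group_axioms]) (auto simp: fun_eq_iff ring_bimod_def)
  then show ?thesis
    using assms(2-5)
    by (intro bimoduleI) (auto simp: ring_hom_def Pi_iff l_distr r_distr m_assoc)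
qed

lemma id_ring_hom: "id \<in> ring_hom A A"
  by (auto simp: ring_hom_def)

section \<open>Dual modules and dual bases\<close>

lemma right_dual_simps [simp]:
  "carrier (right_dual S M) = right_hom S M (ring_bimod S id id) \<inter> extensional (carrier M)"
  "\<zero>\<^bsub>right_dual S M\<^esub> = (\<lambda>x\<in>carrier M. \<zero>\<^bsub>S\<^esub>)"
  "f \<oplus>\<^bsub>right_dual S M\<^esub> g = (\<lambda>x\<in>carrier M. f x \<oplus>\<^bsub>S\<^esub> g x)"
  "s \<odot>\<^bsub>right_dual S M\<^esub> f = (\<lambda>x\<in>carrier M. s \<otimes>\<^bsub>S\<^esub> f x)"
  "f \<bullet>\<^bsub>right_dual S M\<^esub> r = (\<lambda>x\<in>carrier M. f (r \<odot>\<^bsub>M\<^esub> x))"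
  by (simp_all add: right_dual_def)

lemma bimodule_right_dual:
  assumes "bimodule R S M" shows "bimodule S R (right_dual S M)"
proof -
  interpret M: bimodule R S M by fact
  have "abelian_group (right_dual S M)"
  proof (rule abelian_groupI)
    fix f assume f: "f \<in> carrier (right_dual S M)"
    show "\<exists>g\<in>carrier (right_dual S M). g \<oplus>\<^bsub>right_dual S M\<^esub> f = \<zero>\<^bsub>right_dual S M\<^esub>"
      using f by (intro bexI[of _ "\<lambda>x\<in>carrier M. \<ominus>\<^bsub>S\<^esub> f x"])
        (auto simp: right_hom_def Pi_iff M.S.l_neg M.S.minus_add M.S.l_minus M.rsmult_closed)
    show "\<zero>\<^bsub>right_dual S M\<^esub> \<oplus>\<^bsub>right_dual S M\<^esub> f = f"
      using f by (auto simp: right_hom_def Pi_iff extensional_def)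
  qed (auto simp: right_hom_def Pi_iff M.S.a_ac M.rsmult_closed M.S.l_distr intro!: restrict_ext)
  then show ?thesis
    by (intro bimoduleI M.R.ring_axioms M.S.ring_axioms)
      (auto simp: right_hom_def Pi_iff M.smult_closed M.rsmult_closed M.smult_r_distr
        M.smult_rsmult[symmetric] M.S.r_distr M.S.l_distr M.S.m_assoc M.smult_l_distr M.smult_assoc M.smult_one
        extensional_def fun_eq_iff)
qed

text \<open>Reversing both products turns left linear functionals into right linear ones and
  exchanges the actions on the dual. Hence the divisibility in the left QF condition is the one in
  the right QF condition of the opposite extension.\<close>

lemma opposite_left_dual:
  "opposite_bimod (left_dual B (ring_bimod A h id)) =
    right_dual (opposite_ring B) (ring_bimod (opposite_ring A) id h)"
  by (auto simp: opposite_bimod_def left_dual_def right_dual_def left_hom_def right_hom_def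
      fun_eq_iff)

section \<open>Free modules and the dual basis lemma\<close>

lemma module_sum_simps [simp]:
  "carrier (module_sum M N) = carrier M \<times> carrier N"
  "\<zero>\<^bsub>module_sum M N\<^esub> = (\<zero>\<^bsub>M\<^esub>, \<zero>\<^bsub>N\<^esub>)"
  "(x, y) \<oplus>\<^bsub>module_sum M N\<^esub> (x', y') = (x \<oplus>\<^bsub>M\<^esub> x', y \<oplus>\<^bsub>N\<^esub> y')"
  "r \<odot>\<^bsub>module_sum M N\<^esub> (x, y) = (r \<odot>\<^bsub>M\<^esub> x, r \<odot>\<^bsub>N\<^esub> y)"
  by (simp_all add: module_sum_def)

lemma left_module_sum:
  assumes "left_module R M" "left_module R N" shows "left_module R (module_sum M N)"
proof -
  interpret M: left_module R M by fact
  interpret N: left_module R N by fact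
  have "abelian_group (module_sum M N)"
  proof (rule abelian_groupI)
    fix p assume p: "p \<in> carrier (module_sum M N)"
    show "\<exists>q\<in>carrier (module_sum M N). q \<oplus>\<^bsub>module_sum M N\<^esub> p = \<zero>\<^bsub>module_sum M N\<^esub>"
      using p by (intro bexI[of _ "(\<ominus>\<^bsub>M\<^esub> fst p, \<ominus>\<^bsub>N\<^esub> snd p)"]) (auto simp: M.M.l_neg N.M.l_neg)
  qed (auto simp: M.M.a_ac N.M.a_ac)
  then show ?thesis
    by (intro left_module.intro left_module_axioms.intro M.R.ring_axioms)
      (auto simp: M.smult_closed M.smult_l_distr M.smult_r_distr M.smult_assoc M.smult_one
        N.smult_closed N.smult_l_distr N.smult_r_distr N.smult_assoc N.smult_one)
qed

lemma free_module_simps [simp]: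
  "carrier (free_module R I) = {f \<in> I \<rightarrow>\<^sub>E carrier R. finite {i \<in> I. f i \<noteq> \<zero>\<^bsub>R\<^esub>}}"
  "f \<oplus>\<^bsub>free_module R I\<^esub> g = (\<lambda>i\<in>I. f i \<oplus>\<^bsub>R\<^esub> g i)"
  "r \<odot>\<^bsub>free_module R I\<^esub> f = (\<lambda>i\<in>I. r \<otimes>\<^bsub>R\<^esub> f i)"
  by (simp_all add: free_module_def)

text \<open>The function \<open>f\<close>, cut off outside the finite set \<open>J\<close>, is a
  combination of standard basis vectors, built up one index at a time.\<close>

lemma free_module_hom_decomp:
  assumes R: "ring R" and M: "left_module R M" and q: "q \<in> left_hom R (free_module R I) M"
    and f: "f \<in> I \<rightarrow>\<^sub>E carrier R" and J: "finite J" "J \<subseteq> I"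
  shows "q (\<lambda>i\<in>I. if i \<in> J then f i else \<zero>\<^bsub>R\<^esub>) =
    (\<Oplus>\<^bsub>M\<^esub>j\<in>J. f j \<odot>\<^bsub>M\<^esub> q (\<lambda>i\<in>I. if i = j then \<one>\<^bsub>R\<^esub> else \<zero>\<^bsub>R\<^esub>))"
proof -
  interpret R: ring R by fact
  interpret M: left_module R M by fact
  define e where "e j = (\<lambda>i\<in>I. if i = j then \<one>\<^bsub>R\<^esub> else \<zero>\<^bsub>R\<^esub>)" for j
  define z where "z J = (\<lambda>i\<in>I. if i \<in> J then f i else \<zero>\<^bsub>R\<^esub>)" for J
  have q': "q \<in> add_hom (free_module R I) M"
    using q unfolding left_hom_iff by simp
  have fj: "f j \<in> carrier R" if "j \<in> I" for j
    using f that by auto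
  have e: "e j \<in> carrier (free_module R I)" for j
    by (auto simp: e_def)
  have fe: "f j \<odot>\<^bsub>free_module R I\<^esub> e j \<in> carrier (free_module R I)" if "j \<in> I" for j
    using fj[OF that] by (auto simp: e_def intro: finite_subset[of _ "{j}"])
  have z: "z J \<in> carrier (free_module R I)" if "finite J" for J
    using fj that by (auto simp: z_def intro: finite_subset[of _ J])
  have qe: "f j \<odot>\<^bsub>M\<^esub> q (e j) \<in> carrier M" if "j \<in> I" for j
    using fj[OF that] e by (intro M.smult_closed add_hom_closed[OF q'])
  have "q (z J) = (\<Oplus>\<^bsub>M\<^esub>j\<in>J. f j \<odot>\<^bsub>M\<^esub> q (e j))"
    using J
  proof (induction J)
    case empty
    \<comment> \<open>\<open>add_hom_zero\<close> would ask for the abelian group structure of the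
      free module. Idempotence of the zero vector under addition is enough to obtain that
      \<open>q\<close> kills it.\<close>
    have "z {} \<oplus>\<^bsub>free_module R I\<^esub> z {} = z {}"
      by (auto simp: z_def fun_eq_iff)
    then have "q (z {}) \<oplus>\<^bsub>M\<^esub> q (z {}) = q (z {})"
      using add_hom_add[OF q' z[of "{}"] z[of "{}"]] by simp
    then have "q (z {}) = \<zero>\<^bsub>M\<^esub>"
      using add_hom_closed[OF q' z[of "{}"]] M.M.add.l_cancel_one by simp
    then show ?case by simp
  next
    case (insert j J)
    have zj: "z (insert j J) = f j \<odot>\<^bsub>free_module R I\<^esub> e j \<oplus>\<^bsub>free_module R I\<^esub> z J"
      using insert fj by (auto simp: z_def e_def fun_eq_iff)
    have "q (z (insert j J)) = q (f j \<odot>\<^bsub>free_module R I\<^esub> e j) \<oplus>\<^bsub>M\<^esub> q (z J)"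
      unfolding zj using insert by (intro add_hom_add[OF q'] fe z) auto
    also have "q (f j \<odot>\<^bsub>free_module R I\<^esub> e j) = f j \<odot>\<^bsub>M\<^esub> q (e j)"
      using q e[of j] fj insert unfolding left_hom_iff by blast
    also have "(f j \<odot>\<^bsub>M\<^esub> q (e j)) \<oplus>\<^bsub>M\<^esub> q (z J) = (\<Oplus>\<^bsub>M\<^esub>j\<in>insert j J. f j \<odot>\<^bsub>M\<^esub> q (e j))"
      using insert qe by (subst M.M.finsum_insert) auto
    finally show ?case .
  qed
  then show ?thesis by (simp add: z_def e_def)
qed

text \<open>The functionals are the free coordinates restricted to the summand \<open>M\<close>, and
  the elements are the projections to \<open>M\<close> of the standard basis vectors. The basis
  \<open>I\<close> may be infinite; finite generation cuts it down, since a coordinate vanishing on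
  the generators vanishes on \<open>M\<close>.\<close>

theorem dual_basis:
  fixes M :: "('r, 'm, 'j) module_scheme"
  assumes M: "left_module R M" and fgp: "left_fg_projective R M"
  shows "\<exists>(J :: 'm set) \<xi> m. finite J \<and>
    (\<forall>j\<in>J. \<xi> j \<in> left_hom R M (ring_bimod R id id) \<and> m j \<in> carrier M) \<and>
    (\<forall>x\<in>carrier M. x = (\<Oplus>\<^bsub>M\<^esub>j\<in>J. \<xi> j x \<odot>\<^bsub>M\<^esub> m j))"
proof -
  interpret M: left_module R M by fact
  obtain I :: "'m set" and Q :: "('r, 'm \<Rightarrow> 'r) module" and \<theta> where Q: "left_module R Q"
    and \<theta>: "\<theta> \<in> left_hom R (module_sum M Q) (free_module R I)"
    and bij: "bij_betw \<theta> (carrier (module_sum M Q)) (carrier (free_module R I))"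
    using fgp unfolding left_fg_projective_def projective_def left_isomorphic_def by blast
  interpret Q: left_module R Q by fact
  obtain G where G: "finite G" "G \<subseteq> carrier M"
      "\<And>x. x \<in> carrier M \<Longrightarrow> \<exists>c\<in>G \<rightarrow> carrier R. x = (\<Oplus>\<^bsub>M\<^esub>g\<in>G. c g \<odot>\<^bsub>M\<^esub> g)"
    using fgp unfolding left_fg_projective_def finitely_generated_def by blast
  define \<theta>' where "\<theta>' = inv_into (carrier (module_sum M Q)) \<theta>"
  have "\<theta>' \<in> left_hom R (free_module R I) (module_sum M Q)"
    unfolding \<theta>'_def using left_module_sum[OF M Q] \<theta> bij by (rule left_hom_inv)
  then have q: "(\<lambda>f. fst (\<theta>' f)) \<in> left_hom R (free_module R I) M"
    unfolding left_hom_iff add_hom_iff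
    by (auto simp del: free_module_simps simp: module_sum_def Pi_iff mem_Times_iff split_beta)
  define k where "k i x = \<theta> (x, \<zero>\<^bsub>Q\<^esub>) i" for i x
  have \<theta>x: "\<theta> (x, \<zero>\<^bsub>Q\<^esub>) \<in> carrier (free_module R I)" if "x \<in> carrier M" for x
    using \<theta> that unfolding left_hom_iff add_hom_iff by auto
  have k: "k i \<in> left_hom R M (ring_bimod R id id)" if i: "i \<in> I" for i
  proof -
    have "\<theta> (x \<oplus>\<^bsub>M\<^esub> y, \<zero>\<^bsub>Q\<^esub>) = \<theta> (x, \<zero>\<^bsub>Q\<^esub>) \<oplus>\<^bsub>free_module R I\<^esub> \<theta> (y, \<zero>\<^bsub>Q\<^esub>)"
      if "x \<in> carrier M" "y \<in> carrier M" for x y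
    proof -
      have "\<theta> ((x, \<zero>\<^bsub>Q\<^esub>) \<oplus>\<^bsub>module_sum M Q\<^esub> (y, \<zero>\<^bsub>Q\<^esub>)) = \<theta> (x, \<zero>\<^bsub>Q\<^esub>) \<oplus>\<^bsub>free_module R I\<^esub> \<theta> (y, \<zero>\<^bsub>Q\<^esub>)"
        using \<theta> that unfolding left_hom_iff by (intro add_hom_add) auto
      then show ?thesis by simp
    qed
    moreover have "\<theta> (r \<odot>\<^bsub>M\<^esub> x, \<zero>\<^bsub>Q\<^esub>) = r \<odot>\<^bsub>free_module R I\<^esub> \<theta> (x, \<zero>\<^bsub>Q\<^esub>)"
      if "r \<in> carrier R" "x \<in> carrier M" for r x
    proof -
      have "(x, \<zero>\<^bsub>Q\<^esub>) \<in> carrier (module_sum M Q)" using that by simp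
      then have "\<theta> (r \<odot>\<^bsub>module_sum M Q\<^esub> (x, \<zero>\<^bsub>Q\<^esub>)) = r \<odot>\<^bsub>free_module R I\<^esub> \<theta> (x, \<zero>\<^bsub>Q\<^esub>)"
        using \<theta> that(1) unfolding left_hom_iff by blast
      then show ?thesis using that by (simp add: Q.smult_zero)
    qed
    moreover have "\<theta> (x, \<zero>\<^bsub>Q\<^esub>) i \<in> carrier R" if "x \<in> carrier M" for x
      using \<theta>x[OF that] i by auto
    ultimately show ?thesis
      unfolding left_hom_iff add_hom_iff using i by (auto simp: k_def)
  qed
  have kR: "k i x \<in> carrier R" if "i \<in> I" "x \<in> carrier M" for i x
    using k[OF that(1)] that(2) unfolding left_hom_iff add_hom_iff by auto
  \<comment> \<open>The indices occurring in some generator: a finite union of finite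
    supports.\<close>
  define J where "J = (\<Union>g\<in>G. {i \<in> I. k i g \<noteq> \<zero>\<^bsub>R\<^esub>})"
  have J: "finite J" "J \<subseteq> I"
    unfolding J_def k_def using G(1,2) \<theta>x by auto
  have k0: "k i x = \<zero>\<^bsub>R\<^esub>" if "x \<in> carrier M" "i \<in> I" "i \<notin> J" for i x
  proof -
    obtain c where c: "c \<in> G \<rightarrow> carrier R" "x = (\<Oplus>\<^bsub>M\<^esub>g\<in>G. c g \<odot>\<^bsub>M\<^esub> g)"
      using G(3) \<open>x \<in> carrier M\<close> by blast
    have ki: "k i \<in> add_hom M R"
      using k[OF that(2)] unfolding left_hom_iff add_hom_iff by simp
    have "k i x = (\<Oplus>\<^bsub>R\<^esub>g\<in>G. k i (c g \<odot>\<^bsub>M\<^esub> g))"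
      unfolding c(2) using c(1) G(2)
      by (intro add_hom_finsum[OF M.M.abelian_group_axioms M.R.abelian_group_axioms ki])
        (auto intro!: M.smult_closed)
    also have "\<dots> = (\<Oplus>\<^bsub>R\<^esub>g\<in>G. \<zero>\<^bsub>R\<^esub>)"
    proof (intro M.R.finsum_cong')
      fix g assume g: "g \<in> G"
      then have "k i g = \<zero>\<^bsub>R\<^esub>" using that(2,3) by (auto simp: J_def)
      then show "k i (c g \<odot>\<^bsub>M\<^esub> g) = \<zero>\<^bsub>R\<^esub>"
        using k[OF that(2)] c(1) G(2) g unfolding left_hom_iff by (auto simp: Pi_iff subset_iff)
    qed auto
    finally show ?thesis by simp
  qed
  show ?thesis
  proof (intro exI[of _ J] exI[of _ k] exI[of _ "\<lambda>j. fst (\<theta>' (\<lambda>i\<in>I. if i = j then \<one>\<^bsub>R\<^esub> else \<zero>\<^bsub>R\<^esub>))"]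
      conjI ballI)
    show "finite J" by fact
    show "k j \<in> left_hom R M (ring_bimod R id id)" if "j \<in> J" for j
      using that J(2) k by blast
    show "fst (\<theta>' (\<lambda>i\<in>I. if i = j then \<one>\<^bsub>R\<^esub> else \<zero>\<^bsub>R\<^esub>)) \<in> carrier M" for j
    proof -
      have "(\<lambda>i\<in>I. if i = j then \<one>\<^bsub>R\<^esub> else \<zero>\<^bsub>R\<^esub>) \<in> carrier (free_module R I)" by auto
      then show ?thesis using q unfolding left_hom_iff add_hom_iff by blast
    qed
    fix x assume x: "x \<in> carrier M"
    have "\<theta> (x, \<zero>\<^bsub>Q\<^esub>) = (\<lambda>i\<in>I. if i \<in> J then k i x else \<zero>\<^bsub>R\<^esub>)"
      using \<theta>x[OF x] k0[OF x] by (auto simp: k_def fun_eq_iff PiE_iff extensional_def)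
    moreover have "\<theta>' (\<theta> (x, \<zero>\<^bsub>Q\<^esub>)) = (x, \<zero>\<^bsub>Q\<^esub>)"
      unfolding \<theta>'_def using bij x by (intro inv_into_f_f) (auto simp: bij_betw_def)
    ultimately have "x = fst (\<theta>' (\<lambda>i\<in>I. if i \<in> J then k i x else \<zero>\<^bsub>R\<^esub>))"
      by simp
    \<comment> \<open>The coefficient function is made extensional on \<open>I\<close>, as
      \<open>free_module_hom_decomp\<close> demands; on \<open>J\<close> this changes
      nothing.\<close>
    also have "\<dots> = fst (\<theta>' (\<lambda>i\<in>I. if i \<in> J then (\<lambda>i\<in>I. k i x) i else \<zero>\<^bsub>R\<^esub>))"
      using J(2) by (intro arg_cong[where f = "\<lambda>f. fst (\<theta>' f)"]) (auto simp: fun_eq_iff)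
    also have "\<dots> = (\<Oplus>\<^bsub>M\<^esub>j\<in>J. (\<lambda>i\<in>I. k i x) j \<odot>\<^bsub>M\<^esub> fst (\<theta>' (\<lambda>i\<in>I. if i = j then \<one>\<^bsub>R\<^esub> else \<zero>\<^bsub>R\<^esub>)))"
      using x kR by (intro free_module_hom_decomp[OF M.R.ring_axioms M q _ J]) auto
    also have "\<dots> = (\<Oplus>\<^bsub>M\<^esub>j\<in>J. k j x \<odot>\<^bsub>M\<^esub> fst (\<theta>' (\<lambda>i\<in>I. if i = j then \<one>\<^bsub>R\<^esub> else \<zero>\<^bsub>R\<^esub>)))"
    proof (intro M.M.finsum_cong')
      show "(\<lambda>j. k j x \<odot>\<^bsub>M\<^esub> fst (\<theta>' (\<lambda>i\<in>I. if i = j then \<one>\<^bsub>R\<^esub> else \<zero>\<^bsub>R\<^esub>))) \<in> J \<rightarrow> carrier M"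
      proof
        fix j assume j: "j \<in> J"
        have "(\<lambda>i\<in>I. if i = j then \<one>\<^bsub>R\<^esub> else \<zero>\<^bsub>R\<^esub>) \<in> carrier (free_module R I)" by auto
        then have "fst (\<theta>' (\<lambda>i\<in>I. if i = j then \<one>\<^bsub>R\<^esub> else \<zero>\<^bsub>R\<^esub>)) \<in> carrier M"
          using q unfolding left_hom_iff add_hom_iff by blast
        moreover have "k j x \<in> carrier R"
          using kR J(2) j x by auto
        ultimately show "k j x \<odot>\<^bsub>M\<^esub> fst (\<theta>' (\<lambda>i\<in>I. if i = j then \<one>\<^bsub>R\<^esub> else \<zero>\<^bsub>R\<^esub>)) \<in> carrier M"
          by (intro M.smult_closed)
      qed
    qed (use J(2) in auto)
    finally show "x = (\<Oplus>\<^bsub>M\<^esub>j\<in>J. k j x \<odot>\<^bsub>M\<^esub> fst (\<theta>' (\<lambda>i\<in>I. if i = j then \<one>\<^bsub>R\<^esub> else \<zero>\<^bsub>R\<^esub>)))" .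
  qed
qed

section \<open>Tensor products of bimodules\<close>

definition balanced ::
    "('s, 'i) ring_scheme \<Rightarrow> ('r, 's, 'm, 'j) bimodule_scheme \<Rightarrow> ('s, 't, 'n, 'k) bimodule_scheme \<Rightarrow>
      ('g, 'l) ring_scheme \<Rightarrow> ('m \<Rightarrow> 'n \<Rightarrow> 'g) \<Rightarrow> bool"
  where "balanced S M N G p \<longleftrightarrow>
    (\<forall>x\<in>carrier M. \<forall>y\<in>carrier N. p x y \<in> carrier G) \<and>
    (\<forall>x\<in>carrier M. \<forall>x'\<in>carrier M. \<forall>y\<in>carrier N. p (x \<oplus>\<^bsub>M\<^esub> x') y = p x y \<oplus>\<^bsub>G\<^esub> p x' y) \<and>
    (\<forall>x\<in>carrier M. \<forall>y\<in>carrier N. \<forall>y'\<in>carrier N. p x (y \<oplus>\<^bsub>N\<^esub> y') = p x y \<oplus>\<^bsub>G\<^esub> p x y') \<and>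
    (\<forall>x\<in>carrier M. \<forall>s\<in>carrier S. \<forall>y\<in>carrier N. p (x \<bullet>\<^bsub>M\<^esub> s) y = p x (s \<odot>\<^bsub>N\<^esub> y))"

definition tensor ::
    "('s, 'i) ring_scheme \<Rightarrow> ('r, 's, 'm, 'j) bimodule_scheme \<Rightarrow> ('s, 't, 'n, 'k) bimodule_scheme \<Rightarrow>
      'm \<Rightarrow> 'n \<Rightarrow> ('m \<times> 'n \<Rightarrow>\<^sub>0 int) set"
  where "tensor S M N x y = tensor_kernel S M N #>\<^bsub>tensor_free M N\<^esub> frag_of (x, y)"

locale bimodule_tensor =
  fixes R :: "('r, 'h) ring_scheme" and S :: "('s, 'i) ring_scheme" and U :: "('t, 'l) ring_scheme"
    and M :: "('r, 's, 'm, 'j) bimodule_scheme" and N :: "('s, 't, 'n, 'k) bimodule_scheme"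
  assumes M: "bimodule R S M" and N: "bimodule S U N"
begin

abbreviation "F \<equiv> tensor_free M N"
abbreviation "K \<equiv> tensor_kernel S M N"
abbreviation "MN \<equiv> tensor_product S M N"
abbreviation "\<tau> \<equiv> tensor S M N"

sublocale M: bimodule R S M by (rule M)
sublocale N: bimodule S U N by (rule N)

lemma F_diff: "a \<in> carrier F \<Longrightarrow> b \<in> carrier F \<Longrightarrow> a - b \<in> carrier F"
  using keys_diff[of a b] by auto

lemma relators_subset: "tensor_relators S M N \<subseteq> carrier F"
  unfolding tensor_relators_def
  by (auto intro!: F_diff simp: M.rsmult_closed N.smult_closed simp del: carrier_free_Abelian_group_iff)

lemma comm_group_F: "comm_group F"
  by (rule abelian_free_Abelian_group)

lemma subgroup_K: "subgroup K F"
  unfolding tensor_kernel_def using relators_subset by (intro group.generate_is_subgroup) auto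

lemma normal_K: "K \<lhd> F"
  by (rule comm_group.normal_iff_subgroup[THEN iffD2, OF comm_group_F subgroup_K])

lemma coset_eq:
  assumes "c - d \<in> K" "c \<in> carrier F" "d \<in> carrier F"
  shows "K #>\<^bsub>F\<^esub> c = K #>\<^bsub>F\<^esub> d"
proof -
  interpret F: comm_group F by (rule comm_group_F)
  have "c = (c - d) \<otimes>\<^bsub>F\<^esub> d" by simp
  with assms(1) have "c \<in> K #>\<^bsub>F\<^esub> d" unfolding r_coset_def by blast
  then show ?thesis using F.repr_independence[OF _ assms(3) subgroup_K] by simp
qed

lemma mem_cosetD:
  assumes "d \<in> K #>\<^bsub>F\<^esub> c" "c \<in> carrier F"
  shows "d \<in> carrier F" "d - c \<in> K"
proof -
  obtain k where k: "k \<in> K" "d = k + c" using assms(1) by (auto simp: r_coset_def)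
  interpret K: subgroup K F by (rule subgroup_K)
  show "d - c \<in> K" using k by simp
  have "k \<otimes>\<^bsub>F\<^esub> c \<in> carrier F"
    using K.mem_carrier[OF k(1)] assms(2) by (intro monoid.m_closed[OF group.is_monoid[OF group_free_Abelian_group]])
  then show "d \<in> carrier F" using k(2) by simp
qed

lemma coset_self: "c \<in> carrier F \<Longrightarrow> c \<in> K #>\<^bsub>F\<^esub> c"
  by (rule group.rcos_self[OF group_free_Abelian_group _ subgroup_K])

text \<open>Differences are the only closure step needed: the inverse of \<open>h\<close> is
  \<open>0 - h\<close>, and a product is \<open>h1 - (0 - h2)\<close>.\<close>

lemma kernel_induct [consumes 1, case_names relator diff]:
  assumes "c \<in> K" and rel: "\<And>c. c \<in> tensor_relators S M N \<Longrightarrow> P c"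
    and diff: "\<And>a b. \<lbrakk>a \<in> K; b \<in> K; P a; P b\<rbrakk> \<Longrightarrow> P (a - b)"
  shows "P c"
proof -
  interpret K: subgroup K F by (rule subgroup_K)
  have rK: "a \<in> K" if "a \<in> tensor_relators S M N" for a
    unfolding tensor_kernel_def using that by (rule generate.incl)
  have r0: "0 \<in> K" using K.one_closed by simp
  \<comment> \<open>The neutral element must be a difference too. Some relator exists, built from
    zeros, and it is subtracted from itself.\<close>
  have "frag_of (\<zero>\<^bsub>M\<^esub> \<bullet>\<^bsub>M\<^esub> \<zero>\<^bsub>S\<^esub>, \<zero>\<^bsub>N\<^esub>) - frag_of (\<zero>\<^bsub>M\<^esub>, \<zero>\<^bsub>S\<^esub> \<odot>\<^bsub>N\<^esub> \<zero>\<^bsub>N\<^esub>) \<in> tensor_relators S M N"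
    unfolding tensor_relators_def by blast
  from rel[OF this] diff[OF rK[OF this] rK[OF this]] have P0: "P 0" by simp
  have "P c \<and> c \<in> K"
    using assms(1) unfolding tensor_kernel_def
  proof (induction rule: generate.induct)
    case one
    then show ?case using P0 r0 by (simp add: tensor_kernel_def)
  next
    case (incl h)
    then show ?case using rel rK by (simp add: tensor_kernel_def)
  next
    case (inv h)
    then have "inv\<^bsub>F\<^esub> h = 0 - h" using relators_subset by (auto simp: subset_iff)
    moreover have "0 - h \<in> K"
      using K.m_inv_closed[OF rK[OF inv]] calculation by simp
    ultimately show ?case using diff[OF r0 rK[OF inv] P0 rel[OF inv]] by (simp add: tensor_kernel_def)
  next
    case (eng h1 h2)
    then have h: "h1 \<in> K" "h2 \<in> K" "P h1" "P h2" by (simp_all add: tensor_kernel_def)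
    have "0 - h2 \<in> K"
      using K.m_inv_closed[OF h(2)] K.mem_carrier[OF h(2)] by simp
    from diff[OF h(1) this h(3) diff[OF r0 h(2) P0 h(4)]] K.m_closed[OF h(1,2)]
    show ?case by (simp add: tensor_kernel_def)
  qed
  then show ?thesis ..
qed

section \<open>The group underlying the tensor product and its universal property\<close>

lemma MN_simps [simp]:
  "carrier MN = (\<lambda>c. K #>\<^bsub>F\<^esub> c) ` carrier F"
  "\<zero>\<^bsub>MN\<^esub> = K"
  by (simp_all add: tensor_product_def carrier_FactGroup)

lemma coset_add:
  "c \<in> carrier F \<Longrightarrow> d \<in> carrier F \<Longrightarrow>
    (K #>\<^bsub>F\<^esub> c) \<oplus>\<^bsub>MN\<^esub> (K #>\<^bsub>F\<^esub> d) = K #>\<^bsub>F\<^esub> (c + d)"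
  using normal.rcos_sum[OF normal_K, of c d] by (simp add: tensor_product_def)

lemma abelian_group_tensor: "abelian_group MN"
proof -
  interpret Q: comm_group "F Mod K"
    by (rule comm_group.abelian_FactGroup[OF comm_group_F subgroup_K])
  have eq: "carrier MN = carrier (F Mod K)" "add MN = monoid.mult (F Mod K)" "\<zero>\<^bsub>MN\<^esub> = \<one>\<^bsub>F Mod K\<^esub>"
    by (simp_all add: tensor_product_def)
  show ?thesis
    by (rule abelian_groupI; unfold eq) (auto simp: Q.m_ac intro: Q.l_inv Q.inv_closed simp del: one_FactGroup mult_FactGroup)
qed

sublocale MN: abelian_group MN by (rule abelian_group_tensor)

lemma tau_closed: "x \<in> carrier M \<Longrightarrow> y \<in> carrier N \<Longrightarrow> \<tau> x y \<in> carrier MN"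
  by (auto simp: tensor_def)

lemma balanced_tau: "balanced S M N MN \<tau>"
proof -
  have rK: "a \<in> K" if "a \<in> tensor_relators S M N" for a
    unfolding tensor_kernel_def using that by (rule generate.incl)
  have F: "frag_of (x, y) \<in> carrier F" if "x \<in> carrier M" "y \<in> carrier N" for x y
    using that by simp
  have F2: "frag_of (x, y) + frag_of (x', y') \<in> carrier F"
    if "x \<in> carrier M" "y \<in> carrier N" "x' \<in> carrier M" "y' \<in> carrier N" for x y x' y'
    using monoid.m_closed[OF group.is_monoid[OF group_free_Abelian_group] F[OF that(1,2)] F[OF that(3,4)]]
    by simp
  have "\<tau> (x \<oplus>\<^bsub>M\<^esub> x') y = \<tau> x y \<oplus>\<^bsub>MN\<^esub> \<tau> x' y"
    if "x \<in> carrier M" "x' \<in> carrier M" "y \<in> carrier N" for x x' y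
  proof -
    have "frag_of (x \<oplus>\<^bsub>M\<^esub> x', y) - frag_of (x, y) - frag_of (x', y) \<in> tensor_relators S M N"
      unfolding tensor_relators_def using that by blast
    then have "K #>\<^bsub>F\<^esub> frag_of (x \<oplus>\<^bsub>M\<^esub> x', y) = K #>\<^bsub>F\<^esub> (frag_of (x, y) + frag_of (x', y))"
      using that by (intro coset_eq F F2) (auto dest: rK simp: algebra_simps)
    then show ?thesis
      unfolding tensor_def using that by (simp add: coset_add del: carrier_free_Abelian_group_iff)
  qed
  moreover have "\<tau> x (y \<oplus>\<^bsub>N\<^esub> y') = \<tau> x y \<oplus>\<^bsub>MN\<^esub> \<tau> x y'"
    if "x \<in> carrier M" "y \<in> carrier N" "y' \<in> carrier N" for x y y'
  proof -
    have "frag_of (x, y \<oplus>\<^bsub>N\<^esub> y') - frag_of (x, y) - frag_of (x, y') \<in> tensor_relators S M N"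
      unfolding tensor_relators_def using that by blast
    then have "K #>\<^bsub>F\<^esub> frag_of (x, y \<oplus>\<^bsub>N\<^esub> y') = K #>\<^bsub>F\<^esub> (frag_of (x, y) + frag_of (x, y'))"
      using that by (intro coset_eq F F2) (auto dest: rK simp: algebra_simps)
    then show ?thesis
      unfolding tensor_def using that by (simp add: coset_add del: carrier_free_Abelian_group_iff)
  qed
  moreover have "\<tau> (x \<bullet>\<^bsub>M\<^esub> s) y = \<tau> x (s \<odot>\<^bsub>N\<^esub> y)"
    if "x \<in> carrier M" "s \<in> carrier S" "y \<in> carrier N" for x s y
  proof -
    have "frag_of (x \<bullet>\<^bsub>M\<^esub> s, y) - frag_of (x, s \<odot>\<^bsub>N\<^esub> y) \<in> tensor_relators S M N"
      unfolding tensor_relators_def using that by blast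
    then show ?thesis
      unfolding tensor_def using that by (intro coset_eq F rK) (auto simp: M.rsmult_closed N.smult_closed)
  qed
  ultimately show ?thesis
    unfolding balanced_def by (auto simp: tau_closed simp del: MN_simps)
qed

text \<open>The map on pairs extends to the free abelian group. As \<open>p\<close> is balanced, the
  extension kills the relators, hence all of \<open>K\<close>, and descends to cosets.\<close>

theorem tensor_lift:
  assumes G: "abelian_group G" and p: "balanced S M N G p"
  obtains k where "k \<in> add_hom MN G" "\<And>x y. x \<in> carrier M \<Longrightarrow> y \<in> carrier N \<Longrightarrow> k (\<tau> x y) = p x y"
proof -
  interpret G: abelian_group G by fact
  note p' = p[unfolded balanced_def]
  interpret Gm: comm_group "add_monoid G" by (rule G.a_comm_group)
  obtain f where f: "f \<in> hom F (add_monoid G)"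
      and fp: "\<And>z. z \<in> carrier M \<times> carrier N \<Longrightarrow> f (frag_of z) = (case z of (x, y) \<Rightarrow> p x y)"
    by (rule comm_group.free_Abelian_group_universal[OF G.a_comm_group,
          of "\<lambda>(x, y). p x y" "carrier M \<times> carrier N"]) (use p' in auto)
  interpret f: group_hom F "add_monoid G" f
    using f by (intro group_hom.intro group_hom_axioms.intro group_free_Abelian_group G.a_group)
  have fdiff: "f (a - b) = f a \<ominus>\<^bsub>G\<^esub> f b" if "a \<in> carrier F" "b \<in> carrier F" for a b
  proof -
    have ab: "a - b \<in> carrier F" by (rule F_diff[OF that(1,2)])
    have "f ((a - b) \<otimes>\<^bsub>F\<^esub> b) = f (a - b) \<oplus>\<^bsub>G\<^esub> f b"
      using f.hom_mult[OF ab that(2)] by simp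
    moreover have "f (a - b) \<in> carrier G" "f b \<in> carrier G"
      using f.hom_closed[OF ab] f.hom_closed[OF that(2)] by simp_all
    ultimately show ?thesis
      by (simp add: a_minus_def G.a_assoc G.r_neg)
  qed
  have cancel: "(a \<oplus>\<^bsub>G\<^esub> b) \<ominus>\<^bsub>G\<^esub> a \<ominus>\<^bsub>G\<^esub> b = \<zero>\<^bsub>G\<^esub>" if "a \<in> carrier G" "b \<in> carrier G" for a b
    using that by (simp add: a_minus_def G.a_comm[of a b] G.a_assoc G.r_neg G.r_neg2)
  have a_minus_self: "a \<ominus>\<^bsub>G\<^esub> a = \<zero>\<^bsub>G\<^esub>" if "a \<in> carrier G" for a
    using that by (simp add: a_minus_def G.r_neg)
  have minus_zeroD: "a = b" if "a \<ominus>\<^bsub>G\<^esub> b = \<zero>\<^bsub>G\<^esub>" "a \<in> carrier G" "b \<in> carrier G" for a b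
    using that G.minus_equality[of a "\<ominus>\<^bsub>G\<^esub> b"] by (simp add: a_minus_def)
  have f0: "f c = \<zero>\<^bsub>G\<^esub>" if "c \<in> K" for c
    using that
  proof (induction rule: kernel_induct)
    case (relator c)
    then show ?case
      unfolding tensor_relators_def using p'
      by (auto simp: fdiff fp F_diff M.rsmult_closed N.smult_closed cancel a_minus_self
          simp del: carrier_free_Abelian_group_iff)
  next
    case (diff a b)
    then show ?case
      using subgroup.mem_carrier[OF subgroup_K] by (simp add: fdiff a_minus_def del: carrier_free_Abelian_group_iff)
  qed
  have fK: "f c = f d" if cd: "c \<in> carrier F" "d \<in> carrier F" "K #>\<^bsub>F\<^esub> c = K #>\<^bsub>F\<^esub> d" for c d
  proof -
    have "c - d \<in> K" using mem_cosetD(2)[of c d] coset_self[of c] cd by simp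
    then have "f c \<ominus>\<^bsub>G\<^esub> f d = \<zero>\<^bsub>G\<^esub>" using f0 fdiff[OF cd(1,2)] by simp
    moreover have "f c \<in> carrier G" "f d \<in> carrier G"
      using f.hom_closed[OF cd(1)] f.hom_closed[OF cd(2)] by simp_all
    ultimately show ?thesis using minus_zeroD by blast
  qed
  obtain g where g: "g \<in> hom (F Mod K) (add_monoid G)"
      and gf: "\<And>c. c \<in> carrier F \<Longrightarrow> g (K #>\<^bsub>F\<^esub> c) = f c"
    using FactGroup_universal[OF f normal_K fK] by blast
  have "g \<in> add_hom MN G"
    using g by (simp add: hom_def tensor_product_def)
  moreover have "g (\<tau> x y) = p x y" if "x \<in> carrier M" "y \<in> carrier N" for x y
    unfolding tensor_def using that by (simp add: gf fp)
  ultimately show thesis by (rule that)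
qed

text \<open>Every coset has a representative obtained from generators by differences, and the coset
  of a generator is an elementary tensor.\<close>

theorem tensor_hom_eq:
  assumes G: "abelian_group G" and f: "f \<in> add_hom MN G" and g: "g \<in> add_hom MN G"
    and eq: "\<And>x y. x \<in> carrier M \<Longrightarrow> y \<in> carrier N \<Longrightarrow> f (\<tau> x y) = g (\<tau> x y)"
    and X: "X \<in> carrier MN"
  shows "f X = g X"
proof -
  interpret G: abelian_group G by fact
  have *: "k (K #>\<^bsub>F\<^esub> (a - b)) = k (K #>\<^bsub>F\<^esub> a) \<ominus>\<^bsub>G\<^esub> k (K #>\<^bsub>F\<^esub> b)"
    if "a \<in> carrier F" "b \<in> carrier F" "k \<in> add_hom MN G" for a b k
  proof -
    have ab: "a - b \<in> carrier F" by (rule F_diff[OF that(1,2)])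
    have cl: "K #>\<^bsub>F\<^esub> (a - b) \<in> carrier MN" "K #>\<^bsub>F\<^esub> b \<in> carrier MN"
      using ab that(2) by (auto simp del: carrier_free_Abelian_group_iff)
    have "k (K #>\<^bsub>F\<^esub> a) = k ((K #>\<^bsub>F\<^esub> (a - b)) \<oplus>\<^bsub>MN\<^esub> (K #>\<^bsub>F\<^esub> b))"
      using coset_add[OF ab that(2)] by simp
    also have "\<dots> = k (K #>\<^bsub>F\<^esub> (a - b)) \<oplus>\<^bsub>G\<^esub> k (K #>\<^bsub>F\<^esub> b)"
      using that(3) cl by (rule add_hom_add)
    finally show ?thesis
      using add_hom_closed[OF that(3) cl(1)] add_hom_closed[OF that(3) cl(2)]
      by (simp add: a_minus_def G.a_assoc G.r_neg)
  qed
  obtain c where c: "c \<in> carrier F" "X = K #>\<^bsub>F\<^esub> c" using X by auto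
  \<comment> \<open>Membership in the free group is carried along because the difference case of
    \<open>frag_induction\<close> supplies nothing but the claim for the two operands.\<close>
  have "f (K #>\<^bsub>F\<^esub> c) = g (K #>\<^bsub>F\<^esub> c) \<and> c \<in> carrier F"
    using c(1)[unfolded carrier_free_Abelian_group_iff]
  proof (induction rule: frag_induction)
    case zero
    have "K #>\<^bsub>F\<^esub> 0 = \<zero>\<^bsub>MN\<^esub>"
      using group.coset_mult_one[OF group_free_Abelian_group subgroup.subset[OF subgroup_K]] by simp
    then show ?case
      using add_hom_zero[OF abelian_group_tensor G f] add_hom_zero[OF abelian_group_tensor G g] by simp
  next
    case (one z)
    then show ?case using eq[of "fst z" "snd z"] by (auto simp: tensor_def)
  next
    case (diff a b)
    then show ?case
      using *[OF _ _ f] *[OF _ _ g] F_diff by (auto simp del: carrier_free_Abelian_group_iff)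
  qed
  then show ?thesis using c by simp
qed

text \<open>The scalar actions on the tensor product are unions over representatives. Balancedness
  provides an additive map \<open>k\<close> on cosets, and induction over the free group shows that
  every representative of \<open>X\<close> contributes the coset \<open>k X\<close>. So the union
  collapses to \<open>k X\<close>, which gives additivity and the value on elementary tensors
  together.\<close>

lemma tensor_action:
  assumes \<phi>: "\<And>x y. x \<in> carrier M \<Longrightarrow> y \<in> carrier N \<Longrightarrow> \<phi> (x, y) \<in> carrier M \<times> carrier N"
    and bal: "balanced S M N MN (\<lambda>x y. K #>\<^bsub>F\<^esub> frag_of (\<phi> (x, y)))"
  shows "(\<lambda>X. \<Union>c\<in>X. K #>\<^bsub>F\<^esub> frag_extend (\<lambda>z. frag_of (\<phi> z)) c) \<in> add_hom MN MN"
    and "x \<in> carrier M \<Longrightarrow> y \<in> carrier N \<Longrightarrow>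
      (\<Union>c\<in>\<tau> x y. K #>\<^bsub>F\<^esub> frag_extend (\<lambda>z. frag_of (\<phi> z)) c) = K #>\<^bsub>F\<^esub> frag_of (\<phi> (x, y))"
proof -
  let ?e = "frag_extend (\<lambda>z. frag_of (\<phi> z))"
  obtain k where k: "k \<in> add_hom MN MN"
      and k\<tau>: "\<And>x y. x \<in> carrier M \<Longrightarrow> y \<in> carrier N \<Longrightarrow> k (\<tau> x y) = K #>\<^bsub>F\<^esub> frag_of (\<phi> (x, y))"
    using tensor_lift[OF abelian_group_tensor bal] by blast
  have e: "?e c \<in> carrier F" if "c \<in> carrier F" for c
  proof -
    have "Poly_Mapping.keys (?e c) \<subseteq> \<phi> ` Poly_Mapping.keys c"
      using keys_frag_extend[of "\<lambda>z. frag_of (\<phi> z)" c]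
      by (simp add: keys_frag_of UNION_singleton_eq_range)
    also have "\<phi> ` Poly_Mapping.keys c \<subseteq> carrier M \<times> carrier N"
    proof
      fix w assume "w \<in> \<phi> ` Poly_Mapping.keys c"
      then obtain z where z: "z \<in> Poly_Mapping.keys c" "w = \<phi> z" by blast
      then have "z \<in> carrier M \<times> carrier N" using that by auto
      then show "w \<in> carrier M \<times> carrier N" using \<phi>[of "fst z" "snd z"] z(2) by auto
    qed
    finally show ?thesis by simp
  qed
  have coset_diff: "(K #>\<^bsub>F\<^esub> (a - b)) \<oplus>\<^bsub>MN\<^esub> (K #>\<^bsub>F\<^esub> b) = K #>\<^bsub>F\<^esub> a" if "a \<in> carrier F" "b \<in> carrier F" for a b
    using coset_add[OF F_diff[OF that] that(2)] by simp
  have ke: "k (K #>\<^bsub>F\<^esub> c) = K #>\<^bsub>F\<^esub> ?e c \<and> c \<in> carrier F" if "c \<in> carrier F" for c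
    using that[unfolded carrier_free_Abelian_group_iff]
  proof (induction rule: frag_induction)
    case zero
    have "K #>\<^bsub>F\<^esub> 0 = \<zero>\<^bsub>MN\<^esub>"
      using group.coset_mult_one[OF group_free_Abelian_group subgroup.subset[OF subgroup_K]] by simp
    then show ?case using add_hom_zero[OF abelian_group_tensor abelian_group_tensor k] by simp
  next
    case (one z)
    then show ?case using k\<tau>[of "fst z" "snd z"] by (auto simp: tensor_def)
  next
    case (diff a b)
    have F: "a \<in> carrier F" "b \<in> carrier F" "a - b \<in> carrier F"
      using diff F_diff by blast+
    have cl: "K #>\<^bsub>F\<^esub> c \<in> carrier MN" if "c \<in> carrier F" for c
      using that by (simp del: carrier_free_Abelian_group_iff)
    have "k (K #>\<^bsub>F\<^esub> (a - b)) \<oplus>\<^bsub>MN\<^esub> k (K #>\<^bsub>F\<^esub> b) = k (K #>\<^bsub>F\<^esub> a)"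
      using add_hom_add[OF k cl[OF F(3)] cl[OF F(2)]] coset_diff[OF F(1,2)] by simp
    also have "\<dots> = (K #>\<^bsub>F\<^esub> (?e a - ?e b)) \<oplus>\<^bsub>MN\<^esub> k (K #>\<^bsub>F\<^esub> b)"
      using coset_diff[OF e[OF F(1)] e[OF F(2)]] diff by simp
    finally have "k (K #>\<^bsub>F\<^esub> (a - b)) = K #>\<^bsub>F\<^esub> (?e a - ?e b)"
      using add_hom_closed[OF k cl[OF F(3)]] add_hom_closed[OF k cl[OF F(2)]]
        cl[OF F_diff[OF e[OF F(1)] e[OF F(2)]]]
      by (subst (asm) MN.add.right_cancel) auto
    then show ?case using F by (simp add: frag_extend_diff)
  qed
  \<comment> \<open>Besides the agreement of all contributions, \<open>X\<close> has to be non-empty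
    for the union to equal one of them.\<close>
  have Uk: "(\<Union>c\<in>X. K #>\<^bsub>F\<^esub> ?e c) = k X" if X: "X \<in> carrier MN" for X
  proof -
    obtain c where c: "c \<in> carrier F" "X = K #>\<^bsub>F\<^esub> c" using X by auto
    have "K #>\<^bsub>F\<^esub> ?e d = k X" if "d \<in> X" for d
    proof -
      have d: "d \<in> carrier F" "d - c \<in> K" using mem_cosetD that c by blast+
      show ?thesis using ke[OF d(1)] coset_eq[OF d(2,1) c(1)] c(2) by simp
    qed
    moreover have "c \<in> X" using c coset_self by blast
    ultimately show ?thesis by blast
  qed
  then show "(\<lambda>X. \<Union>c\<in>X. K #>\<^bsub>F\<^esub> ?e c) \<in> add_hom MN MN"
    using k MN.a_closed unfolding add_hom_iff by (auto simp del: MN_simps)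
  show "(\<Union>c\<in>\<tau> x y. K #>\<^bsub>F\<^esub> ?e c) = K #>\<^bsub>F\<^esub> frag_of (\<phi> (x, y))"
    if "x \<in> carrier M" "y \<in> carrier N"
    using Uk[OF tau_closed[OF that]] k\<tau>[OF that] by simp
qed

section \<open>The bimodule structure of the tensor product\<close>

lemma smult_tensor:
  assumes r: "r \<in> carrier R"
  shows "(\<lambda>X. r \<odot>\<^bsub>MN\<^esub> X) \<in> add_hom MN MN"
    and "x \<in> carrier M \<Longrightarrow> y \<in> carrier N \<Longrightarrow> r \<odot>\<^bsub>MN\<^esub> \<tau> x y = \<tau> (r \<odot>\<^bsub>M\<^esub> x) y"
proof -
  have eq: "(\<lambda>X. r \<odot>\<^bsub>MN\<^esub> X) =
      (\<lambda>X. \<Union>c\<in>X. K #>\<^bsub>F\<^esub> frag_extend (\<lambda>z. frag_of ((\<lambda>(x, y). (r \<odot>\<^bsub>M\<^esub> x, y)) z)) c)"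
    by (simp add: tensor_product_def fun_eq_iff case_prod_unfold)
  \<comment> \<open>The relation that moves \<open>S\<close> across the tensor sign survives because
    the actions of \<open>R\<close> and \<open>S\<close> on \<open>M\<close> commute.\<close>
  have bal: "balanced S M N MN (\<lambda>x y. K #>\<^bsub>F\<^esub> frag_of ((\<lambda>(x, y). (r \<odot>\<^bsub>M\<^esub> x, y)) (x, y)))"
    using balanced_tau r unfolding balanced_def tensor_def
    by (auto simp: M.smult_closed M.smult_r_distr M.smult_rsmult[symmetric] simp del: MN_simps)
  show "(\<lambda>X. r \<odot>\<^bsub>MN\<^esub> X) \<in> add_hom MN MN"
    unfolding eq by (rule tensor_action(1)[OF _ bal]) (auto simp: r M.smult_closed)
  show "r \<odot>\<^bsub>MN\<^esub> \<tau> x y = \<tau> (r \<odot>\<^bsub>M\<^esub> x) y" if "x \<in> carrier M" "y \<in> carrier N"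
    using fun_cong[OF eq, of "\<tau> x y"] tensor_action(2)[OF _ bal, of x y] that
    by (simp add: r M.smult_closed tensor_def)
qed

lemma rsmult_tensor:
  assumes t: "t \<in> carrier U"
  shows "(\<lambda>X. X \<bullet>\<^bsub>MN\<^esub> t) \<in> add_hom MN MN"
    and "x \<in> carrier M \<Longrightarrow> y \<in> carrier N \<Longrightarrow> \<tau> x y \<bullet>\<^bsub>MN\<^esub> t = \<tau> x (y \<bullet>\<^bsub>N\<^esub> t)"
proof -
  have eq: "(\<lambda>X. X \<bullet>\<^bsub>MN\<^esub> t) =
      (\<lambda>X. \<Union>c\<in>X. K #>\<^bsub>F\<^esub> frag_extend (\<lambda>z. frag_of ((\<lambda>(x, y). (x, y \<bullet>\<^bsub>N\<^esub> t)) z)) c)"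
    by (simp add: tensor_product_def fun_eq_iff case_prod_unfold)
  have bal: "balanced S M N MN (\<lambda>x y. K #>\<^bsub>F\<^esub> frag_of ((\<lambda>(x, y). (x, y \<bullet>\<^bsub>N\<^esub> t)) (x, y)))"
    using balanced_tau t unfolding balanced_def tensor_def
    by (auto simp: N.rsmult_closed N.rsmult_l_distr N.smult_rsmult simp del: MN_simps)
  show "(\<lambda>X. X \<bullet>\<^bsub>MN\<^esub> t) \<in> add_hom MN MN"
    unfolding eq by (rule tensor_action(1)[OF _ bal]) (auto simp: t N.rsmult_closed)
  show "\<tau> x y \<bullet>\<^bsub>MN\<^esub> t = \<tau> x (y \<bullet>\<^bsub>N\<^esub> t)" if "x \<in> carrier M" "y \<in> carrier N"
    using fun_cong[OF eq, of "\<tau> x y"] tensor_action(2)[OF _ bal, of x y] that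
    by (simp add: t N.rsmult_closed tensor_def)
qed

lemma tensor_add_hom_right: "x \<in> carrier M \<Longrightarrow> (\<lambda>y. \<tau> x y) \<in> add_hom N MN"
  using balanced_tau unfolding balanced_def add_hom_iff by blast

lemma tensor_add_hom_left: "y \<in> carrier N \<Longrightarrow> (\<lambda>x. \<tau> x y) \<in> add_hom M MN"
  using balanced_tau unfolding balanced_def add_hom_iff by blast

text \<open>Apart from closure and additivity in the tensor, each law compares two additive maps, so
  \<open>tensor_hom_eq\<close> reduces it to elementary tensors, where it follows from the laws of
  \<open>M\<close> and \<open>N\<close>.\<close>

theorem bimodule_tensor_product: "bimodule R U MN"
proof -
  note ab = abelian_group_tensor
  note [simp] = smult_tensor(2) rsmult_tensor(2) M.smult_closed N.rsmult_closed
  show ?thesis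
  proof (rule bimoduleI)
    show "ring R" by (rule M.R.ring_axioms)
    show "ring U" by (rule N.S.ring_axioms)
    show "abelian_group MN" by (rule ab)
    show "r \<odot>\<^bsub>MN\<^esub> X \<in> carrier MN" if "r \<in> carrier R" "X \<in> carrier MN" for r X
      using smult_tensor(1)[OF that(1)] that(2) by (rule add_hom_closed)
    show "X \<bullet>\<^bsub>MN\<^esub> t \<in> carrier MN" if "X \<in> carrier MN" "t \<in> carrier U" for t X
      using rsmult_tensor(1)[OF that(2)] that(1) by (rule add_hom_closed)
    show "r \<odot>\<^bsub>MN\<^esub> (X \<oplus>\<^bsub>MN\<^esub> Y) = r \<odot>\<^bsub>MN\<^esub> X \<oplus>\<^bsub>MN\<^esub> r \<odot>\<^bsub>MN\<^esub> Y"
      if "r \<in> carrier R" "X \<in> carrier MN" "Y \<in> carrier MN" for r X Y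
      using smult_tensor(1)[OF that(1)] that(2,3) by (rule add_hom_add)
    show "(X \<oplus>\<^bsub>MN\<^esub> Y) \<bullet>\<^bsub>MN\<^esub> t = X \<bullet>\<^bsub>MN\<^esub> t \<oplus>\<^bsub>MN\<^esub> Y \<bullet>\<^bsub>MN\<^esub> t"
      if "X \<in> carrier MN" "Y \<in> carrier MN" "t \<in> carrier U" for t X Y
      using rsmult_tensor(1)[OF that(3)] that(1,2) by (rule add_hom_add)
    show "(r \<oplus>\<^bsub>R\<^esub> r') \<odot>\<^bsub>MN\<^esub> X = r \<odot>\<^bsub>MN\<^esub> X \<oplus>\<^bsub>MN\<^esub> r' \<odot>\<^bsub>MN\<^esub> X"
      if r: "r \<in> carrier R" "r' \<in> carrier R" and X: "X \<in> carrier MN" for r r' X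
      by (rule tensor_hom_eq[OF ab smult_tensor(1)[OF M.R.a_closed[OF r]]
            add_hom_plus[OF ab smult_tensor(1)[OF r(1)] smult_tensor(1)[OF r(2)]] _ X])
        (simp add: r M.smult_l_distr add_hom_add[OF tensor_add_hom_left] del: MN_simps)
    show "X \<bullet>\<^bsub>MN\<^esub> (t \<oplus>\<^bsub>U\<^esub> t') = X \<bullet>\<^bsub>MN\<^esub> t \<oplus>\<^bsub>MN\<^esub> X \<bullet>\<^bsub>MN\<^esub> t'"
      if X: "X \<in> carrier MN" and t: "t \<in> carrier U" "t' \<in> carrier U" for t t' X
      by (rule tensor_hom_eq[OF ab rsmult_tensor(1)[OF N.S.a_closed[OF t]]
            add_hom_plus[OF ab rsmult_tensor(1)[OF t(1)] rsmult_tensor(1)[OF t(2)]] _ X])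
        (simp add: t N.rsmult_r_distr add_hom_add[OF tensor_add_hom_right] del: MN_simps)
    show "(r \<otimes>\<^bsub>R\<^esub> r') \<odot>\<^bsub>MN\<^esub> X = r \<odot>\<^bsub>MN\<^esub> (r' \<odot>\<^bsub>MN\<^esub> X)"
      if r: "r \<in> carrier R" "r' \<in> carrier R" and X: "X \<in> carrier MN" for r r' X
      by (rule tensor_hom_eq[OF ab smult_tensor(1)[OF M.R.m_closed[OF r]]
            add_hom_comp[OF smult_tensor(1)[OF r(2)] smult_tensor(1)[OF r(1)]] _ X])
        (simp add: r M.smult_assoc del: MN_simps)
    show "X \<bullet>\<^bsub>MN\<^esub> (t \<otimes>\<^bsub>U\<^esub> t') = (X \<bullet>\<^bsub>MN\<^esub> t) \<bullet>\<^bsub>MN\<^esub> t'"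
      if X: "X \<in> carrier MN" and t: "t \<in> carrier U" "t' \<in> carrier U" for t t' X
      by (rule tensor_hom_eq[OF ab rsmult_tensor(1)[OF N.S.m_closed[OF t]]
            add_hom_comp[OF rsmult_tensor(1)[OF t(1)] rsmult_tensor(1)[OF t(2)]] _ X])
        (simp add: t N.rsmult_assoc del: MN_simps)
    have id: "(\<lambda>X. X) \<in> add_hom MN MN"
      unfolding add_hom_iff by (simp del: MN_simps)
    show "\<one>\<^bsub>R\<^esub> \<odot>\<^bsub>MN\<^esub> X = X" if X: "X \<in> carrier MN" for X
      by (rule tensor_hom_eq[OF ab smult_tensor(1)[OF M.R.one_closed] id _ X])
        (simp add: M.smult_one del: MN_simps)
    show "X \<bullet>\<^bsub>MN\<^esub> \<one>\<^bsub>U\<^esub> = X" if X: "X \<in> carrier MN" for X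
      by (rule tensor_hom_eq[OF ab rsmult_tensor(1)[OF N.S.one_closed] id _ X])
        (simp add: N.rsmult_one del: MN_simps)
    show "(r \<odot>\<^bsub>MN\<^esub> X) \<bullet>\<^bsub>MN\<^esub> t = r \<odot>\<^bsub>MN\<^esub> (X \<bullet>\<^bsub>MN\<^esub> t)"
      if r: "r \<in> carrier R" and X: "X \<in> carrier MN" and t: "t \<in> carrier U" for r X t
      by (rule tensor_hom_eq[OF ab add_hom_comp[OF smult_tensor(1)[OF r] rsmult_tensor(1)[OF t]]
            add_hom_comp[OF rsmult_tensor(1)[OF t] smult_tensor(1)[OF r]] _ X])
        (simp add: r t del: MN_simps)
  qed
qed

end

text \<open>Phrased with ring operations and \<open>h\<close> instead of module records, so that a
  dual basis of the left \<open>B\<close>-module \<open>A\<close> is literally a right dual basis of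
  the opposite extension. The index set lies in the type of \<open>A\<close> because
  \<open>projective\<close> takes its bases there.\<close>

definition right_dual_basis ::
    "('a, 'i) ring_scheme \<Rightarrow> ('b, 'j) ring_scheme \<Rightarrow> ('b \<Rightarrow> 'a) \<Rightarrow>
      'a set \<Rightarrow> ('a \<Rightarrow> 'a) \<Rightarrow> ('a \<Rightarrow> 'a \<Rightarrow> 'b) \<Rightarrow> bool"
  where "right_dual_basis A B h J m \<xi> \<longleftrightarrow> finite J \<and>
    (\<forall>j\<in>J. m j \<in> carrier A \<and> \<xi> j \<in> add_hom A B \<and>
      (\<forall>x\<in>carrier A. \<forall>b\<in>carrier B. \<xi> j (x \<otimes>\<^bsub>A\<^esub> h b) = \<xi> j x \<otimes>\<^bsub>B\<^esub> b)) \<and>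
    (\<forall>x\<in>carrier A. x = (\<Oplus>\<^bsub>A\<^esub>j\<in>J. m j \<otimes>\<^bsub>A\<^esub> h (\<xi> j x)))"

lemma right_dual_basis_exists:
  fixes A :: "('a, 'i) ring_scheme" and B :: "('b, 'j) ring_scheme"
  assumes h: "ring_hom_ring B A h" and fgp: "right_fg_projective B (ring_bimod A id h)"
  obtains J m \<xi> where "right_dual_basis A B h J m \<xi>"
proof -
  let ?M = "opposite_module (ring_bimod A id h)"
  interpret A: ring A using h by (simp add: ring_hom_ring_def)
  interpret B: ring B using h by (simp add: ring_hom_ring_def)
  interpret h: ring_hom_ring B A h by (rule h)
  have M_simps [simp]: "carrier ?M = carrier A" "\<And>x y. x \<oplus>\<^bsub>?M\<^esub> y = x \<oplus>\<^bsub>A\<^esub> y" "\<zero>\<^bsub>?M\<^esub> = \<zero>\<^bsub>A\<^esub>"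
      "\<And>b x. b \<odot>\<^bsub>?M\<^esub> x = x \<otimes>\<^bsub>A\<^esub> h b"
    by (simp_all add: opposite_module_def)
  have finsum_M: "finsum ?M = finsum A"
    by (simp add: finsum_def finprod_def opposite_module_def ring_bimod_def fun_eq_iff)
  have "abelian_group ?M"
    by (rule abelian_group_cong[OF A.abelian_group_axioms])
      (simp_all add: opposite_module_def ring_bimod_def)
  then have M: "left_module (opposite_ring B) ?M"
    by (intro left_module.intro left_module_axioms.intro ring_opposite_ring B.ring_axioms)
      (simp_all add: A.l_distr A.r_distr A.m_assoc)
  obtain J :: "'a set" and \<xi> m where b: "finite J"
      "\<forall>j\<in>J. \<xi> j \<in> left_hom (opposite_ring B) ?M (ring_bimod (opposite_ring B) id id) \<and> m j \<in> carrier ?M"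
      "\<forall>x\<in>carrier ?M. x = (\<Oplus>\<^bsub>?M\<^esub>j\<in>J. \<xi> j x \<odot>\<^bsub>?M\<^esub> m j)"
    using dual_basis[OF M fgp[unfolded right_fg_projective_def]] by (elim exE conjE) (erule (2) that)
  have "right_dual_basis A B h J m \<xi>"
    unfolding right_dual_basis_def
  proof (intro conjI ballI)
    fix j assume j: "j \<in> J"
    show "\<xi> j \<in> add_hom A B"
      using b(2) j unfolding left_hom_def add_hom_iff by simp
    show "\<xi> j (x \<otimes>\<^bsub>A\<^esub> h c) = \<xi> j x \<otimes>\<^bsub>B\<^esub> c" if "x \<in> carrier A" "c \<in> carrier B" for x c
      using b(2) j that unfolding left_hom_def by simp
  qed (use b in \<open>simp_all add: finsum_M\<close>)
  then show thesis by (rule that)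
qed

lemma finsum_opposite_ring [simp]: "finsum (opposite_ring A) = finsum A"
  by (simp add: finsum_def finprod_def opposite_ring_def fun_eq_iff)

lemma left_dual_basis_exists:
  fixes A :: "('a, 'i) ring_scheme" and B :: "('b, 'j) ring_scheme"
  assumes h: "ring_hom_ring B A h" and fgp: "left_fg_projective B (ring_bimod A h id)"
  obtains J m \<xi> where "right_dual_basis (opposite_ring A) (opposite_ring B) h J m \<xi>"
proof -
  interpret A: ring A using h by (simp add: ring_hom_ring_def)
  interpret B: ring B using h by (simp add: ring_hom_ring_def)
  interpret h: ring_hom_ring B A h by (rule h)
  have M: "bimodule B A (ring_bimod A h id)"
    by (intro bimodule_ring_bimod A.ring_axioms B.ring_axioms h.homh id_ring_hom)
  obtain J :: "'a set" and \<xi> m where b: "finite J"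
      "\<forall>j\<in>J. \<xi> j \<in> left_hom B (ring_bimod A h id) (ring_bimod B id id) \<and> m j \<in> carrier (ring_bimod A h id)"
      "\<forall>x\<in>carrier (ring_bimod A h id).
        x = (\<Oplus>\<^bsub>ring_bimod A h id\<^esub>j\<in>J. \<xi> j x \<odot>\<^bsub>ring_bimod A h id\<^esub> m j)"
    using dual_basis[OF bimodule_left_module[OF M] fgp] by (elim exE conjE) (erule (2) that)
  have "right_dual_basis (opposite_ring A) (opposite_ring B) h J m \<xi>"
    unfolding right_dual_basis_def
  proof (intro conjI ballI)
    fix j assume j: "j \<in> J"
    show "\<xi> j \<in> add_hom (opposite_ring A) (opposite_ring B)"
      using b(2) j unfolding left_hom_def add_hom_iff by simp
    show "\<xi> j (x \<otimes>\<^bsub>opposite_ring A\<^esub> h c) = \<xi> j x \<otimes>\<^bsub>opposite_ring B\<^esub> c"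
      if "x \<in> carrier (opposite_ring A)" "c \<in> carrier (opposite_ring B)" for x c
      using b(2) j that unfolding left_hom_def by simp
  qed (use b in simp_all)
  then show thesis by (rule that)
qed

section \<open>The tensor square of a ring extension\<close>

text \<open>
  The tensor product \<open>A \<otimes>\<^sub>B A\<close> is used only through its universal property, so that the flipped
  map \<open>(x, y) \<mapsto> \<tau> y x\<close> over the opposite rings is a further instance.  Locale assumptions being
  monomorphic, the universal property is stated for the two target groups \<open>A\<close> and \<open>T\<close> that occur.
\<close>

locale tensor_square =
  fixes A :: "('a, 'i) ring_scheme" and B :: "('b, 'j) ring_scheme" and h :: "'b \<Rightarrow> 'a"
    and T :: "('a, 'a, 't) bimodule" and \<tau> :: "'a \<Rightarrow> 'a \<Rightarrow> 't"
  assumes ring_hom: "ring_hom_ring B A h"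
    and bimodule_T: "bimodule A A T"
    and balanced_tau: "balanced B (ring_bimod A id h) (ring_bimod A h id) T \<tau>"
    and smult_tau: "\<lbrakk>a \<in> carrier A; x \<in> carrier A; y \<in> carrier A\<rbrakk> \<Longrightarrow> a \<odot>\<^bsub>T\<^esub> \<tau> x y = \<tau> (a \<otimes>\<^bsub>A\<^esub> x) y"
    and tau_rsmult: "\<lbrakk>a \<in> carrier A; x \<in> carrier A; y \<in> carrier A\<rbrakk> \<Longrightarrow> \<tau> x y \<bullet>\<^bsub>T\<^esub> a = \<tau> x (y \<otimes>\<^bsub>A\<^esub> a)"
    and lift_A: "balanced B (ring_bimod A id h) (ring_bimod A h id) A p \<Longrightarrow>
      \<exists>k\<in>add_hom T A. \<forall>x\<in>carrier A. \<forall>y\<in>carrier A. k (\<tau> x y) = p x y"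
    and lift_T: "balanced B (ring_bimod A id h) (ring_bimod A h id) T q \<Longrightarrow>
      \<exists>k\<in>add_hom T T. \<forall>x\<in>carrier A. \<forall>y\<in>carrier A. k (\<tau> x y) = q x y"
    and hom_eq_A: "\<lbrakk>f \<in> add_hom T A; g \<in> add_hom T A;
      \<And>x y. \<lbrakk>x \<in> carrier A; y \<in> carrier A\<rbrakk> \<Longrightarrow> f (\<tau> x y) = g (\<tau> x y); t \<in> carrier T\<rbrakk> \<Longrightarrow> f t = g t"
    and hom_eq_T: "\<lbrakk>f' \<in> add_hom T T; g' \<in> add_hom T T;
      \<And>x y. \<lbrakk>x \<in> carrier A; y \<in> carrier A\<rbrakk> \<Longrightarrow> f' (\<tau> x y) = g' (\<tau> x y); t \<in> carrier T\<rbrakk> \<Longrightarrow> f' t = g' t"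

lemma balanced_opposite:
  "balanced (opposite_ring B) (ring_bimod (opposite_ring A) id h) (ring_bimod (opposite_ring A) h id) G p \<longleftrightarrow>
    balanced B (ring_bimod A id h) (ring_bimod A h id) G (\<lambda>x y. p y x)"
  unfolding balanced_def by auto

lemma balanced_cong_group:
  assumes "carrier G' = carrier G" "\<And>x y. x \<oplus>\<^bsub>G'\<^esub> y = x \<oplus>\<^bsub>G\<^esub> y"
  shows "balanced S M N G' p = balanced S M N G p"
  using assms by (simp add: balanced_def)

lemma add_hom_opposite:
  "add_hom (opposite_bimod M) (opposite_bimod N) = add_hom M N"
  "add_hom (opposite_bimod M) (opposite_ring A) = add_hom M A"
  by (auto simp: hom_def)

text \<open>The tensor square of the opposite extension is \<open>T\<close> with its two factors
  swapped: the swap exchanges the two actions and preserves balancedness. Since only the universal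
  property is assumed, \<open>T\<close> itself serves again and no isomorphism between two
  constructed tensor products enters.\<close>

lemma tensor_square_opposite:
  assumes "tensor_square A B h T \<tau>"
  shows "tensor_square (opposite_ring A) (opposite_ring B) h (opposite_bimod T) (\<lambda>x y. \<tau> y x)"
proof -
  interpret tensor_square A B h T \<tau> by fact
  interpret h: ring_hom_ring B A h by (rule ring_hom)
  show ?thesis
  proof (rule tensor_square.intro)
    show "ring_hom_ring (opposite_ring B) (opposite_ring A) h"
      by (intro ring_hom_ringI2 ring_opposite_ring ring_hom_opposite_ring h.homh h.R.ring_axioms h.S.ring_axioms)
    show "bimodule (opposite_ring A) (opposite_ring A) (opposite_bimod T)"
      by (rule bimodule_opposite[OF bimodule_T])
    show "balanced (opposite_ring B) (ring_bimod (opposite_ring A) id h) (ring_bimod (opposite_ring A) h id)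
        (opposite_bimod T) (\<lambda>x y. \<tau> y x)"
      unfolding balanced_opposite using balanced_tau by (simp add: balanced_def)
    show "\<exists>k\<in>add_hom (opposite_bimod T) (opposite_ring A). \<forall>x\<in>carrier (opposite_ring A).
        \<forall>y\<in>carrier (opposite_ring A). k (\<tau> y x) = p x y"
      if "balanced (opposite_ring B) (ring_bimod (opposite_ring A) id h) (ring_bimod (opposite_ring A) h id)
        (opposite_ring A) p" for p
      using lift_A[of "\<lambda>x y. p y x"] that
      unfolding balanced_opposite add_hom_opposite
      by (auto simp: balanced_cong_group[of "opposite_ring A" A])
    show "\<exists>k\<in>add_hom (opposite_bimod T) (opposite_bimod T). \<forall>x\<in>carrier (opposite_ring A).
        \<forall>y\<in>carrier (opposite_ring A). k (\<tau> y x) = q x y"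
      if "balanced (opposite_ring B) (ring_bimod (opposite_ring A) id h) (ring_bimod (opposite_ring A) h id)
        (opposite_bimod T) q" for q
      using lift_T[of "\<lambda>x y. q y x"] that
      unfolding balanced_opposite add_hom_opposite
      by (auto simp: balanced_cong_group[of "opposite_bimod T" T])
    show "f t = g t" if "f \<in> add_hom (opposite_bimod T) (opposite_ring A)"
        "g \<in> add_hom (opposite_bimod T) (opposite_ring A)"
        "\<And>x y. \<lbrakk>x \<in> carrier (opposite_ring A); y \<in> carrier (opposite_ring A)\<rbrakk> \<Longrightarrow> f (\<tau> y x) = g (\<tau> y x)"
        "t \<in> carrier (opposite_bimod T)" for f g t
      using that unfolding add_hom_opposite opposite_ring_simps opposite_bimod_simps
      by (intro hom_eq_A[of f g t])
    show "f t = g t" if "f \<in> add_hom (opposite_bimod T) (opposite_bimod T)"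
        "g \<in> add_hom (opposite_bimod T) (opposite_bimod T)"
        "\<And>x y. \<lbrakk>x \<in> carrier (opposite_ring A); y \<in> carrier (opposite_ring A)\<rbrakk> \<Longrightarrow> f (\<tau> y x) = g (\<tau> y x)"
        "t \<in> carrier (opposite_bimod T)" for f g t
      using that unfolding add_hom_opposite opposite_ring_simps opposite_bimod_simps
      by (intro hom_eq_T[of f g t])
  qed (simp_all add: smult_tau tau_rsmult)
qed

context tensor_square
begin

interpretation A: ring A using ring_hom by (simp add: ring_hom_ring_def)
interpretation B: ring B using ring_hom by (simp add: ring_hom_ring_def)
interpretation h: ring_hom_ring B A h by (rule ring_hom)
interpretation T: bimodule A A T by (rule bimodule_T)

lemma h_hom: "h \<in> ring_hom B A"
  by (rule h.homh)

lemma tau_closed: "x \<in> carrier A \<Longrightarrow> y \<in> carrier A \<Longrightarrow> \<tau> x y \<in> carrier T"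
  using balanced_tau by (simp add: balanced_def)

lemma tau_add_hom_left: "y \<in> carrier A \<Longrightarrow> (\<lambda>x. \<tau> x y) \<in> add_hom A T"
  using balanced_tau by (simp add: balanced_def add_hom_iff)

lemma tau_add_hom_right: "x \<in> carrier A \<Longrightarrow> (\<lambda>y. \<tau> x y) \<in> add_hom A T"
  using balanced_tau by (simp add: balanced_def add_hom_iff)

lemma tau_balance:
  "x \<in> carrier A \<Longrightarrow> b \<in> carrier B \<Longrightarrow> y \<in> carrier A \<Longrightarrow> \<tau> (x \<otimes>\<^bsub>A\<^esub> h b) y = \<tau> x (h b \<otimes>\<^bsub>A\<^esub> y)"
  using balanced_tau by (simp add: balanced_def)

lemma abelian_A: "abelian_group A" and abelian_B: "abelian_group B" and abelian_T: "abelian_group T"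
  by (rule A.abelian_group_axioms B.abelian_group_axioms T.M.abelian_group_axioms)+

definition right_linear :: "('a \<Rightarrow> 'a) set"
  where "right_linear = {\<alpha> \<in> add_hom A A. \<forall>x\<in>carrier A. \<forall>b\<in>carrier B. \<alpha> (x \<otimes>\<^bsub>A\<^esub> h b) = \<alpha> x \<otimes>\<^bsub>A\<^esub> h b}"

definition endos :: "('a \<Rightarrow> 'a) set"
  where "endos = {\<beta> \<in> right_linear. \<forall>x\<in>carrier A. \<forall>b\<in>carrier B. \<beta> (h b \<otimes>\<^bsub>A\<^esub> x) = h b \<otimes>\<^bsub>A\<^esub> \<beta> x}"

definition centralizer :: "'t set"
  where "centralizer = {t \<in> carrier T. \<forall>b\<in>carrier B. h b \<odot>\<^bsub>T\<^esub> t = t \<bullet>\<^bsub>T\<^esub> h b}"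

text \<open>The maps \<open>\<alpha> \<otimes> id\<close> and \<open>x \<otimes> y \<mapsto> \<alpha>(x) y\<close>, meaningful only for right linear \<open>\<alpha>\<close>.\<close>

definition tensor_map :: "('a \<Rightarrow> 'a) \<Rightarrow> 't \<Rightarrow> 't"
  where "tensor_map \<alpha> = (SOME k. k \<in> add_hom T T \<and> (\<forall>x\<in>carrier A. \<forall>y\<in>carrier A. k (\<tau> x y) = \<tau> (\<alpha> x) y))"

definition tensor_apply :: "('a \<Rightarrow> 'a) \<Rightarrow> 't \<Rightarrow> 'a"
  where "tensor_apply \<alpha> = (SOME k. k \<in> add_hom T A \<and> (\<forall>x\<in>carrier A. \<forall>y\<in>carrier A. k (\<tau> x y) = \<alpha> x \<otimes>\<^bsub>A\<^esub> y))"

lemma right_linearD: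
  assumes "\<alpha> \<in> right_linear"
  shows "\<alpha> \<in> add_hom A A" "x \<in> carrier A \<Longrightarrow> \<alpha> x \<in> carrier A"
    "x \<in> carrier A \<Longrightarrow> b \<in> carrier B \<Longrightarrow> \<alpha> (x \<otimes>\<^bsub>A\<^esub> h b) = \<alpha> x \<otimes>\<^bsub>A\<^esub> h b"
    "x \<in> carrier A \<Longrightarrow> y \<in> carrier A \<Longrightarrow> \<alpha> (x \<oplus>\<^bsub>A\<^esub> y) = \<alpha> x \<oplus>\<^bsub>A\<^esub> \<alpha> y"
  using assms by (auto simp: right_linear_def add_hom_closed add_hom_add)

lemma endosD:
  assumes "\<beta> \<in> endos"
  shows "\<beta> \<in> right_linear" "x \<in> carrier A \<Longrightarrow> b \<in> carrier B \<Longrightarrow> \<beta> (h b \<otimes>\<^bsub>A\<^esub> x) = h b \<otimes>\<^bsub>A\<^esub> \<beta> x"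
  using assms by (auto simp: endos_def)

lemma tensor_map:
  assumes "\<alpha> \<in> right_linear"
  shows tensor_map_add_hom: "tensor_map \<alpha> \<in> add_hom T T"
    and tensor_map_tau: "x \<in> carrier A \<Longrightarrow> y \<in> carrier A \<Longrightarrow> tensor_map \<alpha> (\<tau> x y) = \<tau> (\<alpha> x) y"
proof -
  have "balanced B (ring_bimod A id h) (ring_bimod A h id) T (\<lambda>x y. \<tau> (\<alpha> x) y)"
    using right_linearD[OF assms] balanced_tau by (simp add: balanced_def)
  then have "\<exists>k. k \<in> add_hom T T \<and> (\<forall>x\<in>carrier A. \<forall>y\<in>carrier A. k (\<tau> x y) = \<tau> (\<alpha> x) y)"
    using lift_T by blast
  from someI_ex[OF this] show "tensor_map \<alpha> \<in> add_hom T T"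
      "x \<in> carrier A \<Longrightarrow> y \<in> carrier A \<Longrightarrow> tensor_map \<alpha> (\<tau> x y) = \<tau> (\<alpha> x) y"
    unfolding tensor_map_def by blast+
qed

lemma tensor_apply:
  assumes "\<alpha> \<in> right_linear"
  shows tensor_apply_add_hom: "tensor_apply \<alpha> \<in> add_hom T A"
    and tensor_apply_tau: "x \<in> carrier A \<Longrightarrow> y \<in> carrier A \<Longrightarrow> tensor_apply \<alpha> (\<tau> x y) = \<alpha> x \<otimes>\<^bsub>A\<^esub> y"
proof -
  have "balanced B (ring_bimod A id h) (ring_bimod A h id) A (\<lambda>x y. \<alpha> x \<otimes>\<^bsub>A\<^esub> y)"
    using right_linearD[OF assms] by (simp add: balanced_def A.l_distr A.r_distr A.m_assoc)
  then have "\<exists>k. k \<in> add_hom T A \<and> (\<forall>x\<in>carrier A. \<forall>y\<in>carrier A. k (\<tau> x y) = \<alpha> x \<otimes>\<^bsub>A\<^esub> y)"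
    using lift_A by blast
  from someI_ex[OF this] show "tensor_apply \<alpha> \<in> add_hom T A"
      "x \<in> carrier A \<Longrightarrow> y \<in> carrier A \<Longrightarrow> tensor_apply \<alpha> (\<tau> x y) = \<alpha> x \<otimes>\<^bsub>A\<^esub> y"
    unfolding tensor_apply_def by blast+
qed

lemma mult_add_hom_right: "a \<in> carrier A \<Longrightarrow> (\<lambda>x. x \<otimes>\<^bsub>A\<^esub> a) \<in> add_hom A A"
  by (simp add: add_hom_iff A.l_distr)

lemma mult_add_hom_left: "a \<in> carrier A \<Longrightarrow> (\<lambda>x. a \<otimes>\<^bsub>A\<^esub> x) \<in> add_hom A A"
  by (simp add: add_hom_iff A.r_distr)

lemma tensor_apply_rsmult:
  assumes \<alpha>: "\<alpha> \<in> right_linear" and a: "a \<in> carrier A" and t: "t \<in> carrier T"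
  shows "tensor_apply \<alpha> (t \<bullet>\<^bsub>T\<^esub> a) = tensor_apply \<alpha> t \<otimes>\<^bsub>A\<^esub> a"
  by (rule hom_eq_A[OF add_hom_comp[OF T.rsmult_add_hom[OF a] tensor_apply_add_hom[OF \<alpha>]]
        add_hom_comp[OF tensor_apply_add_hom[OF \<alpha>] mult_add_hom_right[OF a]] _ t])
    (simp add: a tau_rsmult tensor_apply_tau[OF \<alpha>] right_linearD[OF \<alpha>] A.m_assoc)

lemma tensor_map_rsmult:
  assumes \<alpha>: "\<alpha> \<in> right_linear" and a: "a \<in> carrier A" and t: "t \<in> carrier T"
  shows "tensor_map \<alpha> (t \<bullet>\<^bsub>T\<^esub> a) = tensor_map \<alpha> t \<bullet>\<^bsub>T\<^esub> a"
  by (rule hom_eq_T[OF add_hom_comp[OF T.rsmult_add_hom[OF a] tensor_map_add_hom[OF \<alpha>]]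
        add_hom_comp[OF tensor_map_add_hom[OF \<alpha>] T.rsmult_add_hom[OF a]] _ t])
    (simp add: a tau_rsmult tensor_map_tau[OF \<alpha>] right_linearD[OF \<alpha>])

text \<open>Left \<open>B\<close>-linearity of \<open>\<beta>\<close> lets \<open>h b\<close> pass
  out of the first factor, and \<open>\<beta> \<otimes> id\<close> commutes with the right action of
  \<open>A\<close>; so the two actions of \<open>h b\<close> still agree on the image of
  \<open>e\<close>.\<close>

lemma tensor_map_centralizer:
  assumes \<beta>: "\<beta> \<in> endos" and e: "e \<in> centralizer"
  shows "tensor_map \<beta> e \<in> centralizer"
proof -
  note \<beta>' = endosD(1)[OF \<beta>]
  have eT: "e \<in> carrier T" using e by (simp add: centralizer_def)
  have "h b \<odot>\<^bsub>T\<^esub> tensor_map \<beta> e = tensor_map \<beta> e \<bullet>\<^bsub>T\<^esub> h b" if b: "b \<in> carrier B" for b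
  proof -
    have hb: "h b \<in> carrier A" using b by simp
    have "tensor_map \<beta> (h b \<odot>\<^bsub>T\<^esub> e) = h b \<odot>\<^bsub>T\<^esub> tensor_map \<beta> e"
      by (rule hom_eq_T[OF add_hom_comp[OF T.smult_add_hom[OF hb] tensor_map_add_hom[OF \<beta>']]
            add_hom_comp[OF tensor_map_add_hom[OF \<beta>'] T.smult_add_hom[OF hb]] _ eT])
        (simp add: b hb smult_tau tensor_map_tau[OF \<beta>'] right_linearD[OF \<beta>'] endosD(2)[OF \<beta>])
    then show ?thesis
      using e b by (simp add: centralizer_def tensor_map_rsmult[OF \<beta>' hb eT])
  qed
  then show ?thesis
    using add_hom_closed[OF tensor_map_add_hom[OF \<beta>'] eT] by (simp add: centralizer_def)
qed

section \<open>Depth two through \<open>B\<close>-central tensors and \<open>B\<close>-bilinear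
  endomorphisms of \<open>A\<close>\<close>

definition right_gens :: "('a \<Rightarrow> 't) set"
  where "right_gens = {\<lambda>a. \<gamma> a \<odot>\<^bsub>T\<^esub> s | \<gamma> s. \<gamma> \<in> endos \<and> s \<in> centralizer}"

lemma right_gensI: "\<gamma> \<in> endos \<Longrightarrow> s \<in> centralizer \<Longrightarrow> (\<lambda>a. \<gamma> a \<odot>\<^bsub>T\<^esub> s) \<in> right_gens"
  unfolding right_gens_def by (intro CollectI exI[of _ \<gamma>] exI[of _ s]) simp

lemma right_gens_funcset: "right_gens \<subseteq> carrier A \<rightarrow> carrier T"
  by (auto simp: right_gens_def centralizer_def T.smult_closed right_linearD(2)[OF endosD(1)])

lemma bimodule_ring: "bimodule A B (ring_bimod A id h)" "bimodule B A (ring_bimod A h id)"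
  by (intro bimodule_ring_bimod A.ring_axioms B.ring_axioms h_hom id_ring_hom)+

lemma bimodule_restrict: "bimodule A B (restrict_scalars id h T)" "bimodule B A (restrict_scalars h id T)"
  by (intro bimodule_restrict_scalars[OF bimodule_T] A.ring_axioms B.ring_axioms h_hom id_ring_hom)+

text \<open>From \<open>x \<otimes> y = x(1 \<otimes> y) = \<Sum>\<^sub>i x \<beta>\<^sub>i(y)
  s\<^sub>i\<close>, the identity of \<open>T\<close> is the sum of the maps
  \<open>t \<mapsto> f\<^sub>i(t) s\<^sub>i\<close> with
  \<open>f\<^sub>i(x \<otimes> y) = x \<beta>\<^sub>i(y)\<close>. Each factors through
  \<open>A\<close>; centrality of \<open>s\<^sub>i\<close> makes
  \<open>a \<mapsto> a s\<^sub>i\<close> right \<open>B\<close>-linear.\<close>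

lemma right_divides_if_sum_of:
  assumes "sum_of T (carrier A) right_gens (\<lambda>a. \<tau> \<one>\<^bsub>A\<^esub> a)"
  shows "bimod_divides A B (restrict_scalars id h T) (ring_bimod A id h)"
  unfolding bimod_divides_iff[OF bimodule_restrict(1) bimodule_ring(1)]
proof -
  let ?T = "restrict_scalars id h T" and ?A = "ring_bimod A id h"
  obtain n :: nat and k where k: "\<And>i. i < n \<Longrightarrow> k i \<in> right_gens"
      and \<tau>1: "\<And>a. a \<in> carrier A \<Longrightarrow> \<tau> \<one>\<^bsub>A\<^esub> a = (\<Oplus>\<^bsub>T\<^esub>i\<in>{..<n}. k i a)"
    using assms by (rule sum_ofE) blast
  have "\<forall>i\<in>{..<n}. \<exists>\<beta> s. k i = (\<lambda>a. \<beta> a \<odot>\<^bsub>T\<^esub> s) \<and> \<beta> \<in> endos \<and> s \<in> centralizer"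
  proof
    fix i assume "i \<in> {..<n}"
    then have "k i \<in> right_gens" using k by simp
    then show "\<exists>\<beta> s. k i = (\<lambda>a. \<beta> a \<odot>\<^bsub>T\<^esub> s) \<and> \<beta> \<in> endos \<and> s \<in> centralizer"
      unfolding right_gens_def by blast
  qed
  then obtain \<beta> s where \<beta>s: "\<And>i. i < n \<Longrightarrow> k i = (\<lambda>a. \<beta> i a \<odot>\<^bsub>T\<^esub> s i)"
      "\<And>i. i < n \<Longrightarrow> \<beta> i \<in> endos" "\<And>i. i < n \<Longrightarrow> s i \<in> centralizer"
    unfolding bchoice_iff by (metis lessThan_iff)
  have sT: "s i \<in> carrier T" if "i < n" for i
    using \<beta>s(3)[OF that] by (simp add: centralizer_def)
  \<comment> \<open>Left \<open>B\<close>-linearity of \<open>\<beta> i\<close> makes the map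
    balanced; its right \<open>B\<close>-linearity enters in \<open>f_hom\<close>.\<close>
  have "\<forall>i\<in>{..<n}. \<exists>f\<in>add_hom T A. \<forall>x\<in>carrier A. \<forall>y\<in>carrier A. f (\<tau> x y) = x \<otimes>\<^bsub>A\<^esub> \<beta> i y"
  proof
    fix i assume i: "i \<in> {..<n}"
    then have "\<beta> i \<in> endos" using \<beta>s(2) by simp
    note b = right_linearD[OF endosD(1)[OF this]] endosD(2)[OF this]
    show "\<exists>f\<in>add_hom T A. \<forall>x\<in>carrier A. \<forall>y\<in>carrier A. f (\<tau> x y) = x \<otimes>\<^bsub>A\<^esub> \<beta> i y"
      by (rule lift_A) (simp add: balanced_def b A.l_distr A.r_distr A.m_assoc)
  qed
  then obtain f where f: "\<And>i. i < n \<Longrightarrow> f i \<in> add_hom T A"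
      "\<And>i x y. i < n \<Longrightarrow> x \<in> carrier A \<Longrightarrow> y \<in> carrier A \<Longrightarrow> f i (\<tau> x y) = x \<otimes>\<^bsub>A\<^esub> \<beta> i y"
    unfolding bchoice_iff by (metis lessThan_iff)
  have f_hom: "f i \<in> bimod_hom A B ?T ?A" if i: "i < n" for i
  proof -
    note b = right_linearD[OF endosD(1)[OF \<beta>s(2)[OF i]]]
    have "f i (a \<odot>\<^bsub>T\<^esub> t) = a \<otimes>\<^bsub>A\<^esub> f i t" if a: "a \<in> carrier A" and t: "t \<in> carrier T" for a t
      by (rule hom_eq_A[OF add_hom_comp[OF T.smult_add_hom[OF a] f(1)[OF i]]
            add_hom_comp[OF f(1)[OF i] mult_add_hom_left[OF a]] _ t])
        (simp add: a f(2)[OF i] smult_tau b A.m_assoc)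
    moreover have "f i (t \<bullet>\<^bsub>T\<^esub> h c) = f i t \<otimes>\<^bsub>A\<^esub> h c" if c: "c \<in> carrier B" and t: "t \<in> carrier T" for c t
    proof -
      have hc: "h c \<in> carrier A" using c by simp
      show ?thesis
        by (rule hom_eq_A[OF add_hom_comp[OF T.rsmult_add_hom[OF hc] f(1)[OF i]]
              add_hom_comp[OF f(1)[OF i] mult_add_hom_right[OF hc]] _ t])
          (simp add: c hc f(2)[OF i] tau_rsmult b A.m_assoc)
    qed
    ultimately show ?thesis
      using f(1)[OF i] unfolding bimod_hom_iff add_hom_iff by simp
  qed
  have g_hom: "(\<lambda>a. a \<odot>\<^bsub>T\<^esub> s i) \<in> bimod_hom A B ?A ?T" if i: "i < n" for i
  proof -
    have "(a \<otimes>\<^bsub>A\<^esub> h c) \<odot>\<^bsub>T\<^esub> s i = (a \<odot>\<^bsub>T\<^esub> s i) \<bullet>\<^bsub>T\<^esub> h c" if "a \<in> carrier A" "c \<in> carrier B" for a c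
      using that \<beta>s(3)[OF i] sT[OF i] by (simp add: centralizer_def T.smult_assoc T.smult_rsmult)
    then show ?thesis
      unfolding bimod_hom_iff add_hom_iff using sT[OF i]
      by (simp add: T.smult_closed T.smult_l_distr T.smult_assoc)
  qed
  show "sum_of ?T (carrier ?T) (factor_through A B ?T ?A) (\<lambda>t. t)"
  proof (rule sum_ofI[where n = n and g = "\<lambda>i t. f i t \<odot>\<^bsub>T\<^esub> s i"])
    show "(\<lambda>t. f i t \<odot>\<^bsub>T\<^esub> s i) \<in> factor_through A B ?T ?A" if "i < n" for i
      by (rule factor_throughI[OF f_hom[OF that] g_hom[OF that]])
    fix t assume "t \<in> carrier ?T"
    then have t: "t \<in> carrier T" by simp
    have sum_hom: "(\<lambda>t. \<Oplus>\<^bsub>T\<^esub>i\<in>{..<n}. f i t \<odot>\<^bsub>T\<^esub> s i) \<in> add_hom T T"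
      using f(1) sT by (intro finsum_add_hom[OF abelian_T] add_hom_comp[OF _ T.smult_add_hom_left]) auto
    have id: "(\<lambda>t. t) \<in> add_hom T T" by (simp add: add_hom_iff)
    have "t = (\<Oplus>\<^bsub>T\<^esub>i\<in>{..<n}. f i t \<odot>\<^bsub>T\<^esub> s i)"
    proof (rule hom_eq_T[OF id sum_hom _ t])
      fix x y assume x: "x \<in> carrier A" and y: "y \<in> carrier A"
      have \<beta>y: "\<beta> i y \<in> carrier A" if "i < n" for i
        using right_linearD(2)[OF endosD(1)[OF \<beta>s(2)[OF that]] y] .
      have "\<tau> x y = x \<odot>\<^bsub>T\<^esub> \<tau> \<one>\<^bsub>A\<^esub> y"
        using x y by (simp add: smult_tau)
      also have "\<dots> = x \<odot>\<^bsub>T\<^esub> (\<Oplus>\<^bsub>T\<^esub>i\<in>{..<n}. \<beta> i y \<odot>\<^bsub>T\<^esub> s i)"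
        unfolding \<tau>1[OF y] using \<beta>y sT \<beta>s(1)
        by (intro arg_cong[where f = "\<lambda>t. x \<odot>\<^bsub>T\<^esub> t"] T.M.finsum_cong') (auto simp: T.smult_closed)
      also have "\<dots> = (\<Oplus>\<^bsub>T\<^esub>i\<in>{..<n}. x \<odot>\<^bsub>T\<^esub> (\<beta> i y \<odot>\<^bsub>T\<^esub> s i))"
        using \<beta>y sT by (intro add_hom_finsum[OF abelian_T abelian_T T.smult_add_hom[OF x]])
          (auto simp: T.smult_closed)
      also have "\<dots> = (\<Oplus>\<^bsub>T\<^esub>i\<in>{..<n}. f i (\<tau> x y) \<odot>\<^bsub>T\<^esub> s i)"
        using \<beta>y sT x y by (intro T.M.finsum_cong') (auto simp: T.smult_closed T.smult_assoc f(2))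
      finally show "\<tau> x y = (\<Oplus>\<^bsub>T\<^esub>i\<in>{..<n}. f i (\<tau> x y) \<odot>\<^bsub>T\<^esub> s i)" .
    qed
    then show "t = (\<Oplus>\<^bsub>?T\<^esub>i\<in>{..<n}. f i t \<odot>\<^bsub>T\<^esub> s i)" by simp
  qed
qed

text \<open>The identity of \<open>T\<close>, written as a sum of maps
  \<open>g\<^sub>k f\<^sub>k\<close> through \<open>A\<close>, is evaluated at
  \<open>u \<otimes> 1\<close>. Right \<open>A\<close>-linearity turns
  \<open>g\<^sub>k(f\<^sub>k(u \<otimes> 1))\<close> into
  \<open>g\<^sub>k(1) f\<^sub>k(u \<otimes> 1)\<close>.\<close>

lemma left_divides_decomp:
  assumes "bimod_divides B A (restrict_scalars h id T) (ring_bimod A h id)"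
  obtains n :: nat and \<beta> t where "\<And>k. k < n \<Longrightarrow> \<beta> k \<in> endos" "\<And>k. k < n \<Longrightarrow> t k \<in> centralizer"
    "\<And>u. u \<in> carrier A \<Longrightarrow> \<tau> u \<one>\<^bsub>A\<^esub> = (\<Oplus>\<^bsub>T\<^esub>k\<in>{..<n}. t k \<bullet>\<^bsub>T\<^esub> \<beta> k u)"
proof -
  let ?T = "restrict_scalars h id T" and ?A = "ring_bimod A h id"
  obtain n :: nat and k where k: "\<And>i. i < n \<Longrightarrow> k i \<in> factor_through B A ?T ?A"
      and id: "\<And>t. t \<in> carrier ?T \<Longrightarrow> t = (\<Oplus>\<^bsub>?T\<^esub>i\<in>{..<n}. k i t)"
    using assms unfolding bimod_divides_iff[OF bimodule_restrict(2) bimodule_ring(2)]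
    by (rule sum_ofE) blast
  have "\<forall>i\<in>{..<n}. \<exists>f g. k i = (\<lambda>x. g (f x)) \<and> f \<in> bimod_hom B A ?T ?A \<and> g \<in> bimod_hom B A ?A ?T"
  proof
    fix i assume "i \<in> {..<n}"
    then have "k i \<in> factor_through B A ?T ?A" using k by simp
    then show "\<exists>f g. k i = (\<lambda>x. g (f x)) \<and> f \<in> bimod_hom B A ?T ?A \<and> g \<in> bimod_hom B A ?A ?T"
      unfolding factor_through_def by blast
  qed
  then obtain f g where fg: "\<And>i. i < n \<Longrightarrow> k i = (\<lambda>x. g i (f i x))"
      "\<And>i. i < n \<Longrightarrow> f i \<in> bimod_hom B A ?T ?A" "\<And>i. i < n \<Longrightarrow> g i \<in> bimod_hom B A ?A ?T"
    unfolding bchoice_iff by (metis lessThan_iff)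
  have f: "f i \<in> add_hom T A" "\<And>b t. b \<in> carrier B \<Longrightarrow> t \<in> carrier T \<Longrightarrow> f i (h b \<odot>\<^bsub>T\<^esub> t) = h b \<otimes>\<^bsub>A\<^esub> f i t"
      "\<And>a t. a \<in> carrier A \<Longrightarrow> t \<in> carrier T \<Longrightarrow> f i (t \<bullet>\<^bsub>T\<^esub> a) = f i t \<otimes>\<^bsub>A\<^esub> a" if "i < n" for i
    using fg(2)[OF that] unfolding bimod_hom_iff add_hom_iff by auto
  have g: "g i \<in> add_hom A T" "\<And>b x. b \<in> carrier B \<Longrightarrow> x \<in> carrier A \<Longrightarrow> g i (h b \<otimes>\<^bsub>A\<^esub> x) = h b \<odot>\<^bsub>T\<^esub> g i x"
      "\<And>a x. a \<in> carrier A \<Longrightarrow> x \<in> carrier A \<Longrightarrow> g i (x \<otimes>\<^bsub>A\<^esub> a) = g i x \<bullet>\<^bsub>T\<^esub> a" if "i < n" for i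
    using fg(3)[OF that] unfolding bimod_hom_iff add_hom_iff by auto
  show thesis
  proof (rule that[of n "\<lambda>i u. f i (\<tau> u \<one>\<^bsub>A\<^esub>)" "\<lambda>i. g i \<one>\<^bsub>A\<^esub>"])
    fix i assume i: "i < n"
    \<comment> \<open>With 1 in the second factor, \<open>h b\<close> crosses the tensor sign and
      becomes a right scalar on \<open>x \<otimes> 1\<close>.\<close>
    have "f i (\<tau> (x \<otimes>\<^bsub>A\<^esub> h b) \<one>\<^bsub>A\<^esub>) = f i (\<tau> x \<one>\<^bsub>A\<^esub>) \<otimes>\<^bsub>A\<^esub> h b"
      if "x \<in> carrier A" "b \<in> carrier B" for x b
      using f(3)[OF i, of "h b" "\<tau> x \<one>\<^bsub>A\<^esub>"] that by (simp add: tau_closed tau_rsmult tau_balance)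
    moreover have "f i (\<tau> (h b \<otimes>\<^bsub>A\<^esub> x) \<one>\<^bsub>A\<^esub>) = h b \<otimes>\<^bsub>A\<^esub> f i (\<tau> x \<one>\<^bsub>A\<^esub>)"
      if "x \<in> carrier A" "b \<in> carrier B" for x b
      using f(2)[OF i, of b "\<tau> x \<one>\<^bsub>A\<^esub>"] that by (simp add: tau_closed smult_tau)
    moreover have "(\<lambda>u. f i (\<tau> u \<one>\<^bsub>A\<^esub>)) \<in> add_hom A A"
      by (rule add_hom_comp[OF tau_add_hom_left f(1)[OF i]]) simp
    ultimately show "(\<lambda>u. f i (\<tau> u \<one>\<^bsub>A\<^esub>)) \<in> endos"
      by (simp add: endos_def right_linear_def)
    \<comment> \<open>Both sides are the image of \<open>h b\<close> under \<open>g i\<close>, once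
      by left and once by right linearity.\<close>
    have "h b \<odot>\<^bsub>T\<^esub> g i \<one>\<^bsub>A\<^esub> = g i \<one>\<^bsub>A\<^esub> \<bullet>\<^bsub>T\<^esub> h b" if b: "b \<in> carrier B" for b
    proof -
      have "h b \<in> carrier A" using b by simp
      then show ?thesis
        using g(2)[OF i b A.one_closed] g(3)[OF i _ A.one_closed, of "h b"] by simp
    qed
    then show "g i \<one>\<^bsub>A\<^esub> \<in> centralizer"
      using add_hom_closed[OF g(1)[OF i] A.one_closed] by (simp add: centralizer_def)
  next
    fix u assume u: "u \<in> carrier A"
    have "\<tau> u \<one>\<^bsub>A\<^esub> = (\<Oplus>\<^bsub>T\<^esub>i\<in>{..<n}. k i (\<tau> u \<one>\<^bsub>A\<^esub>))"
      using id[of "\<tau> u \<one>\<^bsub>A\<^esub>"] u by (simp add: tau_closed)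
    also have "\<dots> = (\<Oplus>\<^bsub>T\<^esub>i\<in>{..<n}. g i \<one>\<^bsub>A\<^esub> \<bullet>\<^bsub>T\<^esub> f i (\<tau> u \<one>\<^bsub>A\<^esub>))"
    proof (intro T.M.finsum_cong')
      have fi: "f i (\<tau> u \<one>\<^bsub>A\<^esub>) \<in> carrier A" if "i < n" for i
        using u by (intro add_hom_closed[OF f(1)[OF that]] tau_closed) auto
      show "(\<lambda>i. g i \<one>\<^bsub>A\<^esub> \<bullet>\<^bsub>T\<^esub> f i (\<tau> u \<one>\<^bsub>A\<^esub>)) \<in> {..<n} \<rightarrow> carrier T"
        using fi by (auto intro!: T.rsmult_closed add_hom_closed[OF g(1)])
      show "k i (\<tau> u \<one>\<^bsub>A\<^esub>) = g i \<one>\<^bsub>A\<^esub> \<bullet>\<^bsub>T\<^esub> f i (\<tau> u \<one>\<^bsub>A\<^esub>)" if "i \<in> {..<n}" for i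
        using that g(3)[of i "f i (\<tau> u \<one>\<^bsub>A\<^esub>)" "\<one>\<^bsub>A\<^esub>"] fi[of i] by (simp add: fg(1))
    qed simp
    finally show "\<tau> u \<one>\<^bsub>A\<^esub> = (\<Oplus>\<^bsub>T\<^esub>i\<in>{..<n}. g i \<one>\<^bsub>A\<^esub> \<bullet>\<^bsub>T\<^esub> f i (\<tau> u \<one>\<^bsub>A\<^esub>))" .
  qed
qed

text \<open>The decomposition of the identity has a single summand,
  \<open>x \<mapsto> x \<otimes> 1\<close> followed by multiplication, which is
  \<open>tensor_apply\<close> of the identity. Right \<open>B\<close>-linearity of
  \<open>x \<mapsto> x \<otimes> 1\<close> is the balancing relation.\<close>

lemma ring_divides_tensor: "bimod_divides A B (ring_bimod A id h) (restrict_scalars id h T)"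
  unfolding bimod_divides_iff[OF bimodule_ring(1) bimodule_restrict(1)]
proof -
  let ?T = "restrict_scalars id h T" and ?A = "ring_bimod A id h"
  have id: "(\<lambda>x. x) \<in> right_linear" by (simp add: right_linear_def add_hom_iff)
  define \<mu> where "\<mu> = tensor_apply (\<lambda>x. x)"
  have \<mu>: "\<mu> \<in> add_hom T A" and \<mu>\<tau>: "\<And>x y. x \<in> carrier A \<Longrightarrow> y \<in> carrier A \<Longrightarrow> \<mu> (\<tau> x y) = x \<otimes>\<^bsub>A\<^esub> y"
    using tensor_apply[OF id] by (simp_all add: \<mu>_def)
  have "\<mu> (a \<odot>\<^bsub>T\<^esub> t) = a \<otimes>\<^bsub>A\<^esub> \<mu> t" if a: "a \<in> carrier A" and t: "t \<in> carrier T" for a t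
    by (rule hom_eq_A[OF add_hom_comp[OF T.smult_add_hom[OF a] \<mu>]
          add_hom_comp[OF \<mu> mult_add_hom_left[OF a]] _ t]) (simp add: a \<mu>\<tau> smult_tau A.m_assoc)
  then have g: "\<mu> \<in> bimod_hom A B ?T ?A"
    using \<mu> tensor_apply_rsmult[OF id] unfolding bimod_hom_iff add_hom_iff by (simp add: \<mu>_def)
  have f: "(\<lambda>x. \<tau> x \<one>\<^bsub>A\<^esub>) \<in> bimod_hom A B ?A ?T"
    using tau_add_hom_left[of "\<one>\<^bsub>A\<^esub>"]
    unfolding bimod_hom_iff add_hom_iff by (simp add: smult_tau tau_rsmult tau_balance)
  have "(\<lambda>x. \<mu> (\<tau> x \<one>\<^bsub>A\<^esub>)) \<in> factor_through A B ?A ?T"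
    by (rule factor_throughI[OF f g])
  then have "sum_of ?A (carrier ?A) (factor_through A B ?A ?T) (\<lambda>x. \<mu> (\<tau> x \<one>\<^bsub>A\<^esub>))"
    using bimodule_abelian_group[OF bimodule_ring(1)] factor_through_funcset[of A B ?A ?T]
    by (intro abelian_group.sum_of_base) auto
  then show "sum_of ?A (carrier ?A) (factor_through A B ?A ?T) (\<lambda>x. x)"
    by (rule sum_of_cong[THEN iffD1, rotated]) (simp add: \<mu>\<tau>)
qed

section \<open>\<open>B\<close>-bimodule maps from \<open>A\<close> to \<open>B\<close>, and the
  Casimir elements of a dual basis\<close>

definition right_dual_functional :: "('a \<Rightarrow> 'b) \<Rightarrow> bool"
  where "right_dual_functional \<psi> \<longleftrightarrow> \<psi> \<in> add_hom A B \<and>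
    (\<forall>x\<in>carrier A. \<forall>b\<in>carrier B. \<psi> (x \<otimes>\<^bsub>A\<^esub> h b) = \<psi> x \<otimes>\<^bsub>B\<^esub> b) \<and>
    (\<forall>x\<in>carrier A. \<forall>b\<in>carrier B. \<psi> (h b \<otimes>\<^bsub>A\<^esub> x) = b \<otimes>\<^bsub>B\<^esub> \<psi> x)"

text \<open>Composition with \<open>h\<close> carries the values into \<open>A\<close>, so that
  \<open>tensor_map\<close> and \<open>tensor_apply\<close> become applicable.\<close>

lemma right_linear_functional:
  assumes "right_dual_functional \<psi>" "a \<in> carrier A"
  shows "(\<lambda>x. h (\<psi> (a \<otimes>\<^bsub>A\<^esub> x))) \<in> right_linear"
  using assms by (simp add: right_dual_functional_def right_linear_def add_hom_iff Pi_iff A.r_distr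
      A.m_assoc[symmetric])

text \<open>Applying \<open>\<psi>\<close> to the dual basis formula of \<open>x\<close> yields
  \<open>\<psi> = \<Sum>\<^sub>j \<psi>(m\<^sub>j) \<xi>\<^sub>j\<close> in the dual; left
  \<open>B\<close>-linearity of \<open>g\<close> does the rest.\<close>

lemma right_dual_expansion:
  assumes basis: "right_dual_basis A B h J m \<xi>"
    and g: "g \<in> bimod_hom B A (right_dual B (ring_bimod A id h)) (ring_bimod A h id)"
    and \<psi>: "\<psi> \<in> carrier (right_dual B (ring_bimod A id h))"
  shows "g \<psi> = (\<Oplus>\<^bsub>A\<^esub>j\<in>J. h (\<psi> (m j)) \<otimes>\<^bsub>A\<^esub> g (restrict (\<xi> j) (carrier A)))"
proof -
  let ?D = "right_dual B (ring_bimod A id h)"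
  let ?\<xi> = "\<lambda>j. restrict (\<xi> j) (carrier A)"
  interpret D: bimodule B A ?D by (rule bimodule_right_dual[OF bimodule_ring(1)])
  note b = basis[unfolded right_dual_basis_def]
  have \<psi>': "\<psi> \<in> add_hom A B" "\<And>x b. x \<in> carrier A \<Longrightarrow> b \<in> carrier B \<Longrightarrow> \<psi> (x \<otimes>\<^bsub>A\<^esub> h b) = \<psi> x \<otimes>\<^bsub>B\<^esub> b"
      "\<psi> \<in> extensional (carrier A)"
    using \<psi> by (auto simp: right_hom_def add_hom_iff)
  have \<xi>D: "?\<xi> j \<in> carrier ?D" if "j \<in> J" for j
    using b that by (auto simp: right_hom_def add_hom_iff Pi_iff)
  have m: "m j \<in> carrier A" "\<psi> (m j) \<in> carrier B" if "j \<in> J" for j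
    using b that add_hom_closed[OF \<psi>'(1)] by auto
  have summand: "\<psi> (m j) \<odot>\<^bsub>?D\<^esub> ?\<xi> j \<in> carrier ?D" if "j \<in> J" for j
    using that by (intro D.smult_closed m \<xi>D)
  have "\<psi> = (\<Oplus>\<^bsub>?D\<^esub>j\<in>J. \<psi> (m j) \<odot>\<^bsub>?D\<^esub> ?\<xi> j)"
  proof (rule extensionalityI[OF \<psi>'(3)])
    have "(\<Oplus>\<^bsub>?D\<^esub>j\<in>J. \<psi> (m j) \<odot>\<^bsub>?D\<^esub> ?\<xi> j) \<in> carrier ?D"
      by (rule D.M.finsum_closed) (use summand in blast)
    then show "(\<Oplus>\<^bsub>?D\<^esub>j\<in>J. \<psi> (m j) \<odot>\<^bsub>?D\<^esub> ?\<xi> j) \<in> extensional (carrier A)"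
      by simp
    fix x assume x: "x \<in> carrier A"
    \<comment> \<open>Additivity of evaluation turns a sum taken in the dual into a sum in
      \<open>B\<close>.\<close>
    have ev: "(\<lambda>f. f x) \<in> add_hom ?D B"
      unfolding add_hom_iff using x by (auto simp: right_hom_def)
    have \<xi>x: "\<xi> j x \<in> carrier B" if "j \<in> J" for j
      using b that x by (auto intro: add_hom_closed)
    have "\<psi> x = \<psi> (\<Oplus>\<^bsub>A\<^esub>j\<in>J. m j \<otimes>\<^bsub>A\<^esub> h (\<xi> j x))"
      using b x by auto
    also have "\<dots> = (\<Oplus>\<^bsub>B\<^esub>j\<in>J. \<psi> (m j \<otimes>\<^bsub>A\<^esub> h (\<xi> j x)))"
      using m \<xi>x by (intro add_hom_finsum[OF abelian_A abelian_B \<psi>'(1)]) auto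
    also have "\<dots> = (\<Oplus>\<^bsub>B\<^esub>j\<in>J. (\<psi> (m j) \<odot>\<^bsub>?D\<^esub> ?\<xi> j) x)"
      using m \<xi>x x by (intro B.finsum_cong') (auto simp: \<psi>'(2))
    also have "\<dots> = (\<Oplus>\<^bsub>?D\<^esub>j\<in>J. \<psi> (m j) \<odot>\<^bsub>?D\<^esub> ?\<xi> j) x"
      using summand by (intro add_hom_finsum[OF D.M.abelian_group_axioms abelian_B ev, symmetric]) blast
    finally show "\<psi> x = (\<Oplus>\<^bsub>?D\<^esub>j\<in>J. \<psi> (m j) \<odot>\<^bsub>?D\<^esub> ?\<xi> j) x" .
  qed
  then have "g \<psi> = g (\<Oplus>\<^bsub>?D\<^esub>j\<in>J. \<psi> (m j) \<odot>\<^bsub>?D\<^esub> ?\<xi> j)"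
    by (rule arg_cong)
  also have "\<dots> = (\<Oplus>\<^bsub>ring_bimod A h id\<^esub>j\<in>J. g (\<psi> (m j) \<odot>\<^bsub>?D\<^esub> ?\<xi> j))"
    using g summand unfolding bimod_hom_iff
    by (intro add_hom_finsum[OF D.M.abelian_group_axioms bimodule_abelian_group[OF bimodule_ring(2)]]) blast+
  also have "\<dots> = (\<Oplus>\<^bsub>A\<^esub>j\<in>J. h (\<psi> (m j)) \<otimes>\<^bsub>A\<^esub> g (?\<xi> j))"
  proof -
    have "g (\<psi> (m j) \<odot>\<^bsub>?D\<^esub> ?\<xi> j) = h (\<psi> (m j)) \<otimes>\<^bsub>A\<^esub> g (?\<xi> j)" if "j \<in> J" for j
      using g m(2)[OF that] \<xi>D[OF that] unfolding bimod_hom_iff by (metis ring_bimod_simps(4))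
    moreover have "g (?\<xi> j) \<in> carrier A" if "j \<in> J" for j
      using g \<xi>D[OF that] add_hom_closed unfolding bimod_hom_iff by (metis ring_bimod_simps(1))
    ultimately show ?thesis
      unfolding finsum_ring_bimod using m by (intro A.finsum_cong') auto
  qed
  finally show ?thesis .
qed

text \<open>Both claims move coefficients across the tensor sign and collect them with
  \<open>right_dual_expansion\<close>. For centrality, \<open>a m\<^sub>j\<close> is expanded in the
  \<open>m\<^sub>k\<close>, and in the second factor the coefficients
  \<open>\<xi>\<^sub>k(a m\<^sub>j)\<close> add up to
  \<open>g(\<xi>\<^sub>k a) = g(\<xi>\<^sub>k) a\<close>. For the second claim the coefficients are
  \<open>h(\<psi>(m\<^sub>j))\<close>, which leave 1 behind.\<close>

lemma dual_basis_casimir: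
  assumes basis: "right_dual_basis A B h J m \<xi>"
    and g: "g \<in> bimod_hom B A (right_dual B (ring_bimod A id h)) (ring_bimod A h id)"
  defines "e \<equiv> \<Oplus>\<^bsub>T\<^esub>j\<in>J. \<tau> (m j) (g (restrict (\<xi> j) (carrier A)))"
  shows "e \<in> centralizer"
    and "\<lbrakk>\<psi> \<in> carrier (right_dual B (ring_bimod A id h)); \<alpha> \<in> right_linear; \<And>x. x \<in> carrier A \<Longrightarrow> \<alpha> x = h (\<psi> x)\<rbrakk> \<Longrightarrow>
      tensor_map \<alpha> e = \<tau> \<one>\<^bsub>A\<^esub> (g \<psi>)"
proof -
  let ?D = "right_dual B (ring_bimod A id h)"
  define w where "w j = g (restrict (\<xi> j) (carrier A))" for j
  interpret D: bimodule B A ?D by (rule bimodule_right_dual[OF bimodule_ring(1)])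
  note b = basis[unfolded right_dual_basis_def]
  have J: "finite J" using b by simp
  have m: "m j \<in> carrier A" if "j \<in> J" for j
    using b that by auto
  have \<xi>: "\<xi> j x \<in> carrier B" if "j \<in> J" "x \<in> carrier A" for j x
    using b that by (auto intro: add_hom_closed)
  have \<xi>D: "restrict (\<xi> j) (carrier A) \<in> carrier ?D" if "j \<in> J" for j
    using b that by (auto simp: right_hom_def add_hom_iff Pi_iff)
  have w: "w j \<in> carrier A" if "j \<in> J" for j
    using g \<xi>D[OF that] add_hom_closed unfolding bimod_hom_iff w_def by (metis ring_bimod_simps(1))
  have eT: "e \<in> carrier T"
    unfolding e_def w_def[symmetric] using m w by (intro T.M.finsum_closed) (auto intro: tau_closed)
  \<comment> \<open>Commutation holds with all of \<open>A\<close>. The part kept in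
    \<open>centralizer\<close>, for \<open>a = h b\<close>, is what survives the later application
    of a \<open>B\<close>-bilinear map to the first factors.\<close>
  have "a \<odot>\<^bsub>T\<^esub> e = e \<bullet>\<^bsub>T\<^esub> a" if a: "a \<in> carrier A" for a
  proof -
    have aD: "restrict (\<xi> k) (carrier A) \<bullet>\<^bsub>?D\<^esub> a \<in> carrier ?D" if "k \<in> J" for k
      using D.rsmult_closed[OF \<xi>D[OF that] a] .
    have c: "h (\<xi> k (a \<otimes>\<^bsub>A\<^esub> m j)) \<in> carrier A" if "k \<in> J" "j \<in> J" for k j
      using that a m \<xi> by simp
    have "a \<odot>\<^bsub>T\<^esub> e = (\<Oplus>\<^bsub>T\<^esub>j\<in>J. a \<odot>\<^bsub>T\<^esub> \<tau> (m j) (w j))"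
      unfolding e_def w_def[symmetric] using m w
      by (intro add_hom_finsum[OF abelian_T abelian_T T.smult_add_hom[OF a]]) (auto intro: tau_closed)
    also have "\<dots> = (\<Oplus>\<^bsub>T\<^esub>j\<in>J. \<Oplus>\<^bsub>T\<^esub>k\<in>J. \<tau> (m k) (h (\<xi> k (a \<otimes>\<^bsub>A\<^esub> m j)) \<otimes>\<^bsub>A\<^esub> w j))"
    proof (intro T.M.finsum_cong')
      fix j assume j: "j \<in> J"
      have "a \<odot>\<^bsub>T\<^esub> \<tau> (m j) (w j) = \<tau> (a \<otimes>\<^bsub>A\<^esub> m j) (w j)"
        using j a m w by (simp add: smult_tau)
      also have "\<dots> = \<tau> (\<Oplus>\<^bsub>A\<^esub>k\<in>J. m k \<otimes>\<^bsub>A\<^esub> h (\<xi> k (a \<otimes>\<^bsub>A\<^esub> m j))) (w j)"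
        using b A.m_closed[OF a m[OF j]] by metis
      also have "\<dots> = (\<Oplus>\<^bsub>T\<^esub>k\<in>J. \<tau> (m k \<otimes>\<^bsub>A\<^esub> h (\<xi> k (a \<otimes>\<^bsub>A\<^esub> m j))) (w j))"
        using m c j by (intro add_hom_finsum[OF abelian_A abelian_T tau_add_hom_left[OF w[OF j]]]) auto
      also have "\<dots> = (\<Oplus>\<^bsub>T\<^esub>k\<in>J. \<tau> (m k) (h (\<xi> k (a \<otimes>\<^bsub>A\<^esub> m j)) \<otimes>\<^bsub>A\<^esub> w j))"
        using m c j w \<xi> a by (intro T.M.finsum_cong') (auto intro: tau_closed simp: tau_balance)
      finally show "a \<odot>\<^bsub>T\<^esub> \<tau> (m j) (w j) = \<dots>" .
    qed (use m c w in \<open>auto intro!: T.M.finsum_closed tau_closed\<close>)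
    \<comment> \<open>With \<open>j\<close> innermost, the sum for fixed \<open>k\<close> is the
      expansion of the single functional \<open>\<xi>\<^sub>k a\<close>.\<close>
    also have "\<dots> = (\<Oplus>\<^bsub>T\<^esub>k\<in>J. \<Oplus>\<^bsub>T\<^esub>j\<in>J. \<tau> (m k) (h (\<xi> k (a \<otimes>\<^bsub>A\<^esub> m j)) \<otimes>\<^bsub>A\<^esub> w j))"
      using J m c w by (intro T.M.finsum_swap) (auto intro: tau_closed)
    also have "\<dots> = (\<Oplus>\<^bsub>T\<^esub>k\<in>J. \<tau> (m k) (w k) \<bullet>\<^bsub>T\<^esub> a)"
    proof (intro T.M.finsum_cong')
      fix k assume k: "k \<in> J"
      have "(\<Oplus>\<^bsub>T\<^esub>j\<in>J. \<tau> (m k) (h (\<xi> k (a \<otimes>\<^bsub>A\<^esub> m j)) \<otimes>\<^bsub>A\<^esub> w j)) =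
          \<tau> (m k) (\<Oplus>\<^bsub>A\<^esub>j\<in>J. h (\<xi> k (a \<otimes>\<^bsub>A\<^esub> m j)) \<otimes>\<^bsub>A\<^esub> w j)"
        using m c w k by (intro add_hom_finsum[OF abelian_A abelian_T tau_add_hom_right, symmetric]) auto
      also have "(\<Oplus>\<^bsub>A\<^esub>j\<in>J. h (\<xi> k (a \<otimes>\<^bsub>A\<^esub> m j)) \<otimes>\<^bsub>A\<^esub> w j) =
          g (restrict (\<xi> k) (carrier A) \<bullet>\<^bsub>?D\<^esub> a)"
        unfolding right_dual_expansion[OF basis g aD[OF k]] w_def[symmetric]
        using m a c k w by (intro A.finsum_cong') auto
      also have "\<dots> = w k \<otimes>\<^bsub>A\<^esub> a"
        using g \<xi>D[OF k] a unfolding bimod_hom_iff w_def by (metis ring_bimod_simps(5) id_apply)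
      finally show "(\<Oplus>\<^bsub>T\<^esub>j\<in>J. \<tau> (m k) (h (\<xi> k (a \<otimes>\<^bsub>A\<^esub> m j)) \<otimes>\<^bsub>A\<^esub> w j)) = \<tau> (m k) (w k) \<bullet>\<^bsub>T\<^esub> a"
        using m w k a by (simp add: tau_rsmult)
    qed (use m w a in \<open>auto intro!: T.rsmult_closed tau_closed\<close>)
    also have "\<dots> = e \<bullet>\<^bsub>T\<^esub> a"
      unfolding e_def w_def[symmetric] using m w
      by (intro add_hom_finsum[OF abelian_T abelian_T T.rsmult_add_hom[OF a], symmetric])
        (auto intro: tau_closed)
    finally show ?thesis .
  qed
  then show "e \<in> centralizer"
    using eT by (simp add: centralizer_def)
  assume \<psi>: "\<psi> \<in> carrier ?D" and lin: "\<alpha> \<in> right_linear"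
    and \<alpha>: "\<And>x. x \<in> carrier A \<Longrightarrow> \<alpha> x = h (\<psi> x)"
  have \<psi>m: "\<psi> (m j) \<in> carrier B" if "j \<in> J" for j
    using \<psi> m[OF that] by (auto simp: right_hom_def)
  have "tensor_map \<alpha> e = (\<Oplus>\<^bsub>T\<^esub>j\<in>J. tensor_map \<alpha> (\<tau> (m j) (w j)))"
    unfolding e_def w_def[symmetric] using m w
    by (intro add_hom_finsum[OF abelian_T abelian_T tensor_map_add_hom[OF lin]]) (auto intro: tau_closed)
  also have "\<dots> = (\<Oplus>\<^bsub>T\<^esub>j\<in>J. \<tau> \<one>\<^bsub>A\<^esub> (h (\<psi> (m j)) \<otimes>\<^bsub>A\<^esub> w j))"
    using m w \<psi>m tau_balance[of "\<one>\<^bsub>A\<^esub>"]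
    by (intro T.M.finsum_cong') (auto intro: tau_closed simp: tensor_map_tau[OF lin] \<alpha>)
  also have "\<dots> = \<tau> \<one>\<^bsub>A\<^esub> (\<Oplus>\<^bsub>A\<^esub>j\<in>J. h (\<psi> (m j)) \<otimes>\<^bsub>A\<^esub> w j)"
    using \<psi>m w by (intro add_hom_finsum[OF abelian_A abelian_T tau_add_hom_right, symmetric]) auto
  also have "\<dots> = \<tau> \<one>\<^bsub>A\<^esub> (g \<psi>)"
    unfolding right_dual_expansion[OF basis g \<psi>] w_def ..
  finally show "tensor_map \<alpha> e = \<tau> \<one>\<^bsub>A\<^esub> (g \<psi>)" .
qed

text \<open>The QF divisibility writes the identity of \<open>A\<close> as a sum of maps
  \<open>g\<^sub>i f\<^sub>i\<close> through the right dual. In the second factor of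
  \<open>1 \<otimes> a\<close> this produces \<open>1 \<otimes> g\<^sub>i(f\<^sub>i(a))\<close>,
  which \<open>dual_basis_casimir\<close> recovers from the Casimir element of
  \<open>g\<^sub>i\<close>.\<close>

lemma right_QF_decomp:
  assumes basis: "right_dual_basis A B h J m \<xi>"
    and div: "bimod_divides B A (ring_bimod A h id) (right_dual B (ring_bimod A id h))"
  shows "sum_of T (carrier A)
    {\<lambda>a. tensor_map (\<lambda>x. h (\<psi> (a \<otimes>\<^bsub>A\<^esub> x))) e | \<psi> e. right_dual_functional \<psi> \<and> e \<in> centralizer}
    (\<lambda>a. \<tau> \<one>\<^bsub>A\<^esub> a)" (is "sum_of T _ ?G _")
proof -
  let ?D = "right_dual B (ring_bimod A id h)" and ?A = "ring_bimod A h id"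
  have D: "bimodule B A ?D" by (rule bimodule_right_dual[OF bimodule_ring(1)])
  obtain n :: nat and k where k: "\<And>i. i < n \<Longrightarrow> k i \<in> factor_through B A ?A ?D"
      and id: "\<And>x. x \<in> carrier ?A \<Longrightarrow> x = (\<Oplus>\<^bsub>?A\<^esub>i\<in>{..<n}. k i x)"
    using div unfolding bimod_divides_iff[OF bimodule_ring(2) D]
    by (rule sum_ofE) blast
  have G: "?G \<subseteq> carrier A \<rightarrow> carrier T"
    by (auto simp: centralizer_def intro: add_hom_closed[OF tensor_map_add_hom[OF right_linear_functional]])
  have "\<tau> \<one>\<^bsub>A\<^esub> a = (\<Oplus>\<^bsub>T\<^esub>i\<in>{..<n}. \<tau> \<one>\<^bsub>A\<^esub> (k i a))" if a: "a \<in> carrier A" for a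
  proof -
    have "\<tau> \<one>\<^bsub>A\<^esub> a = \<tau> \<one>\<^bsub>A\<^esub> (\<Oplus>\<^bsub>A\<^esub>i\<in>{..<n}. k i a)"
      using id[of a] a by simp
    also have "\<dots> = (\<Oplus>\<^bsub>T\<^esub>i\<in>{..<n}. \<tau> \<one>\<^bsub>A\<^esub> (k i a))"
      using k a factor_through_funcset[of B A ?A ?D]
      by (intro add_hom_finsum[OF abelian_A abelian_T tau_add_hom_right]) fastforce+
    finally show "\<tau> \<one>\<^bsub>A\<^esub> a = (\<Oplus>\<^bsub>T\<^esub>i\<in>{..<n}. \<tau> \<one>\<^bsub>A\<^esub> (k i a))" .
  qed
  moreover have "sum_of T (carrier A) ?G (\<lambda>a. \<Oplus>\<^bsub>T\<^esub>i\<in>{..<n}. \<tau> \<one>\<^bsub>A\<^esub> (k i a))"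
  proof (rule T.M.sum_of_finsum[OF _ G])
    fix i assume "i \<in> {..<n}"
    then have "k i \<in> factor_through B A ?A ?D" using k by simp
    then obtain f g where f: "f \<in> bimod_hom B A ?A ?D" and g: "g \<in> bimod_hom B A ?D ?A"
        and fg: "k i = (\<lambda>x. g (f x))"
      unfolding factor_through_def by blast
    \<comment> \<open>Right \<open>A\<close>-linearity makes \<open>f a\<close> the functional
      \<open>\<psi>(a -)\<close>, so \<open>f\<close> is determined by its value at 1. Comparing
      this with left linearity at \<open>h b\<close> shows that \<open>\<psi>\<close> is left
      \<open>B\<close>-linear.\<close>
    define \<psi> where "\<psi> = f \<one>\<^bsub>A\<^esub>"
    define e where "e = (\<Oplus>\<^bsub>T\<^esub>j\<in>J. \<tau> (m j) (g (restrict (\<xi> j) (carrier A))))"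
    have fD: "f a \<in> carrier ?D" if "a \<in> carrier A" for a
      using f that unfolding bimod_hom_iff add_hom_iff by auto
    have fa: "f a x = \<psi> (a \<otimes>\<^bsub>A\<^esub> x)" if "a \<in> carrier A" "x \<in> carrier A" for a x
    proof -
      have "f (\<one>\<^bsub>A\<^esub> \<bullet>\<^bsub>?A\<^esub> a) = f \<one>\<^bsub>A\<^esub> \<bullet>\<^bsub>?D\<^esub> a"
        using f that(1) A.one_closed unfolding bimod_hom_iff ring_bimod_simps(1) by blast
      then show ?thesis using that by (simp add: \<psi>_def)
    qed
    have fb: "f (h b) x = b \<otimes>\<^bsub>B\<^esub> \<psi> x" if "b \<in> carrier B" "x \<in> carrier A" for b x
    proof -
      have "f (b \<odot>\<^bsub>?A\<^esub> \<one>\<^bsub>A\<^esub>) = b \<odot>\<^bsub>?D\<^esub> f \<one>\<^bsub>A\<^esub>"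
        using f that(1) A.one_closed unfolding bimod_hom_iff ring_bimod_simps(1) by blast
      then show ?thesis using that by (simp add: \<psi>_def)
    qed
    have \<psi>: "right_dual_functional \<psi>"
      using fD[OF A.one_closed] fb fa[of "h _"] unfolding right_dual_functional_def add_hom_iff
      by (auto simp: \<psi>_def right_hom_def)
    have "\<tau> \<one>\<^bsub>A\<^esub> (k i a) = tensor_map (\<lambda>x. h (\<psi> (a \<otimes>\<^bsub>A\<^esub> x))) e" if a: "a \<in> carrier A" for a
    proof -
      have "(\<lambda>x. h (\<psi> (a \<otimes>\<^bsub>A\<^esub> x))) \<in> right_linear"
        by (rule right_linear_functional[OF \<psi> a])
      from dual_basis_casimir(2)[OF basis g fD[OF a] this] fa[OF a]
      show ?thesis unfolding e_def fg by simp
    qed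
    moreover have "sum_of T (carrier A) ?G (\<lambda>a. tensor_map (\<lambda>x. h (\<psi> (a \<otimes>\<^bsub>A\<^esub> x))) e)"
    proof -
      have "e \<in> centralizer" unfolding e_def by (rule dual_basis_casimir(1)[OF basis g])
      with \<psi> have "(\<lambda>a. tensor_map (\<lambda>x. h (\<psi> (a \<otimes>\<^bsub>A\<^esub> x))) e) \<in> ?G" by blast
      then show ?thesis using G by (intro T.M.sum_of_base) auto
    qed
    ultimately show "sum_of T (carrier A) ?G (\<lambda>a. \<tau> \<one>\<^bsub>A\<^esub> (k i a))"
      by (subst sum_of_cong) auto
  qed simp
  ultimately show ?thesis by (subst sum_of_cong) auto
qed

text \<open>With \<open>\<alpha>\<^sub>a = h \<psi>(a -)\<close>, applying
  \<open>x \<otimes> y \<mapsto> \<alpha>\<^sub>a(x) y\<close> to the left depth two formula gives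
  \<open>\<alpha>\<^sub>a(u) = \<Sum>\<^sub>k \<gamma>\<^sub>k(a) \<beta>\<^sub>k(u)\<close>, where
  \<open>\<gamma>\<^sub>k(a)\<close> is \<open>tensor_apply (\<alpha> a) (t k)\<close>. Hence
  \<open>\<alpha>\<^sub>a \<otimes> id\<close> is the sum of the
  \<open>\<gamma>\<^sub>k(a) (\<beta>\<^sub>k \<otimes> id)\<close>, and the tensors obtained from
  \<open>e\<close> no longer involve \<open>a\<close>.\<close>

lemma tensor_map_functional_decomp:
  assumes left: "bimod_divides B A (restrict_scalars h id T) (ring_bimod A h id)"
    and \<psi>: "right_dual_functional \<psi>" and e: "e \<in> centralizer"
  shows "sum_of T (carrier A) right_gens (\<lambda>a. tensor_map (\<lambda>x. h (\<psi> (a \<otimes>\<^bsub>A\<^esub> x))) e)"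
proof -
  obtain n :: nat and \<beta> t where \<beta>: "\<And>k. k < n \<Longrightarrow> \<beta> k \<in> endos" and t: "\<And>k. k < n \<Longrightarrow> t k \<in> centralizer"
      and \<tau>1: "\<And>u. u \<in> carrier A \<Longrightarrow> \<tau> u \<one>\<^bsub>A\<^esub> = (\<Oplus>\<^bsub>T\<^esub>k\<in>{..<n}. t k \<bullet>\<^bsub>T\<^esub> \<beta> k u)"
    by (rule left_divides_decomp[OF left]) blast
  define \<alpha> where "\<alpha> a = (\<lambda>x. h (\<psi> (a \<otimes>\<^bsub>A\<^esub> x)))" for a
  have \<alpha>: "\<alpha> a \<in> right_linear" if "a \<in> carrier A" for a
    unfolding \<alpha>_def by (rule right_linear_functional[OF \<psi> that])
  note \<psi>' = \<psi>[unfolded right_dual_functional_def]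
  have \<psi>_closed: "\<psi> x \<in> carrier B" if "x \<in> carrier A" for x
    using \<psi>' that by (auto intro: add_hom_closed)
  have eT: "e \<in> carrier T" using e by (simp add: centralizer_def)
  have tT: "t k \<in> carrier T" if "k < n" for k using t[OF that] by (simp add: centralizer_def)
  have \<beta>cl: "\<beta> k u \<in> carrier A" if "k < n" "u \<in> carrier A" for k u
    using right_linearD(2)[OF endosD(1)[OF \<beta>[OF that(1)]] that(2)] .
  have acl: "tensor_apply (\<alpha> a) (t k) \<in> carrier A" if "k < n" "a \<in> carrier A" for k a
    by (rule add_hom_closed[OF tensor_apply_add_hom[OF \<alpha>[OF that(2)]] tT[OF that(1)]])
  have mcl: "tensor_map (\<beta> k) s \<in> carrier T" if "k < n" "s \<in> carrier T" for k s
    by (rule add_hom_closed[OF tensor_map_add_hom[OF endosD(1)[OF \<beta>[OF that(1)]]] that(2)])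
  have expand: "tensor_map (\<alpha> a) e = (\<Oplus>\<^bsub>T\<^esub>k\<in>{..<n}. tensor_apply (\<alpha> a) (t k) \<odot>\<^bsub>T\<^esub> tensor_map (\<beta> k) e)"
    if a: "a \<in> carrier A" for a
  proof (rule hom_eq_T[OF tensor_map_add_hom[OF \<alpha>[OF a]] _ _ eT])
    show "(\<lambda>s. \<Oplus>\<^bsub>T\<^esub>k\<in>{..<n}. tensor_apply (\<alpha> a) (t k) \<odot>\<^bsub>T\<^esub> tensor_map (\<beta> k) s) \<in> add_hom T T"
      using acl a \<beta> by (intro finsum_add_hom[OF abelian_T]
          add_hom_comp[OF tensor_map_add_hom T.smult_add_hom] endosD(1)) auto
    fix u v assume u: "u \<in> carrier A" and v: "v \<in> carrier A"
    have "\<alpha> a u = tensor_apply (\<alpha> a) (\<tau> u \<one>\<^bsub>A\<^esub>)"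
      using tensor_apply_tau[OF \<alpha>[OF a] u A.one_closed] right_linearD(2)[OF \<alpha>[OF a] u] by simp
    also have "\<dots> = (\<Oplus>\<^bsub>A\<^esub>k\<in>{..<n}. tensor_apply (\<alpha> a) (t k \<bullet>\<^bsub>T\<^esub> \<beta> k u))"
      unfolding \<tau>1[OF u] using tT \<beta>cl u
      by (intro add_hom_finsum[OF abelian_T abelian_A tensor_apply_add_hom[OF \<alpha>[OF a]]])
        (auto intro!: T.rsmult_closed)
    also have "\<dots> = (\<Oplus>\<^bsub>A\<^esub>k\<in>{..<n}. tensor_apply (\<alpha> a) (t k) \<otimes>\<^bsub>A\<^esub> \<beta> k u)"
      using tT \<beta>cl u acl a
      by (intro A.finsum_cong') (auto simp: tensor_apply_rsmult[OF \<alpha>[OF a]])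
    finally have "\<tau> (\<alpha> a u) v = \<tau> (\<Oplus>\<^bsub>A\<^esub>k\<in>{..<n}. tensor_apply (\<alpha> a) (t k) \<otimes>\<^bsub>A\<^esub> \<beta> k u) v"
      by simp
    also have "\<dots> = (\<Oplus>\<^bsub>T\<^esub>k\<in>{..<n}. \<tau> (tensor_apply (\<alpha> a) (t k) \<otimes>\<^bsub>A\<^esub> \<beta> k u) v)"
      using \<beta>cl u acl a by (intro add_hom_finsum[OF abelian_A abelian_T tau_add_hom_left[OF v]]) auto
    also have "\<dots> = (\<Oplus>\<^bsub>T\<^esub>k\<in>{..<n}. tensor_apply (\<alpha> a) (t k) \<odot>\<^bsub>T\<^esub> tensor_map (\<beta> k) (\<tau> u v))"
      using \<beta>cl u v acl a \<beta>
      by (intro T.M.finsum_cong') (auto simp: tensor_map_tau[OF endosD(1)] smult_tau tau_closed T.smult_closed)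
    finally show "tensor_map (\<alpha> a) (\<tau> u v) =
        (\<Oplus>\<^bsub>T\<^esub>k\<in>{..<n}. tensor_apply (\<alpha> a) (t k) \<odot>\<^bsub>T\<^esub> tensor_map (\<beta> k) (\<tau> u v))"
      using tensor_map_tau[OF \<alpha>[OF a] u v] by simp
  qed
  \<comment> \<open>Additivity and left \<open>B\<close>-linearity in \<open>a\<close> are inherited
    from \<open>\<psi>\<close>. Right linearity uses that \<open>t k\<close> is central: a factor
    \<open>h b\<close> behind \<open>a\<close> acts on \<open>t k\<close> from the left, becomes a
    right scalar, and leaves \<open>tensor_apply\<close>.\<close>
  have \<gamma>: "(\<lambda>a. tensor_apply (\<alpha> a) (t k)) \<in> endos" if k: "k < n" for k
  proof -
    have "tensor_apply (\<alpha> (a \<oplus>\<^bsub>A\<^esub> a')) (t k) = tensor_apply (\<alpha> a) (t k) \<oplus>\<^bsub>A\<^esub> tensor_apply (\<alpha> a') (t k)"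
      if a: "a \<in> carrier A" and a': "a' \<in> carrier A" for a a'
      by (rule hom_eq_A[OF tensor_apply_add_hom[OF \<alpha>[OF A.a_closed[OF a a']]]
            add_hom_plus[OF abelian_A tensor_apply_add_hom[OF \<alpha>[OF a]] tensor_apply_add_hom[OF \<alpha>[OF a']]] _ tT[OF k]])
        (use a a' \<psi>' in \<open>simp add: tensor_apply_tau \<alpha> \<alpha>_def[of _, THEN fun_cong] A.l_distr add_hom_iff Pi_iff\<close>)
    moreover have "tensor_apply (\<alpha> (h b \<otimes>\<^bsub>A\<^esub> a)) (t k) = h b \<otimes>\<^bsub>A\<^esub> tensor_apply (\<alpha> a) (t k)"
      if a: "a \<in> carrier A" and b: "b \<in> carrier B" for a b
    proof -
      have hb: "h b \<in> carrier A" using b by simp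
      show ?thesis
        by (rule hom_eq_A[OF tensor_apply_add_hom[OF \<alpha>[OF A.m_closed[OF hb a]]]
              add_hom_comp[OF tensor_apply_add_hom[OF \<alpha>[OF a]] mult_add_hom_left[OF hb]] _ tT[OF k]])
          (use a b \<psi>' in \<open>simp add: tensor_apply_tau \<alpha> \<alpha>_def[of _, THEN fun_cong] A.m_assoc \<psi>_closed\<close>)
    qed
    moreover have "tensor_apply (\<alpha> (a \<otimes>\<^bsub>A\<^esub> h b)) (t k) = tensor_apply (\<alpha> a) (t k) \<otimes>\<^bsub>A\<^esub> h b"
      if a: "a \<in> carrier A" and b: "b \<in> carrier B" for a b
    proof -
      have hb: "h b \<in> carrier A" using b by simp
      have "tensor_apply (\<alpha> (a \<otimes>\<^bsub>A\<^esub> h b)) (t k) = tensor_apply (\<alpha> a) (h b \<odot>\<^bsub>T\<^esub> t k)"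
        by (rule hom_eq_A[OF tensor_apply_add_hom[OF \<alpha>[OF A.m_closed[OF a hb]]]
              add_hom_comp[OF T.smult_add_hom[OF hb] tensor_apply_add_hom[OF \<alpha>[OF a]]] _ tT[OF k]])
          (use a b in \<open>simp add: tensor_apply_tau \<alpha> \<alpha>_def[of _, THEN fun_cong] smult_tau A.m_assoc\<close>)
      also have "h b \<odot>\<^bsub>T\<^esub> t k = t k \<bullet>\<^bsub>T\<^esub> h b"
        using t[OF k] b by (simp add: centralizer_def)
      finally show ?thesis by (simp add: tensor_apply_rsmult[OF \<alpha>[OF a] hb tT[OF k]])
    qed
    ultimately show ?thesis
      using acl[OF k] unfolding endos_def right_linear_def add_hom_iff by simp
  qed
  have "sum_of T (carrier A) right_gens (\<lambda>a. \<Oplus>\<^bsub>T\<^esub>k\<in>{..<n}. tensor_apply (\<alpha> a) (t k) \<odot>\<^bsub>T\<^esub> tensor_map (\<beta> k) e)"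
  proof (rule T.M.sum_of_finsum[OF _ right_gens_funcset])
    fix k assume "k \<in> {..<n}"
    then have "(\<lambda>a. tensor_apply (\<alpha> a) (t k) \<odot>\<^bsub>T\<^esub> tensor_map (\<beta> k) e) \<in> right_gens"
      by (intro right_gensI \<gamma> tensor_map_centralizer[OF _ e] \<beta>) auto
    then show "sum_of T (carrier A) right_gens (\<lambda>a. tensor_apply (\<alpha> a) (t k) \<odot>\<^bsub>T\<^esub> tensor_map (\<beta> k) e)"
      using right_gens_funcset by (intro T.M.sum_of_base) auto
  qed simp
  then have "sum_of T (carrier A) right_gens (\<lambda>a. tensor_map (\<alpha> a) e)"
    by (rule sum_of_cong[THEN iffD2, rotated]) (rule expand)
  then show ?thesis by (simp add: \<alpha>_def)
qed

theorem left_divides_imp_right_divides: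
  assumes "right_dual_basis A B h J m \<xi>"
    and "bimod_divides B A (ring_bimod A h id) (right_dual B (ring_bimod A id h))"
    and "bimod_divides B A (restrict_scalars h id T) (ring_bimod A h id)"
  shows "bimod_divides A B (restrict_scalars id h T) (ring_bimod A id h)"
proof (intro right_divides_if_sum_of T.M.sum_of_trans[OF right_QF_decomp right_gens_funcset])
  show "right_dual_basis A B h J m \<xi>" by fact
qed (use assms in \<open>auto intro: tensor_map_functional_decomp\<close>)

end

section \<open>Left and right depth two\<close>

lemma tensor_square_tensor_product:
  assumes h: "ring_hom_ring B A h"
  shows "tensor_square A B h (tensor_product B (ring_bimod A id h) (ring_bimod A h id))
    (tensor B (ring_bimod A id h) (ring_bimod A h id))"
proof -
  interpret A: ring A using h by (simp add: ring_hom_ring_def)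
  interpret B: ring B using h by (simp add: ring_hom_ring_def)
  interpret h: ring_hom_ring B A h by (rule h)
  interpret tensor: bimodule_tensor A B A "ring_bimod A id h" "ring_bimod A h id"
    by (intro bimodule_tensor.intro bimodule_ring_bimod A.ring_axioms B.ring_axioms h.homh id_ring_hom)
  show ?thesis
  proof (rule tensor_square.intro)
    show "\<exists>k\<in>add_hom tensor.MN A. \<forall>x\<in>carrier A. \<forall>y\<in>carrier A. k (tensor.\<tau> x y) = p x y"
      if "balanced B (ring_bimod A id h) (ring_bimod A h id) A p" for p
      by (rule tensor.tensor_lift[OF A.abelian_group_axioms that]) auto
    show "\<exists>k\<in>add_hom tensor.MN tensor.MN. \<forall>x\<in>carrier A. \<forall>y\<in>carrier A. k (tensor.\<tau> x y) = q x y"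
      if "balanced B (ring_bimod A id h) (ring_bimod A h id) tensor.MN q" for q
      by (rule tensor.tensor_lift[OF tensor.abelian_group_tensor that]) auto
    show "f t = g t" if "f \<in> add_hom tensor.MN A" "g \<in> add_hom tensor.MN A"
        "\<And>x y. \<lbrakk>x \<in> carrier A; y \<in> carrier A\<rbrakk> \<Longrightarrow> f (tensor.\<tau> x y) = g (tensor.\<tau> x y)"
        "t \<in> carrier tensor.MN" for f g t
      using tensor.tensor_hom_eq[OF A.abelian_group_axioms that(1,2) _ that(4)] that(3) by simp
    show "f t = g t" if "f \<in> add_hom tensor.MN tensor.MN" "g \<in> add_hom tensor.MN tensor.MN"
        "\<And>x y. \<lbrakk>x \<in> carrier A; y \<in> carrier A\<rbrakk> \<Longrightarrow> f (tensor.\<tau> x y) = g (tensor.\<tau> x y)"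
        "t \<in> carrier tensor.MN" for f g t
      using tensor.tensor_hom_eq[OF tensor.abelian_group_tensor that(1,2) _ that(4)] that(3) by simp
    show "a \<odot>\<^bsub>tensor.MN\<^esub> tensor.\<tau> x y = tensor.\<tau> (a \<otimes>\<^bsub>A\<^esub> x) y"
      if "a \<in> carrier A" "x \<in> carrier A" "y \<in> carrier A" for a x y
      using tensor.smult_tensor(2)[of a x y] that by simp
    show "tensor.\<tau> x y \<bullet>\<^bsub>tensor.MN\<^esub> a = tensor.\<tau> x (y \<otimes>\<^bsub>A\<^esub> a)"
      if "a \<in> carrier A" "x \<in> carrier A" "y \<in> carrier A" for a x y
      using tensor.rsmult_tensor(2)[of a x y] that by simp
  qed (rule h tensor.bimodule_tensor_product tensor.balanced_tau)+
qed

text \<open>The group and its relations use only the inner \<open>B\<close>-actions. The outer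
  scalars enter through \<open>smult\<close> and \<open>rsmult\<close> alone, so replacing an outer
  \<open>id\<close> by \<open>h\<close> is a restriction of scalars.\<close>

lemma tensor_product_restrict_scalars:
  "tensor_product B (ring_bimod A id h) (ring_bimod A h h) =
    restrict_scalars id h (tensor_product B (ring_bimod A id h) (ring_bimod A h id))"
  "tensor_product B (ring_bimod A h h) (ring_bimod A h id) =
    restrict_scalars h id (tensor_product B (ring_bimod A id h) (ring_bimod A h id))"
  by (simp_all add: tensor_product_def restrict_scalars_def tensor_kernel_def tensor_relators_def)

text \<open>The field \<open>mult\<close> has no meaning in a bimodule but still distinguishes
  records: the opposite of \<open>ring_bimod A \<phi> \<psi>\<close> retains the product of
  \<open>A\<close>, while \<open>ring_bimod\<close> of the opposite ring has the reversed one. These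
  rules erase the discrepancy.\<close>

lemma bimod_divides_mult_update:
  "bimod_divides R S (X\<lparr>monoid.mult := f\<rparr>) Y = bimod_divides R S X Y"
  "bimod_divides R S X (Y\<lparr>monoid.mult := g\<rparr>) = bimod_divides R S X Y"
  by (simp_all add: bimod_divides_def bimod_isomorphic_def bimod_sum_def bimod_power_def
      left_hom_def right_hom_def)

lemma opposite_opposite_bimod:
  fixes M :: "('r, 's, 'm) bimodule"
  shows "opposite_bimod (opposite_bimod M) = M"
  by (cases M) (simp add: opposite_bimod_def)

lemma opposite_ring_bimod:
  "opposite_bimod (ring_bimod A \<phi> \<psi>) =
    (ring_bimod (opposite_ring A) \<psi> \<phi>)\<lparr>monoid.mult := monoid.mult A\<rparr>"
  by (simp add: opposite_bimod_def ring_bimod_def opposite_ring_def)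

theorem proposition3p6:
  fixes A :: "('a, 'i) ring_scheme" and B :: "('b, 'j) ring_scheme" and h :: "'b \<Rightarrow> 'a"
  assumes "ring_hom_ring B A h"
    and "QF A B h"
  shows "left_D2 A B h \<longleftrightarrow> right_D2 A B h"
proof -
  interpret A: ring A using assms(1) by (simp add: ring_hom_ring_def)
  interpret B: ring B using assms(1) by (simp add: ring_hom_ring_def)
  interpret h: ring_hom_ring B A h by (rule assms(1))
  let ?A' = "opposite_ring A" and ?B' = "opposite_ring B"
  define T where "T = tensor_product B (ring_bimod A id h) (ring_bimod A h id)"
  interpret T: tensor_square A B h T "tensor B (ring_bimod A id h) (ring_bimod A h id)"
    unfolding T_def by (rule tensor_square_tensor_product[OF assms(1)])
  interpret T': tensor_square ?A' ?B' h "opposite_bimod T"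
      "\<lambda>x y. tensor B (ring_bimod A id h) (ring_bimod A h id) y x"
    by (rule tensor_square_opposite) unfold_locales
  note opposite = restrict_scalars_opposite opposite_ring_bimod bimod_divides_mult_update
  \<comment> \<open>The left dual is the opposite of a right dual over the opposite rings, whose
    bimodule structure is known.\<close>
  have dual: "bimodule A B (left_dual B (ring_bimod A h id))"
    using bimodule_opposite[OF bimodule_right_dual[OF T'.bimodule_ring(1)]]
    by (simp add: opposite_left_dual[symmetric] opposite_opposite_bimod)
  \<comment> \<open>In order: \<open>T | A\<close> and \<open>A | T\<close> as
    \<open>(B,A)\<close>-bimodules, \<open>T | A\<close> as \<open>(A,B)\<close>-bimodules, and the
    left QF divisibility, each matched with its form over the opposite extension.\<close>
  note div_op = bimod_divides_opposite[OF T.bimodule_restrict(2) T.bimodule_ring(2), unfolded opposite]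
    bimod_divides_opposite[OF T.bimodule_ring(2) T.bimodule_restrict(2), unfolded opposite]
    bimod_divides_opposite[OF T.bimodule_restrict(1) T.bimodule_ring(1), unfolded opposite]
    bimod_divides_opposite[OF T.bimodule_ring(1) dual, unfolded opposite opposite_left_dual]
  have right: "right_D2 A B h \<longleftrightarrow> bimod_divides A B (restrict_scalars id h T) (ring_bimod A id h)"
    unfolding right_D2_def bimod_similar_def tensor_product_restrict_scalars T_def[symmetric]
    using T.ring_divides_tensor by simp
  \<comment> \<open>That \<open>A | T\<close> as \<open>(B,A)\<close>-bimodules is
    \<open>ring_divides_tensor\<close> for the opposite extension.\<close>
  have left: "left_D2 A B h \<longleftrightarrow> bimod_divides B A (restrict_scalars h id T) (ring_bimod A h id)"
    unfolding left_D2_def bimod_similar_def tensor_product_restrict_scalars T_def[symmetric]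
    using T'.ring_divides_tensor div_op(2) by simp
  note QF = assms(2)[unfolded QF_def left_QF_def right_QF_def]
  obtain J m \<xi> where "right_dual_basis A B h J m \<xi>"
    using right_dual_basis_exists[OF assms(1)] QF by blast
  moreover obtain J' m' \<xi>' where "right_dual_basis ?A' ?B' h J' m' \<xi>'"
    using left_dual_basis_exists[OF assms(1)] QF by blast
  \<comment> \<open>The extension with its right QF data gives one implication; the opposite
    extension with the left QF data gives the other, as \<open>div_op\<close> exchanges left and
    right depth two.\<close>
  ultimately show ?thesis
    unfolding left right
    using T.left_divides_imp_right_divides T'.left_divides_imp_right_divides QF div_op by blast
qed

end
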